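(* Let $f_\infty\colon\mathbb{R}^3\times\mathbb{R}^3\to[0,\infty)$ be smooth with $\mathrm{supp}(f_\infty)\subset\{|x|+|p|\le B\}$ for some $B>0$, let $N\ge6$, and let $(f,\varrho,\phi)$ on $[T_0,\infty)$ and $f_{[K]}$, $K\ge 0$, be the modified scattering solution and the approximate solutions associated to $f_\infty$, as described in the context. Then $(f,\varrho,\phi)$ is unique in the class of solutions which agree with the approximate solutions to sufficiently high order. More precisely, there is $K=K(\mathcal{F}_\infty^{N+1})$ such that if $(f',\varrho',\phi')$ is another smooth solution of the Vlasov--Poisson system on $[T_0,\infty)\times\mathbb{R}^3\times\mathbb{R}^3$ for which there is a constant $C$ such that $$\Vert (f' - f_{[K]}) (t,\cdot,\cdot) \Vert_{L^2_x L^2_p} \leq C \frac{ (\log t)^{1+K}}{t^{1+ K}}$$ for all $t$ sufficiently large, and moreover $f'$ satisfies the support property $$\mathrm{supp}(f'(t,\cdot,\cdot)) \subset \{ (x,p) \in \mathbb{R}^3 \times \mathbb{R}^3 \mid \vert x - t p + \log t \nabla \phi_{\infty}(p) \vert \leq 2\mathcal{F}_{\infty}^3 + B,\ \vert p \vert \leq 2 B \},\qquad t\ge T_0,$$ then $(f',\varrho',\phi') = (f,\varrho,\phi)$.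
   Context: Vlasov--Poisson system: $\partial_t f + p^i \partial_{x^i} f + \partial_{x^i} \phi\, \partial_{p^i} f = 0$, $\Delta_{\mathbb{R}^3} \phi = \varrho$, $\varrho(t,x) = \int_{\mathbb{R}^3} f(t,x,p) dp$, with $\phi(t,x)\to0$ as $|x|\to\infty$. $\phi_\infty$ is the solution of $\Delta\phi_\infty=\varrho_\infty$, $\phi_\infty(p)\to0$ as $|p|\to\infty$, where $\varrho_\infty(p)=\int_{\mathbb{R}^3}f_\infty(x,p)dx$. For an increasing sequence $\{\mathfrak{n}(n)\}_{n\ge0}$ of natural numbers with $\mathfrak{n}(n)>n$, set $$\mathcal{F}_{\infty}^n = \sum_{\vert I \vert + \vert J \vert \leq n} \Big( \Vert \partial_x^I \partial_p^J f_{\infty} \Vert_{L^2_x L^2_p} + \Vert \partial_x^I \partial_p^J f_{\infty} \Vert_{L^2_x L^2_p}^{\mathfrak{n}(n)} \Big).$$ The (suitable) sequence is suppressed from the notation, does not depend on $f_\infty$, and may differ between occurrences. $K=K(\mathcal{F}_\infty^{N+1})$ means that $K$ depends only on this quantity (and on $B,N$). $\|\cdot\|_{L^2_xL^2_p}$ is the $L^2(\mathbb{R}^3_x\times\mathbb{R}^3_p)$ norm. Vector fields: $L_i = t \partial_{x^i} + \partial_{p^i} + \frac{\log t}{t} \partial_i \partial_k \phi_{\infty}(p) \partial_{p^k}$, $i=1,2,3$; for multi-indices, $L^I=L_1^{I_1}L_2^{I_2}L_3^{I_3}$, $(t^{-1}\partial_p)^J=(t^{-1}\partial_{p^1})^{J_1}(t^{-1}\partial_{p^2})^{J_2}(t^{-1}\partial_{p^3})^{J_3}$,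 and similarly for $(t\partial_x)^I$. Approximate solutions: smooth functions $f_{k,l}\colon\mathbb{R}^3\times\mathbb{R}^3\to\mathbb{R}$, $\varrho_{k,l}\colon\mathbb{R}^3\to\mathbb{R}$ ($k\ge0$, $0\le l\le k$) determined by $f_\infty$, with $f_{0,0}=f_\infty$, $\varrho_{0,0}=\varrho_\infty$, $f_{k,l}$ supported in $\{|x|\le B,|p|\le B\}$, $\varrho_{k,l}$ supported in $\{|x|\le B\}$, and $\phi_{k,l}$ the decaying solution of $\Delta\phi_{k,l}=\varrho_{k,l}$; and $$f_{[K]}(t,x,p) = \sum_{k=0}^K \sum_{l=0}^{k} \frac{(\log t)^l}{t^k} f_{k,l}\big(x-tp + \log t \, \nabla \phi_{\infty} ( p), p \big),$$ $$\varrho_{[K]}(t,x)=\frac1{t^3}\sum_{k=0}^K \sum_{l=0}^{k} \frac{(\log t)^l}{t^k}\varrho_{k,l}\Big(\frac xt\Big),\qquad \phi_{[K]}(t,x)=\frac1{t}\sum_{k=0}^K \sum_{l=0}^{k} \frac{(\log t)^l}{t^k}\phi_{k,l}\Big(\frac xt\Big).$$ Modified scattering solution: $(f,\varrho,\phi)$ is a smooth solution of Vlasov--Poisson on $[T_0,\infty)\times\mathbb{R}^3\times\mathbb{R}^3$, $f\ge0$, with $\lim_{t\to\infty} f(t,x+tp-\log t\nabla\phi_\infty(p),p)=f_\infty(x,p)$, which satisfies the same support property as required of $f'$ in the claim and, for every $K\ge0$ and $t\ge T_0$, $$\sum_{\vert I \vert + \vert J \vert \leq N} \Vert L^I (t^{-1}\partial_p)^J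 (f - f_{[K]}) (t,\cdot,\cdot) \Vert_{L^2_x L^2_p} \leq C_K (\mathcal{F}_{\infty}^{N+2K+4})^2 \frac{ (\log t)^{1+K}}{t^{1+ K}},$$ $$\sum_{\vert I \vert \leq N} \Vert (t\partial_x)^I ( \varrho - \varrho_{[K]}) \Vert_{L^2_x} \leq C_{K} \mathcal{F}_{\infty}^{N+2K+4} \frac{(\log t)^{1+K}}{t^{\frac{5}{2} + K}},\qquad \sum_{\vert I \vert \leq N} \Vert (t\partial_x)^I \nabla (\phi - \phi_{[K]}) \Vert_{L^2_x} \leq C_{K} \mathcal{F}_{\infty}^{N+2K+4} \frac{(\log t)^{1+K}}{t^{\frac{3}{2} + K}},$$ where $C_K$ depends only on $K,B,N$. (Such a solution and such approximate solutions exist for $T_0$ sufficiently large depending on $f_\infty$; they are fixed.) *)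

theory Defs
  imports "HOL-Analysis.Analysis"
begin

type_synonym vec3 = "real ^ 3"
type_synonym phase = "vec3 \<Rightarrow> vec3 \<Rightarrow> real"

section \<open>Smoothness, partial derivatives, support, square-integrability\<close>

text \<open>Derivatives are taken within \<open>S\<close>, so that on \<open>{T0..} \<times> UNIV\<close> smoothness means smoothness
  up to the boundary \<open>t = T0\<close>, with one-sided time derivatives there. It is only used for such sets
  and for the whole space, where derivatives within \<open>S\<close> are unique.\<close>

primrec Ck_on :: "nat \<Rightarrow> 'a::euclidean_space set \<Rightarrow> ('a \<Rightarrow> 'b::real_normed_vector) \<Rightarrow> bool" where
  "Ck_on 0 S f \<longleftrightarrow> continuous_on S f"
| "Ck_on (Suc k) S f \<longleftrightarrow>
     (\<exists>D. (\<forall>z\<in>S. (f has_derivative D z) (at z within S)) \<and> (\<forall>v. Ck_on k S (\<lambda>z. D z v)))"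

definition smooth_on :: "'a::euclidean_space set \<Rightarrow> ('a \<Rightarrow> 'b::real_normed_vector) \<Rightarrow> bool" where
  "smooth_on S f \<longleftrightarrow> (\<forall>k. Ck_on k S f)"

definition partial :: "'n::finite \<Rightarrow> (real^'n \<Rightarrow> 'b::real_normed_vector) \<Rightarrow> real^'n \<Rightarrow> 'b" where
  "partial i g x = vector_derivative (\<lambda>s. g (x + s *\<^sub>R axis i 1)) (at 0)"

definition grad :: "(real^'n \<Rightarrow> real) \<Rightarrow> real^'n \<Rightarrow> real^'n" where
  "grad g x = (\<chi> i. partial i g x)"

definition laplacian :: "(real^'n \<Rightarrow> real) \<Rightarrow> real^'n \<Rightarrow> real" where
  "laplacian g x = (\<Sum>i\<in>UNIV. partial i (partial i g) x)"

definition dx :: "3 \<Rightarrow> phase \<Rightarrow> phase" where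
  "dx i g = (\<lambda>x p. partial i (\<lambda>y. g y p) x)"

definition dp :: "3 \<Rightarrow> phase \<Rightarrow> phase" where
  "dp i g = (\<lambda>x p. partial i (\<lambda>q. g x q) p)"

definition supp :: "('a::topological_space \<Rightarrow> 'b::zero) \<Rightarrow> 'a set" where
  "supp g = closure {z. g z \<noteq> 0}"

definition in_L2 :: "('a::euclidean_space \<Rightarrow> 'b::euclidean_space) \<Rightarrow> bool" where
  "in_L2 g \<longleftrightarrow> g \<in> borel_measurable lborel \<and> integrable lborel (\<lambda>z. (norm (g z))\<^sup>2)"

text \<open>Since the Bochner integral of a non-integrable function is \<open>0\<close>, every bound on \<open>L2norm\<close>
  below is accompanied by \<open>in_L2\<close>.\<close>

definition L2norm :: "('a::euclidean_space \<Rightarrow> 'b::euclidean_space) \<Rightarrow> real" where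
  "L2norm g = sqrt (\<integral>z. (norm (g z))\<^sup>2 \<partial>lborel)"

section \<open>Multi-indices\<close>

definition mabs :: "nat ^ 3 \<Rightarrow> nat" where
  "mabs I = (\<Sum>i\<in>UNIV. I $ i)"

definition mpow :: "(3 \<Rightarrow> 'a \<Rightarrow> 'a) \<Rightarrow> nat ^ 3 \<Rightarrow> 'a \<Rightarrow> 'a" where
  "mpow D I = (D 1 ^^ (I $ 1)) \<circ> (D 2 ^^ (I $ 2)) \<circ> (D 3 ^^ (I $ 3))"

text \<open>The index sets of the sums below are finite, so these sums are genuine.\<close>

lemma finite_mabs_le: "finite {I. mabs I \<le> n}"
proof -
  have "I $ i \<le> n" if "mabs I \<le> n" for I i
    using that member_le_sum[of i UNIV "($) I"] unfolding mabs_def by force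
  then have "{I. mabs I \<le> n} \<subseteq> vec_lambda ` (UNIV \<rightarrow>\<^sub>E {..n})"
    by (intro subsetI rev_image_eqI[where f = vec_lambda, OF _ vec_nth_inverse[symmetric]]) auto
  then show ?thesis by (rule finite_subset) (intro finite_imageI finite_PiE; simp)
qed

lemma finite_mabs_pair_le: "finite {(I, J). mabs I + mabs J \<le> n}"
  by (rule finite_subset[of _ "{I. mabs I \<le> n} \<times> {J. mabs J \<le> n}"])
     (auto simp: finite_mabs_le)

section \<open>The Vlasov--Poisson system\<close>

definition poisson_solution :: "(vec3 \<Rightarrow> real) \<Rightarrow> (vec3 \<Rightarrow> real) \<Rightarrow> bool" where
  "poisson_solution \<rho> \<phi> \<longleftrightarrow>
     smooth_on UNIV \<phi> \<and> (\<forall>x. laplacian \<phi> x = \<rho> x) \<and> (\<phi> \<longlongrightarrow> 0) at_infinity"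

definition VP_solution ::
  "real \<Rightarrow> (real \<Rightarrow> phase) \<Rightarrow> (real \<Rightarrow> vec3 \<Rightarrow> real) \<Rightarrow> (real \<Rightarrow> vec3 \<Rightarrow> real) \<Rightarrow> bool" where
  "VP_solution T0 f \<rho> \<phi> \<longleftrightarrow>
     smooth_on ({T0..} \<times> UNIV) (\<lambda>(t, x, p). f t x p) \<and>
     smooth_on ({T0..} \<times> UNIV) (\<lambda>(t, x). \<rho> t x) \<and>
     smooth_on ({T0..} \<times> UNIV) (\<lambda>(t, x). \<phi> t x) \<and>
     (\<forall>t\<ge>T0.
        (\<forall>x p. vector_derivative (\<lambda>s. f s x p) (at t within {T0..})
                 + (\<Sum>i\<in>UNIV. p $ i * dx i (f t) x p)
                 + (\<Sum>i\<in>UNIV. partial i (\<phi> t) x * dp i (f t) x p) = 0) \<and>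
        (\<forall>x. laplacian (\<phi> t) x = \<rho> t x) \<and>
        (\<forall>x. has_bochner_integral lborel (\<lambda>p. f t x p) (\<rho> t x)) \<and>
        (\<phi> t \<longlongrightarrow> 0) at_infinity)"

section \<open>Scattering data\<close>

definition scattering_data :: "real \<Rightarrow> phase \<Rightarrow> bool" where
  "scattering_data B f_inf \<longleftrightarrow>
     smooth_on UNIV (\<lambda>(x, p). f_inf x p) \<and> (\<forall>x p. 0 \<le> f_inf x p) \<and>
     supp (\<lambda>(x, p). f_inf x p) \<subseteq> {(x, p). norm x + norm p \<le> B}"

definition rho_inf :: "phase \<Rightarrow> vec3 \<Rightarrow> real" where
  "rho_inf f_inf p = (\<integral>x. f_inf x p \<partial>lborel)"

definition exponent_seq :: "(nat \<Rightarrow> nat) \<Rightarrow> bool" where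
  "exponent_seq \<nu> \<longleftrightarrow> strict_mono \<nu> \<and> (\<forall>n. n < \<nu> n)"

definition F_inf :: "(nat \<Rightarrow> nat) \<Rightarrow> phase \<Rightarrow> nat \<Rightarrow> real" where
  "F_inf \<nu> f_inf n =
     (\<Sum>(I, J)\<in>{(I, J). mabs I + mabs J \<le> n}.
        L2norm (\<lambda>(x, p). mpow dx I (mpow dp J f_inf) x p)
        + L2norm (\<lambda>(x, p). mpow dx I (mpow dp J f_inf) x p) ^ \<nu> n)"

definition support_property ::
  "(nat \<Rightarrow> nat) \<Rightarrow> real \<Rightarrow> phase \<Rightarrow> (vec3 \<Rightarrow> real) \<Rightarrow> real \<Rightarrow> (real \<Rightarrow> phase) \<Rightarrow> bool" where
  "support_property \<nu> B f_inf phi_inf T0 f \<longleftrightarrow>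
     (\<forall>t\<ge>T0. supp (\<lambda>(x, p). f t x p) \<subseteq>
        {(x, p). norm (x - t *\<^sub>R p + ln t *\<^sub>R grad phi_inf p) \<le> 2 * F_inf \<nu> f_inf 3 + B
                 \<and> norm p \<le> 2 * B})"

section \<open>Approximate solutions\<close>

text \<open>Only the entries with \<open>l \<le> k\<close> of the coefficient families are used.\<close>

definition approx_coeffs ::
  "real \<Rightarrow> phase \<Rightarrow> (nat \<Rightarrow> nat \<Rightarrow> phase) \<Rightarrow> (nat \<Rightarrow> nat \<Rightarrow> vec3 \<Rightarrow> real)
     \<Rightarrow> (nat \<Rightarrow> nat \<Rightarrow> vec3 \<Rightarrow> real) \<Rightarrow> bool" where
  "approx_coeffs B f_inf fc rhoc phic \<longleftrightarrow>
     fc 0 0 = f_inf \<and> rhoc 0 0 = rho_inf f_inf \<and>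
     (\<forall>k. \<forall>l\<le>k.
        smooth_on UNIV (\<lambda>(x, p). fc k l x p) \<and>
        supp (\<lambda>(x, p). fc k l x p) \<subseteq> {(x, p). norm x \<le> B \<and> norm p \<le> B} \<and>
        smooth_on UNIV (rhoc k l) \<and>
        supp (rhoc k l) \<subseteq> {x. norm x \<le> B} \<and>
        poisson_solution (rhoc k l) (phic k l))"

definition f_approx :: "(vec3 \<Rightarrow> real) \<Rightarrow> (nat \<Rightarrow> nat \<Rightarrow> phase) \<Rightarrow> nat \<Rightarrow> real \<Rightarrow> phase" where
  "f_approx phi_inf fc K t x p =
     (\<Sum>k\<le>K. \<Sum>l\<le>k. (ln t) ^ l / t ^ k * fc k l (x - t *\<^sub>R p + ln t *\<^sub>R grad phi_inf p) p)"

definition rho_approx :: "(nat \<Rightarrow> nat \<Rightarrow> vec3 \<Rightarrow> real) \<Rightarrow> nat \<Rightarrow> real \<Rightarrow> vec3 \<Rightarrow> real" where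
  "rho_approx rhoc K t x = 1 / t ^ 3 * (\<Sum>k\<le>K. \<Sum>l\<le>k. (ln t) ^ l / t ^ k * rhoc k l (x /\<^sub>R t))"

definition phi_approx :: "(nat \<Rightarrow> nat \<Rightarrow> vec3 \<Rightarrow> real) \<Rightarrow> nat \<Rightarrow> real \<Rightarrow> vec3 \<Rightarrow> real" where
  "phi_approx phic K t x = 1 / t * (\<Sum>k\<le>K. \<Sum>l\<le>k. (ln t) ^ l / t ^ k * phic k l (x /\<^sub>R t))"

section \<open>Modified scattering solutions\<close>

definition Lfield :: "(vec3 \<Rightarrow> real) \<Rightarrow> real \<Rightarrow> 3 \<Rightarrow> phase \<Rightarrow> phase" where
  "Lfield phi_inf t i g = (\<lambda>x p.
     t * dx i g x p + dp i g x p
     + ln t / t * (\<Sum>k\<in>UNIV. partial i (partial k phi_inf) p * dp k g x p))"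

definition scaled_dp :: "real \<Rightarrow> 3 \<Rightarrow> phase \<Rightarrow> phase" where
  "scaled_dp t i g = (\<lambda>x p. dp i g x p / t)"

definition scaled_dx :: "real \<Rightarrow> 3 \<Rightarrow> (vec3 \<Rightarrow> 'b::real_normed_vector) \<Rightarrow> vec3 \<Rightarrow> 'b" where
  "scaled_dx t i g = (\<lambda>x. t *\<^sub>R partial i g x)"

definition f_estimate where
  "f_estimate \<nu> (C :: nat \<Rightarrow> real) N f_inf phi_inf fc T0 (f :: real \<Rightarrow> phase) \<longleftrightarrow>
     (\<forall>K. \<forall>t\<ge>T0.
        let D = (\<lambda>I J (x, p). mpow (Lfield phi_inf t) I (mpow (scaled_dp t) J
                   (\<lambda>x p. f t x p - f_approx phi_inf fc K t x p)) x p)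
        in (\<forall>I J. mabs I + mabs J \<le> N \<longrightarrow> in_L2 (D I J)) \<and>
           (\<Sum>(I, J)\<in>{(I, J). mabs I + mabs J \<le> N}. L2norm (D I J))
             \<le> C K * (F_inf \<nu> f_inf (N + 2 * K + 4))\<^sup>2 * (ln t) ^ (1 + K) / t ^ (1 + K))"

definition rho_estimate where
  "rho_estimate \<nu> (C :: nat \<Rightarrow> real) N f_inf rhoc T0 (\<rho> :: real \<Rightarrow> vec3 \<Rightarrow> real) \<longleftrightarrow>
     (\<forall>K. \<forall>t\<ge>T0.
        let D = (\<lambda>I. mpow (scaled_dx t) I (\<lambda>x. \<rho> t x - rho_approx rhoc K t x))
        in (\<forall>I. mabs I \<le> N \<longrightarrow> in_L2 (D I)) \<and>
           (\<Sum>I\<in>{I. mabs I \<le> N}. L2norm (D I))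
             \<le> C K * F_inf \<nu> f_inf (N + 2 * K + 4) * (ln t) ^ (1 + K) / t powr (5 / 2 + real K))"

definition phi_estimate where
  "phi_estimate \<nu> (C :: nat \<Rightarrow> real) N f_inf phic T0 (\<phi> :: real \<Rightarrow> vec3 \<Rightarrow> real) \<longleftrightarrow>
     (\<forall>K. \<forall>t\<ge>T0.
        let D = (\<lambda>I. mpow (scaled_dx t) I (grad (\<lambda>x. \<phi> t x - phi_approx phic K t x)))
        in (\<forall>I. mabs I \<le> N \<longrightarrow> in_L2 (D I)) \<and>
           (\<Sum>I\<in>{I. mabs I \<le> N}. L2norm (D I))
             \<le> C K * F_inf \<nu> f_inf (N + 2 * K + 4) * (ln t) ^ (1 + K) / t powr (3 / 2 + real K))"

text \<open>The exponent sequence hidden in each occurrence of \<open>F_inf\<close> may be different: \<open>\<nu>s\<close> is that of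
  the support property, \<open>\<nu>f\<close>, \<open>\<nu>r\<close>, \<open>\<nu>p\<close> those of the three estimates.\<close>

definition modified_scattering_solution where
  "modified_scattering_solution \<nu>s \<nu>f \<nu>r \<nu>p C B N f_inf phi_inf fc rhoc phic T0 f \<rho> \<phi> \<longleftrightarrow>
     VP_solution T0 f \<rho> \<phi> \<and>
     (\<forall>t\<ge>T0. \<forall>x p. 0 \<le> f t x p) \<and>
     (\<forall>x p. ((\<lambda>t. f t (x + t *\<^sub>R p - ln t *\<^sub>R grad phi_inf p) p) \<longlongrightarrow> f_inf x p) at_top) \<and>
     support_property \<nu>s B f_inf phi_inf T0 f \<and>
     f_estimate \<nu>f C N f_inf phi_inf fc T0 f \<and>
     rho_estimate \<nu>r C N f_inf rhoc T0 \<rho> \<and>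
     phi_estimate \<nu>p C N f_inf phic T0 \<phi>"

end

theory Submission imports Defs begin

text \<open>
Let \<open>g = f' - f\<close> and \<open>\<psi> = \<phi>' - \<phi>\<close>, so that \<open>\<Delta>\<psi> = \<integral> g dp\<close>. The transport part of the equation for
\<open>g\<close> is a divergence, hence \<open>y t = \<parallel>g t\<parallel>\<^sup>2\<close> has the derivative \<open>- 2 \<integral>\<integral> \<nabla>\<psi> \<cdot> \<partial>\<^sub>p f g\<close>
(\<open>energy_identity\<close>). The heart of the proof is the bound \<open>\<bar>y' t\<bar> \<le> m / t * y t\<close> for large \<open>t\<close>, with
\<open>m\<close> a function of \<open>B\<close> and of the norm of \<open>f_inf\<close> of order \<open>N + 1\<close> (\<open>force_growth_rate\<close>). It makes
\<open>t powr m * y t\<close> nondecreasing. Both solutions are close to the same approximate solution, so \<open>y t\<close>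
is of order \<open>t\<close> to the power \<open>- 2 (1 + K)\<close> up to logarithms, and for \<open>K \<ge> m\<close> the product tends to \<open>0\<close>; hence \<open>y = 0\<close>
for large times (\<open>y_eq_0_if_fast_decay\<close>). On a compact time interval the same inequality holds with
some constant in place of \<open>m / t\<close>, which carries \<open>y = 0\<close> back to \<open>T0\<close> (\<open>y_eq_0_backward\<close>).

The rate \<open>1 / t\<close> is a balance of powers of \<open>t\<close> (\<open>force_term_bound\<close>).
Both solutions live in \<open>\<bar>x\<bar> \<le> 3 B t\<close>, and over each \<open>x\<close> the momenta lie in a ball of radius \<open>O(1/t)\<close>,
that is, of volume \<open>P = O(t\<^sup>-\<^sup>3)\<close>, so that \<open>\<parallel>\<Delta>\<psi>\<parallel>\<^sup>2 \<le> P \<parallel>g\<parallel>\<^sup>2\<close> by Cauchy--Schwarz.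
A source supported in \<open>\<bar>x\<bar> \<le> R\<close> satisfies \<open>\<parallel>\<nabla>\<psi>\<parallel> \<le> 4 R \<parallel>\<Delta>\<psi>\<parallel>\<close> on that ball
(\<open>poisson_energy_estimate\<close>). Finally \<open>\<integral> \<bar>\<partial>\<^sub>p f\<bar>\<^sup>2 dp = O(1/t)\<close> uniformly in \<open>x\<close>. With \<open>R\<^sup>2 = O(t\<^sup>2)\<close> these
factors multiply to \<open>O(t\<^sup>-\<^sup>2)\<close>, the square of the rate.

For the last bound, \<open>f\<close> is split into the leading approximation and a remainder. The leading
approximation has \<open>\<bar>\<partial>\<^sub>p f\<bar> \<le> t (sup \<bar>\<partial>\<^sub>x f_inf\<bar> + o(1))\<close> on a momentum ball of volume \<open>O(t\<^sup>-\<^sup>3)\<close>, and a Sobolev inequality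
on \<open>\<real>\<^sup>6\<close> controls the supremum by derivatives of \<open>f_inf\<close> of order \<open>7 \<le> N + 1\<close> (\<open>abs_dx_f_inf_le\<close>).
For the remainder only \<open>L\<^sup>2\<close> bounds with the vector fields \<open>L\<^sub>i\<close> are known. They suffice, because under an
integral over \<open>p\<close> the derivative \<open>t \<partial>\<^sub>x\<close> can be traded for \<open>L\<^sub>i\<close> at the cost of a bounded zero order
term: a Sobolev inequality in \<open>x\<close> alone then uses three of the \<open>L\<^sub>i\<close> (\<open>velocity_average_bound\<close>). The
remainder contributes \<open>o(1/t)\<close>, so \<open>m\<close> depends on the leading term only, while the time after
which the bounds hold may depend on the solution in an arbitrary way.\<close>

section \<open>Directional derivatives of smooth functions\<close>

text \<open>Directional derivatives along lines: the operators \<open>partial\<close>, \<open>dx\<close> and \<open>dp\<close> are all instances, the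
last two after uncurrying, so that one calculus serves both \<open>\<real>\<^sup>3\<close> and the phase space.\<close>
definition dird :: "'a::real_normed_vector \<Rightarrow> ('a \<Rightarrow> 'b::real_normed_vector) \<Rightarrow> 'a \<Rightarrow> 'b" where
  "dird v f x = vector_derivative (\<lambda>s. f (x + s *\<^sub>R v)) (at 0)"

lemma has_derivative_along_line:
  assumes "(f has_derivative D) (at (x + s *\<^sub>R v))"
  shows "((\<lambda>s. f (x + s *\<^sub>R v)) has_vector_derivative D v) (at s)"
proof -
  have l: "((\<lambda>s. x + s *\<^sub>R v) has_derivative (\<lambda>h. h *\<^sub>R v)) (at s)"
    by (auto intro!: derivative_eq_intros)
  have "((\<lambda>s. f (x + s *\<^sub>R v)) has_derivative (\<lambda>h. D (h *\<^sub>R v))) (at s)"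
    by (rule has_derivative_compose[OF l]) (use assms in simp)
  moreover have "D (h *\<^sub>R v) = h *\<^sub>R D v" for h
    using assms has_derivative_bounded_linear linear_simps(5) bounded_linear.linear linear_cmul by metis
  ultimately show ?thesis by (simp add: has_vector_derivative_def)
qed

lemma dird_eqI: "(f has_derivative D) (at x) \<Longrightarrow> dird v f x = D v"
  unfolding dird_def using has_derivative_along_line[of f D x 0 v]
  by (simp add: vector_derivative_at)

abbreviation smooth :: "('a::euclidean_space \<Rightarrow> 'b::real_normed_vector) \<Rightarrow> bool" where
  "smooth f \<equiv> smooth_on UNIV f"

text \<open>On the whole space the derivative in the definition of \<open>Ck_on\<close> is unique, which turns the
existential quantifier into a statement about \<open>dird\<close>; the closure properties below are inductions
along this recursion.\<close>
lemma Ck_Suc_iff: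
  "Ck_on (Suc k) UNIV f \<longleftrightarrow>
    (\<forall>x. (f has_derivative (\<lambda>v. dird v f x)) (at x)) \<and> (\<forall>v. Ck_on k UNIV (dird v f))"
  (is "?L \<longleftrightarrow> ?R")
proof
  assume ?L
  then obtain D where D: "\<And>z. (f has_derivative D z) (at z)" "\<And>v. Ck_on k UNIV (\<lambda>z. D z v)"
    by auto
  have "(\<lambda>v. dird v f z) = D z" "dird v f = (\<lambda>z. D z v)" for z v
    using dird_eqI[OF D(1)] by auto
  then show ?R using D by auto
next
  assume ?R
  then show ?L by auto
qed

lemma Ck_continuous: "Ck_on k S f \<Longrightarrow> continuous_on S f"
  by (cases k) (auto simp: continuous_on_eq_continuous_within intro: has_derivative_continuous)

lemma Ck_Suc_imp: "Ck_on (Suc k) S f \<Longrightarrow> Ck_on k S f"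
proof (induction k arbitrary: f)
  case 0
  then show ?case using Ck_continuous[of "Suc 0"] by auto
next
  case (Suc k)
  then obtain D where "\<forall>z\<in>S. (f has_derivative D z) (at z within S)" "\<And>v. Ck_on (Suc k) S (\<lambda>z. D z v)"
    by auto
  then show ?case using Suc.IH unfolding Ck_on.simps(2)[of k S f] by blast
qed

lemma smooth_has_derivative: "smooth f \<Longrightarrow> (f has_derivative (\<lambda>v. dird v f x)) (at x)"
  unfolding smooth_on_def using Ck_Suc_iff by blast

lemma smooth_dird: "smooth f \<Longrightarrow> smooth (dird v f)"
  unfolding smooth_on_def using Ck_Suc_iff by blast

lemma smooth_continuous: "smooth f \<Longrightarrow> continuous_on A f"
  unfolding smooth_on_def using Ck_continuous continuous_on_subset by blast

lemma smooth_along_line: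
  "smooth f \<Longrightarrow> ((\<lambda>s. f (x + s *\<^sub>R v)) has_vector_derivative dird v f (x + s *\<^sub>R v)) (at s)"
  by (rule has_derivative_along_line[OF smooth_has_derivative])

lemma smooth_along_line0:
  "smooth f \<Longrightarrow> ((\<lambda>s. f (x + s *\<^sub>R v)) has_vector_derivative dird v f x) (at 0)"
  using smooth_along_line[of f x v 0] by simp

lemma smooth_DERIV_along_line:
  fixes f :: "'a::euclidean_space \<Rightarrow> real"
  shows "smooth f \<Longrightarrow> ((\<lambda>s. f (x + s *\<^sub>R v)) has_real_derivative dird v f (x + s *\<^sub>R v)) (at s)"
  and "smooth f \<Longrightarrow> ((\<lambda>s. f (x + s *\<^sub>R v)) has_real_derivative dird v f x) (at 0)"
  unfolding has_real_derivative_iff_has_vector_derivative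
  by (rule smooth_along_line smooth_along_line0, assumption)+

subsection \<open>Closure properties\<close>

lemma Ck_const: "Ck_on k UNIV (\<lambda>x. c)"
proof (induction k arbitrary: c)
  case (Suc k)
  then show ?case by (auto intro!: exI[of _ "\<lambda>_ _. 0"])
qed simp

lemma Ck_linear:
  assumes "bounded_linear f" shows "Ck_on k UNIV f"
proof (cases k)
  case 0
  then show ?thesis using assms by (simp add: linear_continuous_on)
next
  case (Suc n)
  then show ?thesis using assms Ck_const
    by (auto intro!: exI[of _ "\<lambda>_. f"] bounded_linear_imp_has_derivative)
qed

lemma Ck_add: "Ck_on k UNIV f \<Longrightarrow> Ck_on k UNIV g \<Longrightarrow> Ck_on k UNIV (\<lambda>x. f x + g x)"
proof (induction k arbitrary: f g)
  case 0
  then show ?case by (auto intro: continuous_intros)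
next
  case (Suc k)
  then show ?case
    unfolding Ck_Suc_iff[of k f] Ck_Suc_iff[of k g]
    by (auto intro!: exI[of _ "\<lambda>z v. dird v f z + dird v g z"] derivative_intros)
qed

lemma Ck_bilinear:
  assumes B: "bounded_bilinear B"
  shows "Ck_on k UNIV f \<Longrightarrow> Ck_on k UNIV g \<Longrightarrow> Ck_on k UNIV (\<lambda>x. B (f x) (g x))"
proof (induction k arbitrary: f g)
  case 0
  then show ?case using bounded_bilinear.continuous_on[OF B] by auto
next
  case (Suc k)
  note f = Suc.prems(1)[unfolded Ck_Suc_iff] and g = Suc.prems(2)[unfolded Ck_Suc_iff]
  show ?case
    unfolding Ck_on.simps
  proof (intro exI conjI ballI allI)
    show "((\<lambda>x. B (f x) (g x)) has_derivative (\<lambda>v. B (f z) (dird v g z) + B (dird v f z) (g z))) (at z)" for z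
      using bounded_bilinear.FDERIV[OF B] f g by blast
    show "Ck_on k UNIV (\<lambda>z. B (f z) (dird v g z) + B (dird v f z) (g z))" for v
      by (intro Ck_add Suc.IH Ck_Suc_imp[OF Suc.prems(1)] Ck_Suc_imp[OF Suc.prems(2)] f[THEN conjunct2, rule_format]
          g[THEN conjunct2, rule_format])
  qed
qed

lemma Ck_sum: "(\<And>i. i \<in> A \<Longrightarrow> Ck_on k UNIV (f i)) \<Longrightarrow> Ck_on k UNIV (\<lambda>x. \<Sum>i\<in>A. f i x)"
  by (induction A rule: infinite_finite_induct) (auto intro: Ck_add Ck_const)

lemma Ck_compose:
  fixes f :: "'b::euclidean_space \<Rightarrow> 'c::real_normed_vector" and g :: "'a::euclidean_space \<Rightarrow> 'b"
  shows "Ck_on k UNIV f \<Longrightarrow> Ck_on k UNIV g \<Longrightarrow> Ck_on k UNIV (\<lambda>x. f (g x))"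
proof (induction k arbitrary: f)
  case 0
  then show ?case using continuous_on_compose2[of UNIV f UNIV g] by auto
next
  case (Suc k)
  note f = Suc.prems(1)[unfolded Ck_Suc_iff] and g = Suc.prems(2)[unfolded Ck_Suc_iff]
  \<comment> \<open>The direction depends on the point; expanding it in a basis restores fixed directions.\<close>
  have *: "dird (dird v g z) f (g z) = (\<Sum>b\<in>Basis. (dird v g z \<bullet> b) *\<^sub>R dird b f (g z))" for v z
  proof -
    have l: "linear (\<lambda>v. dird v f (g z))"
      using f has_derivative_bounded_linear bounded_linear.linear by blast
    have "dird (\<Sum>b\<in>Basis. (dird v g z \<bullet> b) *\<^sub>R b) f (g z) = (\<Sum>b\<in>Basis. dird ((dird v g z \<bullet> b) *\<^sub>R b) f (g z))"
      by (rule linear_sum[OF l])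
    also have "\<dots> = (\<Sum>b\<in>Basis. (dird v g z \<bullet> b) *\<^sub>R dird b f (g z))"
      by (rule sum.cong[OF refl], rule linear_cmul[OF l])
    finally show ?thesis unfolding euclidean_representation .
  qed
  show ?case
    unfolding Ck_on.simps
  proof (intro exI conjI ballI allI)
    show "((\<lambda>x. f (g x)) has_derivative (\<lambda>v. dird (dird v g z) f (g z))) (at z)" for z
      by (rule has_derivative_compose[of g _ z UNIV f]) (use f g in auto)
    have "Ck_on k UNIV (\<lambda>z. (dird v g z \<bullet> b) *\<^sub>R dird b f (g z))" for v b
    proof (rule Ck_bilinear[OF bounded_bilinear_scaleR])
      show "Ck_on k UNIV (\<lambda>z. dird v g z \<bullet> b)"
        by (rule Ck_bilinear[OF bounded_bilinear_inner]) (use g Ck_const in auto)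
      show "Ck_on k UNIV (\<lambda>z. dird b f (g z))"
        using Suc f Ck_Suc_imp by blast
    qed
    then show "Ck_on k UNIV (\<lambda>z. dird (dird v g z) f (g z))" for v
      unfolding * by (intro Ck_sum) 
  qed
qed

named_theorems smooth_intros

lemma smooth_const[smooth_intros]: "smooth (\<lambda>x. c)"
  unfolding smooth_on_def using Ck_const by blast
lemma smooth_linear: "bounded_linear f \<Longrightarrow> smooth f"
  unfolding smooth_on_def using Ck_linear by blast
lemma smooth_id[smooth_intros]: "smooth (\<lambda>x. x)"
  by (rule smooth_linear) (rule bounded_linear_ident)
lemma smooth_add[smooth_intros]: "smooth f \<Longrightarrow> smooth g \<Longrightarrow> smooth (\<lambda>x. f x + g x)"
  unfolding smooth_on_def using Ck_add by blast
lemma smooth_bilinear: "bounded_bilinear B \<Longrightarrow> smooth f \<Longrightarrow> smooth g \<Longrightarrow> smooth (\<lambda>x. B (f x) (g x))"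
  unfolding smooth_on_def using Ck_bilinear by blast
lemmas smooth_scaleR[smooth_intros] = smooth_bilinear[OF bounded_bilinear_scaleR]
lemma smooth_mult[smooth_intros]:
  fixes f g :: "'a::euclidean_space \<Rightarrow> real"
  shows "smooth f \<Longrightarrow> smooth g \<Longrightarrow> smooth (\<lambda>x. f x * g x)"
  by (rule smooth_bilinear[OF bounded_bilinear_mult])
lemmas smooth_inner[smooth_intros] = smooth_bilinear[OF bounded_bilinear_inner]
lemma smooth_sum[smooth_intros]: "(\<And>i. i \<in> A \<Longrightarrow> smooth (f i)) \<Longrightarrow> smooth (\<lambda>x. \<Sum>i\<in>A. f i x)"
  unfolding smooth_on_def by (intro allI Ck_sum) simp
lemma smooth_compose:
  fixes f :: "'b::euclidean_space \<Rightarrow> 'c::real_normed_vector" and g :: "'a::euclidean_space \<Rightarrow> 'b"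
  shows "smooth f \<Longrightarrow> smooth g \<Longrightarrow> smooth (\<lambda>x. f (g x))"
  unfolding smooth_on_def using Ck_compose by blast
lemma smooth_minus[smooth_intros]: "smooth f \<Longrightarrow> smooth (\<lambda>x. - f x)"
  using smooth_scaleR[OF smooth_const, of f "-1"] by simp
lemma smooth_diff[smooth_intros]: "smooth f \<Longrightarrow> smooth g \<Longrightarrow> smooth (\<lambda>x. f x - g x)"
  using smooth_add[OF _ smooth_minus, of f g] by simp
lemma smooth_power2[smooth_intros]:
  fixes f :: "'a::euclidean_space \<Rightarrow> real" shows "smooth f \<Longrightarrow> smooth (\<lambda>x. (f x)\<^sup>2)"
  unfolding power2_eq_square by (rule smooth_mult)
lemma smooth_fst[smooth_intros]:
  fixes g :: "'a::euclidean_space \<Rightarrow> 'b::euclidean_space \<times> 'c::euclidean_space"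
  shows "smooth g \<Longrightarrow> smooth (\<lambda>x. fst (g x))"
  by (rule smooth_compose[OF smooth_linear[OF bounded_linear_fst]])
lemma smooth_snd[smooth_intros]:
  fixes g :: "'a::euclidean_space \<Rightarrow> 'b::euclidean_space \<times> 'c::euclidean_space"
  shows "smooth g \<Longrightarrow> smooth (\<lambda>x. snd (g x))"
  by (rule smooth_compose[OF smooth_linear[OF bounded_linear_snd]])

lemma smooth_Pair[smooth_intros]:
  fixes f :: "'a::euclidean_space \<Rightarrow> 'b::euclidean_space" and g :: "'a \<Rightarrow> 'c::euclidean_space"
  assumes "smooth f" "smooth g" shows "smooth (\<lambda>x. (f x, g x))"
proof -
  have "bounded_linear (\<lambda>x::'b. (x, 0::'c))" "bounded_linear (\<lambda>y::'c. (0::'b, y))"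
    by (auto intro!: bounded_linear_Pair bounded_linear_ident bounded_linear_zero)
  then have "smooth (\<lambda>x. (f x, 0::'c) + (0::'b, g x))"
    by (intro smooth_add smooth_compose[OF smooth_linear assms(1)] smooth_compose[OF smooth_linear assms(2)])
  then show ?thesis by simp
qed

subsection \<open>Rules for directional derivatives\<close>

lemma dird_const: "dird v (\<lambda>x. c) = (\<lambda>x. 0)"
  by (rule ext, rule dird_eqI) (auto intro!: derivative_eq_intros)

lemma dird_add: "smooth f \<Longrightarrow> smooth g \<Longrightarrow> dird v (\<lambda>x. f x + g x) x = dird v f x + dird v g x"
  by (rule dird_eqI) (intro has_derivative_add smooth_has_derivative)

lemma dird_diff: "smooth f \<Longrightarrow> smooth g \<Longrightarrow> dird v (\<lambda>x. f x - g x) x = dird v f x - dird v g x"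
  by (rule dird_eqI) (intro has_derivative_diff smooth_has_derivative)

lemma dird_mult:
  fixes f g :: "'a::euclidean_space \<Rightarrow> real"
  shows "smooth f \<Longrightarrow> smooth g \<Longrightarrow> dird v (\<lambda>x. f x * g x) x = f x * dird v g x + dird v f x * g x"
  by (rule dird_eqI[OF has_derivative_mult]; (erule smooth_has_derivative)?)

lemma dird_compose:
  fixes f :: "'b::euclidean_space \<Rightarrow> 'c::real_normed_vector" and g :: "'a::euclidean_space \<Rightarrow> 'b"
  assumes "smooth f" "smooth g"
  shows "dird v (\<lambda>x. f (g x)) x = dird (dird v g x) f (g x)"
  using dird_eqI[OF has_derivative_compose[OF smooth_has_derivative[OF assms(2), of x]
      smooth_has_derivative[OF assms(1), of "g x"]], of v] by simp

lemma linear_dird: "smooth f \<Longrightarrow> linear (\<lambda>v. dird v f x)"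
  using smooth_has_derivative has_derivative_bounded_linear bounded_linear.linear by blast

text \<open>Clairaut's theorem: by the fundamental theorem of calculus
\<open>f (x + t v) - f x = \<integral> \<partial>\<^sub>v f\<close> along the segment; differentiating in the direction \<open>u\<close> under the integral and
then at \<open>t = 0\<close> gives both orders.\<close>
lemma dird_commute:
  fixes f :: "'a::euclidean_space \<Rightarrow> 'b::banach"
  assumes f: "smooth f"
  shows "dird u (dird v f) x = dird v (dird u f) x"
proof -
  let ?F = "\<lambda>s \<tau>. dird v f (x + s *\<^sub>R u + \<tau> *\<^sub>R v)"
  let ?F' = "\<lambda>s \<tau>. dird u (dird v f) (x + s *\<^sub>R u + \<tau> *\<^sub>R v)"
  have ftc: "integral {0..t} (?F s) = f (x + s *\<^sub>R u + t *\<^sub>R v) - f (x + s *\<^sub>R u)" if "0 \<le> t" for s t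
  proof -
    have "(?F s has_integral f (x + s *\<^sub>R u + t *\<^sub>R v) - f (x + s *\<^sub>R u + 0 *\<^sub>R v)) {0..t}"
      by (rule fundamental_theorem_of_calculus[OF that])
        (rule has_vector_derivative_at_within, rule smooth_along_line[OF f])
    then show ?thesis by (simp add: integral_unique)
  qed
  have "integral {0..t} (?F' 0) = dird u f (x + t *\<^sub>R v) - dird u f x" if "0 \<le> t" for t
  proof -
    have "((\<lambda>s. integral (cbox 0 t) (?F s)) has_vector_derivative integral (cbox 0 t) (?F' 0)) (at 0 within UNIV)"
    proof (rule leibniz_rule_vector_derivative)
      show "((\<lambda>s. ?F s \<tau>) has_vector_derivative ?F' s \<tau>) (at s)" for s \<tau>
      proof -
        have eq: "x + \<tau> *\<^sub>R v + s *\<^sub>R u = x + s *\<^sub>R u + \<tau> *\<^sub>R v" for s by simp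
        show ?thesis
          using smooth_along_line[OF smooth_dird[OF f], of v "x + \<tau> *\<^sub>R v" u s]
          by (simp only: eq)
      qed
      show "?F s integrable_on cbox 0 t" for s
        by (intro integrable_continuous continuous_on_compose2[OF smooth_continuous[OF smooth_dird[OF f], of UNIV]]
            continuous_intros) auto
      show "continuous_on (UNIV \<times> cbox 0 t) (\<lambda>(s, \<tau>). ?F' s \<tau>)"
        unfolding case_prod_beta
        by (intro continuous_on_compose2[OF smooth_continuous[OF smooth_dird[OF smooth_dird[OF f]], of UNIV]]
            continuous_intros) auto
    qed auto
    then have "((\<lambda>s. f (x + s *\<^sub>R u + t *\<^sub>R v) - f (x + s *\<^sub>R u)) has_vector_derivative integral (cbox 0 t) (?F' 0)) (at 0)"
      unfolding box_real ftc[OF that] .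
    moreover have eq: "x + t *\<^sub>R v + s *\<^sub>R u = x + s *\<^sub>R u + t *\<^sub>R v" for s by simp
    have "((\<lambda>s. f (x + s *\<^sub>R u + t *\<^sub>R v) - f (x + s *\<^sub>R u)) has_vector_derivative
        dird u f (x + t *\<^sub>R v) - dird u f x) (at 0)"
      using has_vector_derivative_diff[OF smooth_along_line0[OF f, of "x + t *\<^sub>R v" u] smooth_along_line0[OF f, of x u]]
      by (simp only: eq)
    ultimately show ?thesis using vector_derivative_unique_at by fastforce
  qed
  then have I: "integral {0..t} (?F' 0) = dird u f (x + t *\<^sub>R v) - dird u f x" if "t \<in> {0..1}" for t
    using that by auto
  have cont: "continuous_on {0..1} (?F' 0)"
    by (intro continuous_on_compose2[OF smooth_continuous[OF smooth_dird[OF smooth_dird[OF f]], of UNIV]]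
            continuous_intros) auto
  have "((\<lambda>t. integral {0..t} (?F' 0)) has_vector_derivative ?F' 0 0) (at 0 within {0..1})"
    by (rule integral_has_vector_derivative[OF cont]) simp
  then have 1: "((\<lambda>t. dird u f (x + t *\<^sub>R v) - dird u f x) has_vector_derivative ?F' 0 0) (at 0 within {0..1})"
    by (rule has_vector_derivative_transform[rotated 2]) (use I in auto)
  have 2: "((\<lambda>t. dird u f (x + t *\<^sub>R v) - dird u f x) has_vector_derivative dird v (dird u f) x) (at 0 within {0..1})"
    using has_vector_derivative_at_within[OF smooth_along_line0[OF smooth_dird[OF f], of u x v]]
    by (auto intro!: derivative_eq_intros)
  show ?thesis
    using vector_derivative_unique_within[OF _ 1 2] by (simp add: trivial_limit_within islimpt_Icc)
qed

subsection \<open>Slices and partial derivatives\<close>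

lemma partial_eq_dird: "partial i = dird (axis i 1)"
  by (intro ext) (simp add: partial_def dird_def)

lemma dx_eq_dird: "case_prod (dx i g) = dird (axis i 1, 0) (case_prod g)"
  by (intro ext) (auto simp: dx_def partial_def dird_def)

lemma dp_eq_dird: "case_prod (dp i g) = dird (0, axis i 1) (case_prod g)"
  by (intro ext) (auto simp: dp_def partial_def dird_def)

lemma smooth_grad:
  fixes \<phi> :: "vec3 \<Rightarrow> real"
  shows "smooth \<phi> \<Longrightarrow> smooth (grad \<phi>)"
proof -
  assume s: "smooth \<phi>"
  have "grad \<phi> = (\<lambda>x. \<Sum>i\<in>UNIV. partial i \<phi> x *\<^sub>R axis i 1)"
    by (auto simp: fun_eq_iff grad_def vec_eq_iff axis_def if_distrib cong: if_cong)
  then show ?thesis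
    using s by (auto intro!: smooth_intros smooth_dird simp: partial_eq_dird)
qed

subsection \<open>Functions of bounded support\<close>

text \<open>Compact support, phrased without closures so that it passes to products and derivatives by
pointwise arguments.\<close>
definition bsupp :: "('a::real_normed_vector \<Rightarrow> 'b::zero) \<Rightarrow> bool" where
  "bsupp f \<longleftrightarrow> (\<exists>r. \<forall>x. norm x > r \<longrightarrow> f x = 0)"

lemma bsuppI: "(\<And>x. f x \<noteq> 0 \<Longrightarrow> norm x \<le> r) \<Longrightarrow> bsupp f"
  unfolding bsupp_def by (meson not_le)

lemma bsuppE:
  assumes "bsupp f" obtains r where "r > 0" "\<And>x. f x \<noteq> 0 \<Longrightarrow> norm x \<le> r"
proof -
  obtain r where "\<forall>x. norm x > r \<longrightarrow> f x = 0" using assms unfolding bsupp_def by auto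
  then have "f x \<noteq> 0 \<Longrightarrow> norm x \<le> max r 1" for x by (meson le_max_iff_disj not_le)
  then show ?thesis by (intro that[of "max r 1"]) auto
qed

lemma bsupp_mono: "bsupp f \<Longrightarrow> (\<And>x. g x \<noteq> 0 \<Longrightarrow> f x \<noteq> 0) \<Longrightarrow> bsupp g"
  unfolding bsupp_def by blast

lemma bsupp_mult_left: "bsupp f \<Longrightarrow> bsupp (\<lambda>x. f x * g x :: 'b::mult_zero)"
  and bsupp_mult_right: "bsupp f \<Longrightarrow> bsupp (\<lambda>x. g x * f x :: 'b::mult_zero)"
  by (auto elim!: bsupp_mono)

lemma bsupp_add: "bsupp f \<Longrightarrow> bsupp g \<Longrightarrow> bsupp (\<lambda>x. f x + g x :: 'b::monoid_add)"
proof (elim bsuppE)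
  fix r r' assume "\<And>x. f x \<noteq> 0 \<Longrightarrow> norm x \<le> r" "\<And>x. g x \<noteq> 0 \<Longrightarrow> norm x \<le> r'"
  then show ?thesis by (intro bsuppI[of _ "max r r'"]) (metis add.right_neutral le_max_iff_disj)
qed

lemma bsupp_sum: "(\<And>i. i \<in> A \<Longrightarrow> bsupp (f i)) \<Longrightarrow> bsupp (\<lambda>x. \<Sum>i\<in>A. f i x :: 'b::comm_monoid_add)"
  by (induction A rule: infinite_finite_induct) (auto intro: bsupp_add simp: bsupp_def[of "\<lambda>_. 0"])

lemma dird_eq_0_outside:
  assumes "\<And>x. f x \<noteq> 0 \<Longrightarrow> x \<in> S" "closed S" "x \<notin> S" shows "dird v f x = 0"
proof (rule dird_eqI)
  show "(f has_derivative (\<lambda>v. 0)) (at x)"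
  proof (rule has_derivative_transform_within_open)
    show "((\<lambda>x. 0) has_derivative (\<lambda>v. 0)) (at x)" by (rule has_derivative_const)
    show "open (- S)" "x \<in> - S" using assms by auto
    show "0 = f x" if "x \<in> - S" for x using that assms(1)[of x] by (metis ComplD)
  qed
qed

lemma bsupp_dird:
  assumes "bsupp f" shows "bsupp (dird v f)"
proof -
  obtain r where r: "\<And>x. f x \<noteq> 0 \<Longrightarrow> norm x \<le> r" by (rule bsuppE[OF assms]) blast
  show ?thesis
    by (rule bsuppI[of _ r]) (use dird_eq_0_outside[of f "cball 0 r"] r in \<open>force\<close>)
qed

lemma integrable_bsupp:
  fixes f :: "'a::euclidean_space \<Rightarrow> 'b::euclidean_space"
  assumes "continuous_on UNIV f" "bsupp f"
  shows "integrable lborel f"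
proof -
  obtain r where r: "\<And>x. f x \<noteq> 0 \<Longrightarrow> norm x \<le> r" by (rule bsuppE[OF assms(2)]) blast
  have "integrable lborel (\<lambda>x. indicator (cball 0 r) x *\<^sub>R f x)"
    using assms by (intro borel_integrable_compact) (auto intro: continuous_on_subset)
  also have "(\<lambda>x. indicator (cball 0 r) x *\<^sub>R f x) = f"
    using r by (force simp: indicator_def)
  finally show ?thesis .
qed

lemma smooth_family_bounded_on_cball:
  fixes c :: "'i::finite \<Rightarrow> 'a::euclidean_space \<Rightarrow> 'b::real_normed_vector"
  assumes "\<And>i. smooth (c i)"
  obtains K where "K \<ge> 0" "\<And>i p. norm p \<le> P \<Longrightarrow> norm (c i p) \<le> K"
proof -
  have "\<exists>K\<ge>0. \<forall>p. norm p \<le> P \<longrightarrow> norm (c i p) \<le> K" for i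
  proof -
    have "compact (c i ` cball 0 P)"
      by (intro compact_continuous_image smooth_continuous assms compact_cball)
    then obtain K where "\<And>y. y \<in> c i ` cball 0 P \<Longrightarrow> norm y \<le> K"
      using compact_imp_bounded bounded_iff by metis
    then show ?thesis by (intro exI[of _ "max K 0"]) (force simp: le_max_iff_disj)
  qed
  then obtain K where K: "\<And>i. K i \<ge> 0" "\<And>i p. norm p \<le> P \<Longrightarrow> norm (c i p) \<le> K i" by metis
  have "K i \<le> sum K UNIV" for i by (rule member_le_sum) (use K in auto)
  then have "norm (c i p) \<le> sum K UNIV" if "norm p \<le> P" for i p
    using K(2)[OF that, of i] by (meson order_trans)
  then show ?thesis using K(1) by (intro that[of "sum K UNIV"]) (auto intro: sum_nonneg)
qed

lemma smooth_bounded_on_cball: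
  fixes h :: "'a::euclidean_space \<Rightarrow> 'b::real_normed_vector"
  assumes "smooth h"
  obtains K where "K \<ge> 0" "\<And>p. norm p \<le> P \<Longrightarrow> norm (h p) \<le> K"
  using smooth_family_bounded_on_cball[of "\<lambda>_::unit. h" P] assms by metis

section \<open>Integration of functions of bounded support\<close>

lemma lborel_integral_translation:
  fixes f :: "'a::euclidean_space \<Rightarrow> 'b::{banach, second_countable_topology}"
  assumes "f \<in> borel_measurable borel"
  shows "(LBINT x. f (c + x)) = (LBINT x. f x)"
proof -
  have "(\<integral>x. f x \<partial>distr lborel borel ((+) c)) = (LBINT x. f (c + x))"
    using assms by (intro integral_distr) auto
  then show ?thesis by (simp add: lborel_distr_plus)
qed

lemma lborel_nn_integral_translation:
  fixes f :: "'a::euclidean_space \<Rightarrow> ennreal"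
  assumes "f \<in> borel_measurable borel"
  shows "(\<integral>\<^sup>+x. f (c + x) \<partial>lborel) = (\<integral>\<^sup>+x. f x \<partial>lborel)"
proof -
  have "(\<integral>\<^sup>+x. f x \<partial>distr lborel borel ((+) c)) = (\<integral>\<^sup>+x. f (c + x) \<partial>lborel)"
    using assms by (intro nn_integral_distr) auto
  then show ?thesis by (simp add: lborel_distr_plus)
qed

lemma bounded_bsupp:
  fixes f :: "'a::euclidean_space \<Rightarrow> real"
  assumes "continuous_on UNIV f" "bsupp f"
  obtains K where "K \<ge> 0" "\<And>x. \<bar>f x\<bar> \<le> K"
proof -
  obtain r where r: "r > 0" "\<And>x. f x \<noteq> 0 \<Longrightarrow> norm x \<le> r" by (rule bsuppE[OF assms(2)]) blast
  have "compact (f ` cball 0 r)"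
    using assms(1) by (intro compact_continuous_image) (auto intro: continuous_on_subset)
  then obtain K where K: "\<And>y. y \<in> f ` cball 0 r \<Longrightarrow> norm y \<le> K"
    using compact_imp_bounded bounded_iff by metis
  have "\<bar>f x\<bar> \<le> max K 0" for x
    using K[of "f x"] r(2)[of x] by (cases "f x = 0") auto
  then show ?thesis by (intro that[of "max K 0"]) auto
qed

text \<open>Translation invariance gives \<open>\<integral> (w (x + h v) - w x) / h = 0\<close> for every \<open>h\<close>, and dominated convergence
allows \<open>h \<rightarrow> 0\<close>. No coordinates and no iterated integrals are involved. The hypothesis is only about
one direction, so that functions that are merely continuously differentiable are covered.\<close>
lemma integral_dir_derivative_eq_0:
  fixes w :: "'a::euclidean_space \<Rightarrow> real"
  assumes d: "\<And>x. ((\<lambda>s. w (x + s *\<^sub>R v)) has_real_derivative w' x) (at 0)"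
    and c: "continuous_on UNIV w" "continuous_on UNIV w'" and b: "bsupp w"
  shows "(LBINT x. w' x) = 0"
proof -
  have dd: "((\<lambda>s. w (x + s *\<^sub>R v)) has_real_derivative w' (x + t *\<^sub>R v)) (at t)" for x t
    using d[of "x + t *\<^sub>R v"] DERIV_shift[of "\<lambda>s. w (x + s *\<^sub>R v)" _ 0 t]
    by (simp add: algebra_simps)
  have w': "w' = dird v w"
    using d by (auto simp: fun_eq_iff dird_def has_real_derivative_iff_has_vector_derivative
      intro: vector_derivative_at[symmetric])
  have bw': "bsupp w'" unfolding w' by (rule bsupp_dird[OF b])
  obtain K where K: "K \<ge> 0" "\<And>x. \<bar>w' x\<bar> \<le> K" using bounded_bsupp[OF c(2) bw'] by blast
  obtain r where r: "r > 0" "\<And>x. w' x \<noteq> 0 \<Longrightarrow> norm x \<le> r" by (rule bsuppE[OF bw']) blast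
  define h where "h n = 1 / real (Suc n)" for n
  have h: "0 < h n" "h n \<le> 1" for n by (auto simp: h_def)
  define q where "q n x = (w (x + h n *\<^sub>R v) - w x) / h n" for n x
  have meas: "w \<in> borel_measurable borel" "w' \<in> borel_measurable borel"
    using c by (auto intro: borel_measurable_continuous_onI)
  have int: "integrable lborel w" by (rule integrable_bsupp) fact+
  have q0: "(LBINT x. q n x) = 0" for n
  proof -
    have "integrable (distr lborel borel ((+) (h n *\<^sub>R v))) w"
      using int by (simp add: lborel_distr_plus)
    then have i: "integrable lborel (\<lambda>x. w (h n *\<^sub>R v + x))"
      using meas by (subst (asm) integrable_distr_eq) auto
    have "(LBINT x. w (h n *\<^sub>R v + x) - w x) = 0"
      using i int lborel_integral_translation[OF meas(1)] by (simp add: Bochner_Integration.integral_diff)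
    then show ?thesis by (simp add: q_def add.commute)
  qed
  have "(\<lambda>n. LBINT x. q n x) \<longlonglongrightarrow> (LBINT x. w' x)"
  proof (rule integral_dominated_convergence)
    show "w' \<in> borel_measurable lborel" "q n \<in> borel_measurable lborel" for n
      using meas unfolding q_def by measurable
    show "integrable lborel (\<lambda>x. K * indicator (cball (0::'a) (r + norm v)) x)"
      using borel_integrable_compact[of "cball (0::'a) (r + norm v)" "\<lambda>_. K"] by (simp add: mult.commute)
    have "(\<lambda>n. q n x) \<longlonglongrightarrow> w' x" for x
    proof -
      have "((\<lambda>s. (w (x + s *\<^sub>R v) - w x) / s) \<longlongrightarrow> w' x) (at 0)"
        using d[of x] by (simp add: DERIV_def)
      moreover have "filterlim h (at 0) sequentially"
        unfolding h_def using LIMSEQ_inverse_real_of_nat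
        by (auto simp: filterlim_at inverse_eq_divide)
      ultimately show ?thesis
        unfolding q_def by (rule filterlim_compose)
    qed
    then show "AE x in lborel. (\<lambda>n. q n x) \<longlonglongrightarrow> w' x" by simp
    have "norm (q n x) \<le> K * indicator (cball 0 (r + norm v)) x" for n x
    proof -
      obtain z where z: "0 < z" "z < h n" "w (x + h n *\<^sub>R v) - w (x + 0 *\<^sub>R v) = (h n - 0) * w' (x + z *\<^sub>R v)"
        using MVT2[OF h(1)[of n], of "\<lambda>s. w (x + s *\<^sub>R v)" "\<lambda>t. w' (x + t *\<^sub>R v)"] dd by auto
      have q: "q n x = w' (x + z *\<^sub>R v)" using z h(1)[of n] by (simp add: q_def)
      show ?thesis
      proof (cases "q n x = 0")
        case False
        then have "norm (x + z *\<^sub>R v) \<le> r" using r(2) q by auto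
        moreover have "norm x \<le> norm (x + z *\<^sub>R v) + norm (z *\<^sub>R v)"
          using norm_triangle_ineq4[of "x + z *\<^sub>R v" "z *\<^sub>R v"] by simp
        moreover have "z * norm v \<le> 1 * norm v"
          using z h(2)[of n] by (intro mult_right_mono) auto
        ultimately have "norm x \<le> r + norm v" using z by simp
        then show ?thesis using K(2) q by simp
      qed (use K in auto)
    qed
    then show "AE x in lborel. norm (q n x) \<le> K * indicator (cball 0 (r + norm v)) x" for n by simp
  qed
  then show ?thesis by (simp add: q0 LIMSEQ_const_iff)
qed

lemma integral_dird_eq_0:
  fixes w :: "'a::euclidean_space \<Rightarrow> real"
  assumes "smooth w" "bsupp w"
  shows "(LBINT x. dird v w x) = 0"
  by (rule integral_dir_derivative_eq_0[of w v])
     (use assms in \<open>auto intro!: smooth_continuous smooth_dird smooth_DERIV_along_line\<close>)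

lemma integrable_smooth: "smooth f \<Longrightarrow> bsupp f \<Longrightarrow> integrable lborel f"
  for f :: "'a::euclidean_space \<Rightarrow> 'b::euclidean_space"
  by (rule integrable_bsupp[OF smooth_continuous])

lemma integrable_square:
  fixes h :: "'a::euclidean_space \<Rightarrow> real"
  shows "smooth h \<Longrightarrow> bsupp h \<Longrightarrow> integrable lborel (\<lambda>z. (h z)\<^sup>2)"
  unfolding power2_eq_square by (intro integrable_smooth smooth_mult bsupp_mult_left)

lemma integrable_indicator_cball:
  "integrable lborel (\<lambda>z. indicator (cball (c::'a::euclidean_space) r) z :: real)"
  using borel_integrable_compact[of "cball c r" "\<lambda>_. 1::real"] by simp

subsection \<open>A Sobolev inequality\<close>

lemma smooth_foldr_dird: "smooth h \<Longrightarrow> smooth (foldr dird bs h)"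
  by (induction bs) (auto intro: smooth_dird)

lemma bsupp_foldr_dird: "bsupp h \<Longrightarrow> bsupp (foldr dird bs h)"
  by (induction bs) (auto intro: bsupp_dird)

text \<open>One step of the Sobolev inequality. The shift \<open>c\<close> will be the coordinate of the base point, so that
the integration variable becomes the new coordinate itself.\<close>
lemma abs_le_nn_integral_dird:
  fixes w :: "'a::euclidean_space \<Rightarrow> real"
  assumes w: "smooth w" "bsupp w" and v: "v \<noteq> 0"
  shows "ennreal \<bar>w z\<bar> \<le> (\<integral>\<^sup>+s. ennreal \<bar>dird v w (z + (s - c) *\<^sub>R v)\<bar> \<partial>lborel)"
proof -
  obtain r where r: "r > 0" "\<And>x. w x \<noteq> 0 \<Longrightarrow> norm x \<le> r" by (rule bsuppE[OF w(2)]) blast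
  define N where "N = (r + norm z + 1) / norm v"
  have N: "N \<ge> 0" using r by (auto simp: N_def)
  let ?g = "\<lambda>s. dird v w (z + s *\<^sub>R v)"
  have "norm (N *\<^sub>R v) = r + norm z + 1" using v r by (simp add: N_def)
  moreover have "norm (N *\<^sub>R v) \<le> norm (z + (-N) *\<^sub>R v) + norm z"
    using norm_triangle_ineq4[of z "z + (-N) *\<^sub>R v"] by simp
  ultimately have "\<not> norm (z + (-N) *\<^sub>R v) \<le> r" by linarith
  then have 0: "w (z + (-N) *\<^sub>R v) = 0" using r(2) by blast
  have cont: "continuous_on A ?g" for A
    by (intro continuous_on_compose2[OF smooth_continuous[OF smooth_dird[OF w(1)], of UNIV]] continuous_intros) auto
  have "(LBINT s. indicator {-N..0} s *\<^sub>R ?g s) = w (z + 0 *\<^sub>R v) - w (z + (-N) *\<^sub>R v)"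
    by (rule integral_FTC_atLeastAtMost)
       (use N cont w in \<open>auto intro!: has_vector_derivative_at_within[OF smooth_along_line]\<close>)
  then have "w z = (LBINT s. indicator {-N..0} s *\<^sub>R ?g s)" using 0 by simp
  then have "ennreal \<bar>w z\<bar> = ennreal (norm (LBINT s. indicator {-N..0} s *\<^sub>R ?g s))" by simp
  also have "\<dots> \<le> (\<integral>\<^sup>+s. ennreal (norm (indicator {-N..0} s *\<^sub>R ?g s)) \<partial>lborel)"
    by (rule integral_norm_bound_ennreal) (intro borel_integrable_compact cont, simp)
  also have "\<dots> \<le> (\<integral>\<^sup>+s. ennreal \<bar>?g s\<bar> \<partial>lborel)"
    by (intro nn_integral_mono) (auto simp: indicator_def)
  also have "\<dots> = (\<integral>\<^sup>+s. ennreal \<bar>?g (- c + s)\<bar> \<partial>lborel)"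
    by (rule lborel_nn_integral_translation[symmetric])
       (use borel_measurable_continuous_onI[OF cont] in measurable)
  finally show ?thesis by (simp add: algebra_simps)
qed

text \<open>The point \<open>x\<close> with its coordinates in the directions \<open>S\<close> overwritten by \<open>y\<close>. It interpolates between a
pointwise value (\<open>S\<close> empty) and an integral over the whole space (\<open>S\<close> the basis), and the proof
of the Sobolev inequality is an induction on \<open>S\<close>.\<close>
definition replace_coords :: "'a set \<Rightarrow> 'a::euclidean_space \<Rightarrow> ('a \<Rightarrow> real) \<Rightarrow> 'a" where
  "replace_coords S x y = (\<Sum>b\<in>Basis. (if b \<in> S then y b else x \<bullet> b) *\<^sub>R b)"

lemma replace_coords_insert:
  assumes "b \<in> Basis" "b \<notin> S"
  shows "replace_coords (insert b S) x (y(b := s)) = replace_coords S x y + (s - x \<bullet> b) *\<^sub>R b"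
proof -
  have "replace_coords (insert b S) x (y(b := s)) - replace_coords S x y
      = (\<Sum>b'\<in>Basis. (if b' = b then (s - x \<bullet> b) *\<^sub>R b else 0))"
    unfolding replace_coords_def sum_subtractf[symmetric]
    by (rule sum.cong) (use assms in \<open>auto simp: scaleR_diff_left\<close>)
  also have "\<dots> = (s - x \<bullet> b) *\<^sub>R b" using assms by simp
  finally show ?thesis by (simp add: algebra_simps)
qed

lemma measurable_replace_coords:
  "replace_coords S x \<in> borel_measurable (Pi\<^sub>M S (\<lambda>_. lborel))"
proof -
  have "(\<lambda>y. (if b \<in> S then y b else x \<bullet> b)) \<in> borel_measurable (Pi\<^sub>M S (\<lambda>_. lborel))" for b
    by (cases "b \<in> S") simp_all
  then show ?thesis unfolding replace_coords_def[abs_def]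
    by (intro borel_measurable_sum borel_measurable_scaleR) auto
qed

lemma abs_le_nn_integral_foldr_dird:
  fixes h :: "'a::euclidean_space \<Rightarrow> real"
  assumes h: "smooth h" "bsupp h"
  shows "distinct bs \<Longrightarrow> set bs \<subseteq> Basis \<Longrightarrow>
    ennreal \<bar>h x\<bar> \<le> (\<integral>\<^sup>+y. ennreal \<bar>foldr dird bs h (replace_coords (set bs) x y)\<bar> \<partial>Pi\<^sub>M (set bs) (\<lambda>_. lborel))"
proof (induction bs)
  interpret product_sigma_finite "\<lambda>_. lborel :: real measure" by standard
  case Nil
  show ?case by (simp add: PiM_empty nn_integral_count_space_finite replace_coords_def euclidean_representation)
next
  interpret product_sigma_finite "\<lambda>_. lborel :: real measure" by standard
  case (Cons b bs)
  let ?W = "foldr dird bs h"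
  have b: "b \<in> Basis" "b \<notin> set bs" using Cons.prems by auto
  have W: "smooth ?W" "bsupp ?W" using h smooth_foldr_dird bsupp_foldr_dird by auto
  have m: "(\<lambda>y. ennreal \<bar>foldr dird (b # bs) h (replace_coords (insert b (set bs)) x y)\<bar>)
      \<in> borel_measurable (Pi\<^sub>M (insert b (set bs)) (\<lambda>_. lborel))"
  proof -
    have "continuous_on UNIV (foldr dird (b # bs) h)"
      by (intro smooth_continuous smooth_foldr_dird h)
    then show ?thesis
      using measurable_compose[OF measurable_replace_coords borel_measurable_continuous_onI,
        of "foldr dird (b # bs) h" "insert b (set bs)" x] by measurable
  qed
  have "ennreal \<bar>h x\<bar> \<le> (\<integral>\<^sup>+y. ennreal \<bar>?W (replace_coords (set bs) x y)\<bar> \<partial>Pi\<^sub>M (set bs) (\<lambda>_. lborel))"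
    using Cons by simp
  also have "\<dots> \<le> (\<integral>\<^sup>+y. (\<integral>\<^sup>+s. ennreal \<bar>dird b ?W (replace_coords (set bs) x y + (s - x \<bullet> b) *\<^sub>R b)\<bar> \<partial>lborel)
      \<partial>Pi\<^sub>M (set bs) (\<lambda>_. lborel))"
    using b by (intro nn_integral_mono abs_le_nn_integral_dird W) auto
  also have "\<dots> = (\<integral>\<^sup>+y. (\<integral>\<^sup>+s. ennreal \<bar>foldr dird (b # bs) h (replace_coords (insert b (set bs)) x (y(b := s)))\<bar> \<partial>lborel)
      \<partial>Pi\<^sub>M (set bs) (\<lambda>_. lborel))"
    using b by (simp add: replace_coords_insert)
  also have "\<dots> = (\<integral>\<^sup>+y. ennreal \<bar>foldr dird (b # bs) h (replace_coords (insert b (set bs)) x y)\<bar>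
      \<partial>Pi\<^sub>M (insert b (set bs)) (\<lambda>_. lborel))"
    by (rule product_nn_integral_insert[OF _ _ m, symmetric]) (use b in auto)
  finally show ?case by simp
qed

text \<open>The embedding \<open>W\<^sup>n\<^sup>,\<^sup>1 \<subseteq> L\<^sup>\<infinity>\<close> in dimension \<open>n\<close>, in the sharp form that needs only the one mixed derivative
taken once in every coordinate direction.\<close>
lemma sobolev_sup_bound:
  fixes h :: "'a::euclidean_space \<Rightarrow> real"
  assumes h: "smooth h" "bsupp h" and bs: "distinct bs" "set bs = Basis"
  shows "\<bar>h x\<bar> \<le> (LBINT z. \<bar>foldr dird bs h z\<bar>)"
proof -
  let ?W = "foldr dird bs h"
  have W: "smooth ?W" "bsupp ?W" using h smooth_foldr_dird bsupp_foldr_dird by auto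
  have m: "?W \<in> borel_measurable borel"
    by (rule borel_measurable_continuous_onI[OF smooth_continuous[OF W(1)]])
  have "ennreal \<bar>h x\<bar> \<le> (\<integral>\<^sup>+y. ennreal \<bar>?W (replace_coords (set bs) x y)\<bar> \<partial>Pi\<^sub>M (set bs) (\<lambda>_. lborel))"
    using abs_le_nn_integral_foldr_dird[OF h bs(1)] bs(2) by simp
  also have "\<dots> = (\<integral>\<^sup>+y. ennreal \<bar>?W (\<Sum>b\<in>Basis. y b *\<^sub>R b)\<bar> \<partial>Pi\<^sub>M Basis (\<lambda>_. lborel))"
    unfolding bs(2) replace_coords_def by (intro nn_integral_cong arg_cong[where f=ennreal] arg_cong[where f=abs] arg_cong[where f="?W"] sum.cong) auto
  also have "\<dots> = (\<integral>\<^sup>+z. ennreal \<bar>?W z\<bar> \<partial>distr (Pi\<^sub>M Basis (\<lambda>_. lborel)) borel (\<lambda>f. \<Sum>b\<in>Basis. f b *\<^sub>R b))"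
    using m by (subst nn_integral_distr) auto
  also have "\<dots> = (\<integral>\<^sup>+z. ennreal \<bar>?W z\<bar> \<partial>lborel)" by (simp add: lborel_eq[symmetric])
  also have "\<dots> = ennreal (LBINT z. \<bar>?W z\<bar>)"
    using integrable_smooth[OF W] by (intro nn_integral_eq_integral) auto
  finally show ?thesis by (subst (asm) ennreal_le_iff) auto
qed

subsection \<open>Integrating out the momentum\<close>

lemma bsupp_slice: "bsupp h \<Longrightarrow> bsupp (\<lambda>p. h (x, p))"
proof (elim bsuppE)
  fix r assume r: "\<And>z. h z \<noteq> 0 \<Longrightarrow> norm z \<le> r"
  show ?thesis
  proof (rule bsuppI)
    fix p assume "h (x, p) \<noteq> 0"
    then show "norm p \<le> r" using r[of "(x, p)"] norm_snd_le[of p x] by simp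
  qed
qed

lemma smooth_slice:
  fixes h :: "'a::euclidean_space \<times> 'b::euclidean_space \<Rightarrow> 'c::real_normed_vector"
  shows "smooth h \<Longrightarrow> smooth (\<lambda>p. h (x, p))"
  by (rule smooth_compose) (auto intro: smooth_intros)

lemma dird_slice: "dird w (\<lambda>p. h (x, p)) p = dird (0, w) h (x, p)"
  by (simp add: dird_def)

lemma integral_slice:
  fixes h :: "'a::euclidean_space \<times> 'b::euclidean_space \<Rightarrow> real"
  assumes "continuous_on UNIV h" "bsupp h"
  shows "(LBINT x. (LBINT p. h (x, p))) = (LBINT z. h z)"
    and "integrable lborel (\<lambda>x. LBINT p. h (x, p))"
proof -
  have i: "integrable (lborel \<Otimes>\<^sub>M lborel) h" using integrable_bsupp[OF assms] by (simp add: lborel_prod)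
  show "(LBINT x. (LBINT p. h (x, p))) = (LBINT z. h z)"
    using lborel_pair.integral_fst'[OF i] by (simp add: lborel_prod)
  show "integrable lborel (\<lambda>x. LBINT p. h (x, p))"
    by (rule lborel_pair.integrable_fst'[OF i])
qed

lemma integral_eq_integral_cbox:
  fixes f :: "'a::euclidean_space \<Rightarrow> real"
  assumes "continuous_on UNIV f" "\<And>x. f x \<noteq> 0 \<Longrightarrow> x \<in> cbox a b"
  shows "(LBINT x. f x) = integral (cbox a b) f"
proof -
  obtain r where "\<And>x. x \<in> cbox a b \<Longrightarrow> norm x \<le> r"
    using bounded_cbox bounded_iff by metis
  then have "bsupp f" using assms(2) by (intro bsuppI[of f r]) blast
  then have "integrable lborel f" using assms(1) by (intro integrable_bsupp)
  then have "(f has_integral (LBINT x. f x)) UNIV" by (rule has_integral_integral_lborel)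
  moreover have eq: "(\<lambda>x. if x \<in> cbox a b then f x else 0) = f" using assms(2) by fastforce
  ultimately have "(f has_integral (LBINT x. f x)) (cbox a b)"
    using has_integral_restrict_UNIV[of "cbox a b" f] by (simp only: eq)
  then show ?thesis by (simp add: integral_unique)
qed

text \<open>Differentiation under the integral sign; smoothness follows because the derivatives are again
integrals of the same form.\<close>
lemma smooth_integral_out:
  fixes h :: "'a::euclidean_space \<times> 'b::euclidean_space \<Rightarrow> real"
  assumes h: "smooth h" "bsupp h"
  shows "smooth (\<lambda>x. LBINT p. h (x, p))"
    and "dird v (\<lambda>x. LBINT p. h (x, p)) x = (LBINT p. dird (v, 0) h (x, p))"
proof -
  have der: "((\<lambda>x. LBINT p. h (x, p)) has_derivative (\<lambda>v. LBINT p. dird (v, 0) h (x, p))) (at x)"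
    if h: "smooth h" "bsupp h" for h :: "'a \<times> 'b \<Rightarrow> real" and x
  proof -
    obtain r where r: "\<And>z. h z \<noteq> 0 \<Longrightarrow> norm z \<le> r" by (rule bsuppE[OF h(2)]) blast
    obtain a b :: 'b where ab: "cball 0 r \<subseteq> cbox a b"
      using bounded_cball bounded_subset_cbox_symmetric by metis
    have out: "h (x, p) = 0" "dird v h (x, p) = 0" if "p \<notin> cbox a b" for x p v
    proof -
      have "(x, p) \<notin> cball 0 r"
        using that ab norm_snd_le[of p x] by (auto simp: subset_eq)
      then show "h (x, p) = 0" "dird v h (x, p) = 0"
        using r[of "(x, p)"] dird_eq_0_outside[of h "cball 0 r" "(x, p)" v] r by auto
    qed
    define fx where "fx x p = Blinfun (\<lambda>v. dird (v, 0) h (x, p))" for x p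
    have bl: "bounded_linear (\<lambda>v. dird (v, 0) h (x, p))" for x p
      using bounded_linear_compose[OF has_derivative_bounded_linear[OF smooth_has_derivative[OF h(1), of "(x,p)"]]
        bounded_linear_Pair[OF bounded_linear_ident bounded_linear_zero]] by simp
    have fx: "blinfun_apply (fx x p) = (\<lambda>v. dird (v, 0) h (x, p))" for x p
      unfolding fx_def by (rule bounded_linear_Blinfun_apply[OF bl])
    have cd: "continuous_on A (\<lambda>p. dird v h (x, p))" for A v x
      by (intro continuous_on_compose2[OF smooth_continuous[OF smooth_dird[OF h(1)], of UNIV]] continuous_intros) auto
    have ch: "continuous_on A (\<lambda>p. h (x, p))" for A x
      by (intro continuous_on_compose2[OF smooth_continuous[OF h(1), of UNIV]] continuous_intros) auto
    have cfx: "continuous_on A (\<lambda>(x, p). fx x p)" for A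
      unfolding case_prod_beta
      by (intro continuous_on_blinfun_componentwise) (simp add: fx smooth_continuous[OF smooth_dird[OF h(1)]])
    have "((\<lambda>x. integral (cbox a b) (\<lambda>p. h (x, p))) has_derivative integral (cbox a b) (fx x)) (at x within UNIV)"
    proof (rule leibniz_rule)
      show "((\<lambda>x. h (x, p)) has_derivative blinfun_apply (fx x p)) (at x within UNIV)" for x p
        unfolding fx
        by (rule has_derivative_compose[OF has_derivative_Pair[OF has_derivative_ident has_derivative_const]
            smooth_has_derivative[OF h(1)]])
      show "(\<lambda>p. h (x, p)) integrable_on cbox a b" for x
        by (rule integrable_continuous[OF ch])
      show "continuous_on (UNIV \<times> cbox a b) (\<lambda>(x, p). fx x p)" by (rule cfx)
    qed auto
    moreover have "(\<lambda>x. integral (cbox a b) (\<lambda>p. h (x, p))) = (\<lambda>x. LBINT p. h (x, p))"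
      by (rule ext, rule integral_eq_integral_cbox[symmetric, OF ch]) (use out in blast)
    moreover have "blinfun_apply (integral (cbox a b) (fx x)) = (\<lambda>v. LBINT p. dird (v, 0) h (x, p))"
    proof
      fix v
      have "continuous_on (cbox a b) (fx x)"
        using continuous_on_compose2[OF cfx[of UNIV], of "cbox a b" "\<lambda>p. (x, p)"] by (simp add: continuous_on_Pair)
      then have "blinfun_apply (integral (cbox a b) (fx x)) v = integral (cbox a b) (\<lambda>p. dird (v, 0) h (x, p))"
        by (subst blinfun_apply_integral) (auto simp: fx intro: integrable_continuous)
      also have "\<dots> = (LBINT p. dird (v, 0) h (x, p))"
        by (rule integral_eq_integral_cbox[symmetric, OF cd]) (use out in blast)
      finally show "blinfun_apply (integral (cbox a b) (fx x)) v = (LBINT p. dird (v, 0) h (x, p))" .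
    qed
    ultimately show ?thesis by simp
  qed
  show "dird v (\<lambda>x. LBINT p. h (x, p)) x = (LBINT p. dird (v, 0) h (x, p))"
    by (rule dird_eqI[OF der[OF h]])
  have "Ck_on k UNIV (\<lambda>x. LBINT p. h (x, p))" for k
    using h
  proof (induction k arbitrary: h)
    case 0
    then show ?case
      using der[OF 0] by (auto simp: continuous_on_eq_continuous_within intro: has_derivative_continuous)
  next
    case (Suc k)
    show ?case
      unfolding Ck_on.simps
      by (rule exI[of _ "\<lambda>x v. LBINT p. dird (v, 0) h (x, p)"])
        (use der[OF Suc.prems] Suc.IH[OF smooth_dird bsupp_dird, OF Suc.prems] in auto)
  qed
  then show "smooth (\<lambda>x. LBINT p. h (x, p))" unfolding smooth_on_def by blast
qed

section \<open>The Poisson equation\<close>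

lemma second_derivative_nonpos_at_max:
  fixes F F' :: "real \<Rightarrow> real"
  assumes F: "\<And>s. (F has_real_derivative F' s) (at s)" and F': "(F' has_real_derivative c) (at 0)"
    and max: "\<And>s. F s \<le> F 0"
  shows "c \<le> 0"
proof (rule ccontr)
  assume "\<not> c \<le> 0"
  then have c: "c > 0" by simp
  have F'0: "F' 0 = 0"
    by (rule DERIV_local_max[of F _ 0 1]) (use F max in auto)
  obtain d where d: "d > 0" "\<And>h. h > 0 \<Longrightarrow> h < d \<Longrightarrow> F' 0 < F' (0 + h)"
    using DERIV_pos_inc_right[OF F' c] by auto
  obtain z where z: "0 < z" "z < d / 2" "F (d / 2) - F 0 = (d / 2 - 0) * F' z"
    using MVT2[of 0 "d / 2" F F'] F d(1) by auto
  have "F' z > 0" using d(2)[of z] z F'0 by simp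
  then have "(d / 2 - 0) * F' z > 0" using d(1) by simp
  then show False using z(3) max[of "d / 2"] by linarith
qed

lemma inner_along_axis:
  fixes x :: vec3
  shows "(x + s *\<^sub>R axis i 1) \<bullet> (x + s *\<^sub>R axis i 1) = x \<bullet> x + 2 * s * x $ i + s\<^sup>2"
  by (simp add: inner_add_left inner_add_right inner_axis inner_axis' inner_axis_axis power2_eq_square algebra_simps)

lemma laplacian_eq: "laplacian \<psi> x = (\<Sum>i\<in>UNIV. dird (axis i 1) (dird (axis i 1) \<psi>) x)"
  by (simp add: laplacian_def partial_eq_dird)

lemma laplacian_diff:
  fixes \<phi> \<psi> :: "vec3 \<Rightarrow> real"
  assumes "smooth \<phi>" "smooth \<psi>"
  shows "laplacian (\<lambda>x. \<phi> x - \<psi> x) x = laplacian \<phi> x - laplacian \<psi> x"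
proof -
  have "dird v (\<lambda>x. \<phi> x - \<psi> x) = (\<lambda>x. dird v \<phi> x - dird v \<psi> x)" for v
    by (rule ext, rule dird_diff[OF assms])
  then show ?thesis by (simp add: laplacian_eq dird_diff smooth_dird assms sum_subtractf)
qed

text \<open>Maximum principle. The barrier \<open>(1 + \<bar>x\<bar>\<^sup>2)\<^bsup>-1/2\<^esup>\<close> has the Laplacian \<open>-3 (1 + \<bar>x\<bar>\<^sup>2)\<^bsup>-5/2\<^esup>\<close>, which is negative everywhere
(unlike that of \<open>1/\<bar>x\<bar>\<close>), so \<open>\<psi>\<close> minus a large multiple of it is strictly subharmonic on the whole space.
Were it positive somewhere, it would attain its maximum since it vanishes at infinity, and the second
derivatives there would have the wrong sign.\<close>
lemma barrier_upper_bound: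
  fixes \<psi> :: "vec3 \<Rightarrow> real"
  assumes \<psi>: "smooth \<psi>" and lim: "(\<psi> \<longlongrightarrow> 0) at_infinity"
    and \<sigma>: "\<And>x. - (3 * a * (1 + x \<bullet> x) powr (-5/2)) < laplacian \<psi> x"
  shows "\<psi> x \<le> a * (1 + x \<bullet> x) powr (-1/2)"
proof (rule ccontr)
  assume neg: "\<not> \<psi> x \<le> a * (1 + x \<bullet> x) powr (-1/2)"
  define w where "w y = \<psi> y - a * (1 + y \<bullet> y) powr (-1/2)" for y
  have pos: "1 + y \<bullet> y > 0" for y :: vec3 by (simp add: add_pos_nonneg)
  have wx: "w x > 0" using neg by (simp add: w_def)
  have cw: "continuous_on A w" for A
    unfolding w_def using pos
    by (intro continuous_intros smooth_continuous \<psi>) (auto simp: less_imp_neq[symmetric])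
  have "filterlim (\<lambda>y::vec3. 1 + y \<bullet> y) at_top at_infinity"
  proof -
    have "filterlim (\<lambda>y::vec3. (norm y)\<^sup>2) at_top at_infinity"
      by (intro filterlim_pow_at_top filterlim_norm_at_top) auto
    then show ?thesis
      by (intro filterlim_tendsto_add_at_top[OF tendsto_const]) (simp add: power2_norm_eq_inner)
  qed
  then have "((\<lambda>y::vec3. (1 + y \<bullet> y) powr (-1/2)) \<longlongrightarrow> 0) at_infinity"
    by (intro tendsto_neg_powr) auto
  then have "(w \<longlongrightarrow> 0 - a * 0) at_infinity"
    unfolding w_def by (intro tendsto_intros lim)
  then have "\<forall>\<^sub>F y in at_infinity. w y < w x"
    using wx by (intro order_tendstoD(2)[of w 0]) auto
  then obtain r where r: "\<And>y. norm y \<ge> r \<Longrightarrow> w y < w x"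
    by (auto simp: eventually_at_infinity)
  \<comment> \<open>Outside this ball \<open>w\<close> is below its value at \<open>x\<close>, so the maximum over the ball is global.\<close>
  let ?K = "cball (0::vec3) (max r (norm x))"
  obtain x0 where x0: "x0 \<in> ?K" "\<And>y. y \<in> ?K \<Longrightarrow> w y \<le> w x0"
    using continuous_attains_sup[of ?K w] cw by auto
  have max: "w y \<le> w x0" for y
  proof (cases "y \<in> ?K")
    case False
    then have "w y < w x" using r by auto
    moreover have "w x \<le> w x0" using x0 by auto
    ultimately show ?thesis by simp
  qed (use x0 in auto)
  let ?u = "1 + x0 \<bullet> x0"
  have c: "dird (axis i 1) (dird (axis i 1) \<psi>) x0 - a * (3 * (x0 $ i)\<^sup>2 * ?u powr (-5/2) - ?u powr (-3/2)) \<le> 0" for i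
  proof (rule second_derivative_nonpos_at_max)
    let ?l = "\<lambda>s. x0 + s *\<^sub>R axis i 1"
    let ?U = "\<lambda>s. 1 + (x0 \<bullet> x0 + 2 * s * x0 $ i + s\<^sup>2)"
    have U: "?U s > 0" for s using pos[of "?l s"] by (simp add: inner_along_axis)
    have d: "((\<lambda>s. \<psi> (?l s)) has_real_derivative dird (axis i 1) \<psi> (?l s)) (at s)" for s
      by (rule smooth_DERIV_along_line(1)[OF \<psi>])
    have dd: "((\<lambda>s. dird (axis i 1) \<psi> (?l s)) has_real_derivative dird (axis i 1) (dird (axis i 1) \<psi>) x0) (at 0)"
      by (rule smooth_DERIV_along_line(2)[OF smooth_dird[OF \<psi>]])
    show "((\<lambda>s. w (?l s)) has_real_derivative
        (dird (axis i 1) \<psi> (?l s) + a * (x0 $ i + s) * ?U s powr (-3/2))) (at s)" for s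
      unfolding w_def inner_along_axis
      by (rule derivative_eq_intros d refl U | simp add: U)+
    show "((\<lambda>s. dird (axis i 1) \<psi> (?l s) + a * (x0 $ i + s) * ?U s powr (-3/2)) has_real_derivative
        dird (axis i 1) (dird (axis i 1) \<psi>) x0 - a * (3 * (x0 $ i)\<^sup>2 * ?u powr (-5/2) - ?u powr (-3/2))) (at 0)"
      by (rule derivative_eq_intros dd refl U | simp add: U pos)+
         (simp add: field_simps power2_eq_square)
    show "w (?l s) \<le> w (?l 0)" for s using max by simp
  qed
  have "(\<Sum>i\<in>UNIV. dird (axis i 1) (dird (axis i 1) \<psi>) x0 - a * (3 * (x0 $ i)\<^sup>2 * ?u powr (-5/2) - ?u powr (-3/2))) \<le> 0"
    by (intro sum_nonpos c)
  also have "(\<Sum>i\<in>UNIV. dird (axis i 1) (dird (axis i 1) \<psi>) x0 - a * (3 * (x0 $ i)\<^sup>2 * ?u powr (-5/2) - ?u powr (-3/2)))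
      = laplacian \<psi> x0 - a * (3 * (x0 \<bullet> x0) * ?u powr (-5/2) - 3 * ?u powr (-3/2))"
    by (simp add: laplacian_eq sum_subtractf sum_distrib_left[symmetric] sum_distrib_right[symmetric]
        inner_vec_def power2_eq_square)
  also have "?u powr (-3/2) = ?u * ?u powr (-5/2)"
    using pos[of x0] powr_add[of ?u 1 "-5/2"] by simp
  finally show False using \<sigma>[of x0] by (simp add: algebra_simps)
qed

text \<open>Any decaying solution with a compactly supported source is \<open>O(1/\<bar>x\<bar>)\<close>. The hypothesis is satisfied for
large \<open>a\<close> if the source is bounded, and for every positive \<open>a\<close> if it vanishes.\<close>
lemma barrier_bound:
  fixes \<psi> :: "vec3 \<Rightarrow> real"
  assumes \<psi>: "smooth \<psi>" and lim: "(\<psi> \<longlongrightarrow> 0) at_infinity"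
    and \<sigma>: "\<And>x. \<bar>laplacian \<psi> x\<bar> < 3 * a * (1 + x \<bullet> x) powr (-5/2)"
  shows "\<bar>\<psi> x\<bar> \<le> a * (1 + x \<bullet> x) powr (-1/2)"
proof -
  have "laplacian (\<lambda>x. 0 - \<psi> x) x = 0 - laplacian \<psi> x" for x
    using laplacian_diff[OF smooth_const \<psi>, of 0] by (simp add: laplacian_eq dird_const)
  then have l: "laplacian (\<lambda>x. - \<psi> x) x = - laplacian \<psi> x" for x by simp
  have "\<psi> x \<le> a * (1 + x \<bullet> x) powr (-1/2)"
    by (rule barrier_upper_bound[OF \<psi> lim]) (use \<sigma> abs_less_iff in \<open>smt (verit)\<close>)
  moreover have "- \<psi> x \<le> a * (1 + x \<bullet> x) powr (-1/2)"
    by (rule barrier_upper_bound[OF smooth_minus[OF \<psi>]])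
       (use tendsto_minus[OF lim] in simp, use \<sigma> abs_less_iff l in \<open>smt (verit)\<close>)
  ultimately show ?thesis by linarith
qed

lemma decaying_harmonic_eq_0:
  fixes \<psi> :: "vec3 \<Rightarrow> real"
  assumes "smooth \<psi>" "(\<psi> \<longlongrightarrow> 0) at_infinity" "\<And>x. laplacian \<psi> x = 0"
  shows "\<psi> x = 0"
proof (rule ccontr)
  assume "\<psi> x \<noteq> 0"
  let ?b = "(1 + x \<bullet> x) powr (-1/2)"
  have pos: "1 + y \<bullet> y > 0" for y :: vec3 by (simp add: add_pos_nonneg)
  have b: "?b > 0" using pos[of x] by simp
  let ?a = "\<bar>\<psi> x\<bar> / (2 * ?b)"
  have "\<bar>\<psi> x\<bar> \<le> ?a * ?b"
    by (rule barrier_bound) (use assms pos b \<open>\<psi> x \<noteq> 0\<close> in \<open>auto simp: less_imp_neq[symmetric]\<close>)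
  then show False using b \<open>\<psi> x \<noteq> 0\<close> by (simp add: field_simps)
qed

subsection \<open>The energy estimate\<close>

text \<open>A continuously differentiable function vanishing on a half line, from which the cutoff
\<open>pos_sq (1 - pos_sq (\<rho> / M\<^sup>2 - 1))\<close> is built: it equals \<open>1\<close> for \<open>\<rho> \<le> M\<^sup>2\<close> and \<open>0\<close> for \<open>\<rho> \<ge> 2 M\<^sup>2\<close>, and it is the square
of a Lipschitz function, which is what allows its gradient to be absorbed.\<close>
definition pos_sq :: "real \<Rightarrow> real" where "pos_sq u = (max 0 u)\<^sup>2"

lemma DERIV_pos_sq: "(pos_sq has_real_derivative 2 * max 0 u) (at u)"
proof -
  consider "u > 0" | "u < 0" | "u = 0" by linarith
  then show ?thesis
  proof cases
    case 1
    have "((\<lambda>u. u\<^sup>2) has_real_derivative 2 * max 0 u) (at u)"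
      using 1 by (auto intro!: derivative_eq_intros)
    then show ?thesis
      by (rule has_field_derivative_transform_within_open[of _ _ _ "{0<..}"]) (use 1 in \<open>auto simp: pos_sq_def\<close>)
  next
    case 2
    have "((\<lambda>u. 0) has_real_derivative 2 * max 0 u) (at u)"
      using 2 by (auto intro!: derivative_eq_intros)
    then show ?thesis
      by (rule has_field_derivative_transform_within_open[of _ _ _ "{..<0}"]) (use 2 in \<open>auto simp: pos_sq_def\<close>)
  next
    case 3
    have "(\<lambda>h. max 0 h) \<midarrow>0\<rightarrow> max 0 (0::real)" by (intro tendsto_intros)
    moreover have "pos_sq h / h = max 0 h" if "h \<noteq> 0" for h
      using that by (auto simp: pos_sq_def max_def power2_eq_square)
    ultimately have "(\<lambda>h. pos_sq h / h) \<midarrow>0\<rightarrow> 0"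
      by (subst tendsto_cong[where g="max 0"]) (auto simp: eventually_at_filter)
    then show ?thesis using 3 by (simp add: DERIV_def pos_sq_def)
  qed
qed

text \<open>The right-hand side is the divergence of \<open>\<chi> (\<psi> \<nabla>\<psi> + \<psi>\<^sup>2 V / 4)\<close> at a point, where \<open>V = x / (R\<^sup>2 + \<bar>x\<bar>\<^sup>2)\<close>, \<open>\<chi> = m\<^sup>2\<close> is the
cutoff, \<open>y = \<psi>\<close>, \<open>\<sigma> = \<Delta>\<psi>\<close>, \<open>A = \<bar>\<nabla>\<psi>\<bar>\<^sup>2\<close>, \<open>T = x \<cdot> \<nabla>\<psi>\<close> and \<open>\<rho> = \<bar>x\<bar>\<^sup>2\<close>. The first summand of the field gives the
energy identity, the second a Hardy inequality with the smooth weight \<open>1/d \<le> div V\<close>; its contribution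
absorbs \<open>\<psi> \<sigma>\<close>, so that no bound for \<open>\<psi>\<close> itself is left outside the shell where \<open>\<chi>\<close> varies.\<close>
lemma energy_density_bound:
  fixes y \<sigma> A T \<rho> R M :: real
  assumes "R > 0" "M > 0" "\<rho> \<ge> 0" "T\<^sup>2 \<le> A * \<rho>" "A \<ge> 0"
  defines "d \<equiv> R\<^sup>2 + \<rho>" and "k \<equiv> max 0 (\<rho> / M\<^sup>2 - 1)"
  defines "m \<equiv> max 0 (1 - k\<^sup>2)"
  shows "m\<^sup>2 * A / 4 - 2 * d * \<sigma>\<^sup>2 - (if M\<^sup>2 < \<rho> \<and> \<rho> < 2 * M\<^sup>2 then 130 * y\<^sup>2 / M\<^sup>2 else 0)
    \<le> m\<^sup>2 * (A + y * \<sigma> + y\<^sup>2 / 4 * (3 / d - 2 * \<rho> / d\<^sup>2) + y * T / (2 * d))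
      + 2 * m * (- (4 * k / M\<^sup>2)) * (y * T + y\<^sup>2 / 4 * \<rho> / d)"
proof -
  have d: "d > 0" "\<rho> \<le> d" using assms by (auto simp: add_pos_nonneg)
  have m: "0 \<le> m" "m \<le> 1" "m\<^sup>2 \<le> 1" using power_le_one[of m 2] by (auto simp: m_def)
  have "R\<^sup>2 = d - \<rho>" by (simp add: d_def)
  then have "3 / d - 2 * \<rho> / d\<^sup>2 = 1 / d + 2 * R\<^sup>2 / d\<^sup>2"
    using d by (simp add: field_simps power2_eq_square)
  then have 1: "3 / d - 2 * \<rho> / d\<^sup>2 \<ge> 1 / d" by simp
  have 2: "y * T / (2 * d) \<ge> - (A / 2) - y\<^sup>2 / (8 * d)"
  proof -
    have "T\<^sup>2 / d \<le> A"
      using assms(4) d mult_left_mono[OF d(2) assms(5)] by (simp add: field_simps)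
    moreover have "0 \<le> (T + y / 2)\<^sup>2 / (2 * d)" using d by simp
    moreover have "(T + y / 2)\<^sup>2 / (2 * d) = (T\<^sup>2 / d) / 2 + y * T / (2 * d) + y\<^sup>2 / (8 * d)"
      using d by (simp add: field_simps power2_eq_square)
    ultimately have "0 \<le> A / 2 + y * T / (2 * d) + y\<^sup>2 / (8 * d)" by argo
    then show ?thesis by argo
  qed
  have 3: "y * \<sigma> \<ge> - (y\<^sup>2 / (8 * d)) - 2 * d * \<sigma>\<^sup>2"
  proof -
    have "0 \<le> (y + 4 * d * \<sigma>)\<^sup>2 / (8 * d)" using d by simp
    moreover have "(y + 4 * d * \<sigma>)\<^sup>2 / (8 * d) = y\<^sup>2 / (8 * d) + y * \<sigma> + 2 * d * \<sigma>\<^sup>2"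
      using d by (simp add: field_simps power2_eq_square)
    ultimately show ?thesis by linarith
  qed
  have "y\<^sup>2 / 4 * (3 / d - 2 * \<rho> / d\<^sup>2) \<ge> y\<^sup>2 / 4 * (1 / d)"
    using 1 by (intro mult_left_mono) auto
  moreover have "y\<^sup>2 / 4 * (1 / d) = 2 * (y\<^sup>2 / (8 * d))" by simp
  ultimately have "A + y * \<sigma> + y\<^sup>2 / 4 * (3 / d - 2 * \<rho> / d\<^sup>2) + y * T / (2 * d) \<ge> A / 2 - 2 * d * \<sigma>\<^sup>2"
    using 2 3 by argo
  then have "m\<^sup>2 * (A / 2 - 2 * d * \<sigma>\<^sup>2)
      \<le> m\<^sup>2 * (A + y * \<sigma> + y\<^sup>2 / 4 * (3 / d - 2 * \<rho> / d\<^sup>2) + y * T / (2 * d))"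
    by (intro mult_left_mono) auto
  moreover have "m\<^sup>2 * (2 * d * \<sigma>\<^sup>2) \<le> 1 * (2 * d * \<sigma>\<^sup>2)"
    using m d by (intro mult_right_mono) auto
  ultimately have main: "m\<^sup>2 * A / 2 - 2 * d * \<sigma>\<^sup>2
      \<le> m\<^sup>2 * (A + y * \<sigma> + y\<^sup>2 / 4 * (3 / d - 2 * \<rho> / d\<^sup>2) + y * T / (2 * d))"
    by (simp add: algebra_simps)
  \<comment> \<open>In the shell the cutoff costs \<open>128 = 64 * 2\<close> from \<open>\<psi> \<nabla>\<psi>\<close> and \<open>2\<close> from \<open>\<psi>\<^sup>2 V / 4\<close>.\<close>
  have cross: "2 * m * (- (4 * k / M\<^sup>2)) * (y * T + y\<^sup>2 / 4 * \<rho> / d)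
      \<ge> - (m\<^sup>2 * A / 4) - (if M\<^sup>2 < \<rho> \<and> \<rho> < 2 * M\<^sup>2 then 130 * y\<^sup>2 / M\<^sup>2 else 0)"
  proof (cases "m = 0 \<or> k = 0")
    case True
    have "0 \<le> m\<^sup>2 * A / 4" "0 \<le> (if M\<^sup>2 < \<rho> \<and> \<rho> < 2 * M\<^sup>2 then 130 * y\<^sup>2 / M\<^sup>2 else 0)"
      using assms(5) by auto
    moreover have "2 * m * (- (4 * k / M\<^sup>2)) * (y * T + y\<^sup>2 / 4 * \<rho> / d) = 0" using True by auto
    ultimately show ?thesis by linarith
  next
    case False
    have "k \<ge> 0" by (simp add: k_def)
    then have k: "k > 0" using False by linarith
    then have keq: "k = \<rho> / M\<^sup>2 - 1" by (simp add: k_def max_def split: if_splits)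
    have "k\<^sup>2 < 1" using False by (simp add: m_def max_def split: if_splits)
    then have k1: "k < 1" using k by (simp add: power2_less_1_iff abs_square_less_1)
    have \<rho>: "M\<^sup>2 < \<rho>" "\<rho> < 2 * M\<^sup>2"
      using k k1 assms(2) unfolding keq by (auto simp: field_simps)
    then have \<rho>0: "\<rho> > 0" using assms(2) by (smt (verit) zero_less_power)
    have "m\<^sup>2 * T\<^sup>2 / \<rho> \<le> m\<^sup>2 * A"
      using assms(4) \<rho>0 mult_left_mono[OF assms(4), of "m\<^sup>2"] by (simp add: field_simps)
    moreover have "0 \<le> (m * T / 2 - 8 * k * y * \<rho> / M\<^sup>2)\<^sup>2 / \<rho>" using \<rho>0 by simp
    moreover have "(m * T / 2 - 8 * k * y * \<rho> / M\<^sup>2)\<^sup>2 / \<rho>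
        = m\<^sup>2 * T\<^sup>2 / \<rho> / 4 - 8 * m * k / M\<^sup>2 * (y * T) + 64 * (k\<^sup>2 * (\<rho> / M\<^sup>2)) * (y\<^sup>2 / M\<^sup>2)"
      using \<rho>0 assms(2) by (simp add: field_simps power2_eq_square)
    moreover have "64 * (k\<^sup>2 * (\<rho> / M\<^sup>2)) * (y\<^sup>2 / M\<^sup>2) \<le> 64 * (1 * 2) * (y\<^sup>2 / M\<^sup>2)"
      using \<open>k\<^sup>2 < 1\<close> \<rho> assms(2) by (intro mult_right_mono mult_left_mono mult_mono) (auto simp: field_simps)
    ultimately have a: "8 * m * k / M\<^sup>2 * (y * T) \<le> m\<^sup>2 * A / 4 + 128 * (y\<^sup>2 / M\<^sup>2)" by argo
    have "(m * k) * (\<rho> / d) \<le> (1 * 1) * 1"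
      using m k k1 d \<rho>0 by (intro mult_mono) (auto simp: field_simps)
    then have "2 * ((m * k) * (\<rho> / d)) * (y\<^sup>2 / M\<^sup>2) \<le> 2 * 1 * (y\<^sup>2 / M\<^sup>2)"
      by (intro mult_right_mono) auto
    then have b: "8 * m * k / M\<^sup>2 * (y\<^sup>2 / 4 * \<rho> / d) \<le> 2 * (y\<^sup>2 / M\<^sup>2)"
      by (simp add: field_simps)
    show ?thesis using a b \<rho> by (simp add: algebra_simps)
  qed
  show ?thesis using main cross by simp
qed

lemma sum_power2_partial_eq_norm_grad: "(\<Sum>i\<in>UNIV. (dird (axis i 1) \<psi> x)\<^sup>2) = (norm (grad \<psi> x))\<^sup>2"
  by (simp add: power2_norm_eq_inner inner_vec_def grad_def partial_eq_dird flip: power2_eq_square)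

text \<open>Integrating the pointwise bound over the space removes the divergence. On the shell
\<open>M\<^sup>2 \<le> \<bar>x\<bar>\<^sup>2 \<le> 2 M\<^sup>2\<close> the error is \<open>O(\<psi>\<^sup>2 / M\<^sup>2) = O(M\<^sup>-\<^sup>4)\<close> by the barrier, its integral is \<open>O(1/M)\<close>, and \<open>M\<close> tends to
infinity. The gradient is estimated on the ball only, which is where it is needed and avoids asking for
its integrability on the whole space.\<close>
lemma poisson_energy_estimate:
  fixes \<psi> :: "vec3 \<Rightarrow> real"
  assumes \<psi>: "smooth \<psi>" and lim: "(\<psi> \<longlongrightarrow> 0) at_infinity"
    and supp: "\<And>x. laplacian \<psi> x \<noteq> 0 \<Longrightarrow> norm x \<le> R" and R: "R > 0"
  shows "(LBINT x. indicator (cball 0 R) x * (norm (grad \<psi> x))\<^sup>2) \<le> 16 * R\<^sup>2 * (LBINT x. (laplacian \<psi> x)\<^sup>2)"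
proof -
  let ?\<sigma> = "laplacian \<psi>"
  let ?D = "\<lambda>i::3. dird (axis i 1)"
  have pos: "1 + y \<bullet> y > 0" for y :: vec3 by (simp add: add_pos_nonneg)
  have \<sigma>_smooth: "smooth ?\<sigma>"
    unfolding laplacian_eq[abs_def] by (intro smooth_intros smooth_dird \<psi>)
  have \<sigma>_bsupp: "bsupp ?\<sigma>" using supp by (rule bsuppI)
  have \<sigma>2_int: "integrable lborel (\<lambda>x. (?\<sigma> x)\<^sup>2)"
    by (intro integrable_smooth smooth_power2 \<sigma>_smooth bsupp_mono[OF \<sigma>_bsupp]) auto
  obtain s where s: "s \<ge> 0" "\<And>x. \<bar>?\<sigma> x\<bar> \<le> s"
    using bounded_bsupp[OF smooth_continuous[OF \<sigma>_smooth] \<sigma>_bsupp] by blast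
  \<comment> \<open>The multiple of the barrier that dominates a source bounded by \<open>s\<close> on the ball of radius \<open>R\<close>.\<close>
  define a where "a = (s + 1) / (3 * (1 + R\<^sup>2) powr (-5/2))"
  have "1 + R\<^sup>2 > 0" by (simp add: add_pos_nonneg)
  then have a: "a > 0" using s(1) by (simp add: a_def)
  have \<psi>_bound: "\<bar>\<psi> x\<bar> \<le> a * (1 + x \<bullet> x) powr (-1/2)" for x
  proof (rule barrier_bound[OF \<psi> lim])
    fix x
    show "\<bar>?\<sigma> x\<bar> < 3 * a * (1 + x \<bullet> x) powr (-5/2)"
    proof (cases "?\<sigma> x = 0")
      case True
      then show ?thesis using a pos[of x] by (simp add: less_imp_neq[symmetric])
    next
      case False
      then have "x \<bullet> x \<le> R\<^sup>2"
        using supp[of x] by (simp add: power2_norm_eq_inner[symmetric] power_mono)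
      then have "(1 + R\<^sup>2) powr (-5/2) \<le> (1 + x \<bullet> x) powr (-5/2)"
        using pos[of x] by (intro powr_mono2') auto
      then have "3 * a * (1 + R\<^sup>2) powr (-5/2) \<le> 3 * a * (1 + x \<bullet> x) powr (-5/2)"
        using a by (intro mult_left_mono) auto
      moreover have "3 * a * (1 + R\<^sup>2) powr (-5/2) = s + 1"
        using add_pos_nonneg[of 1 "R\<^sup>2"] by (simp add: a_def)
      ultimately show ?thesis using s(2)[of x] by linarith
    qed
  qed
  have \<psi>2: "(\<psi> x)\<^sup>2 \<le> a\<^sup>2 / (1 + x \<bullet> x)" for x
  proof -
    have "\<bar>\<psi> x\<bar>\<^sup>2 \<le> (a * (1 + x \<bullet> x) powr (-1/2))\<^sup>2"
      by (intro power_mono \<psi>_bound) auto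
    also have "\<dots> = a\<^sup>2 * ((1 + x \<bullet> x) powr (-1/2) * (1 + x \<bullet> x) powr (-1/2))"
      by (simp add: power2_eq_square)
    also have "\<dots> = a\<^sup>2 * (1 + x \<bullet> x) powr (-1)"
      by (subst powr_add[symmetric]) simp
    finally show ?thesis using pos[of x] by (simp add: powr_minus_divide)
  qed
  let ?A = "\<lambda>x. (norm (grad \<psi> x))\<^sup>2"
  have A_cont: "continuous_on X ?A" for X
    by (intro continuous_intros smooth_continuous smooth_grad \<psi>)
  \<comment> \<open>The constant is \<open>520 = 4 * 130\<close>, and \<open>8 M\<^sup>3\<close> is the volume factor of the ball of radius \<open>2 M\<close>.\<close>
  have est: "(LBINT x. indicator (cball 0 R) x * ?A x) \<le> 16 * R\<^sup>2 * (LBINT x. (?\<sigma> x)\<^sup>2)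
      + 520 * a\<^sup>2 * measure lborel (cball (0::vec3) 1) * 8 / M" if M: "M \<ge> R" for M
  proof -
    have M0: "M > 0" using R M by simp
    define k where "k x = max 0 (x \<bullet> x / M\<^sup>2 - 1)" for x :: vec3
    define m where "m x = max 0 (1 - (k x)\<^sup>2)" for x
    define d where "d x = R\<^sup>2 + x \<bullet> x" for x :: vec3
    have d0: "d x > 0" for x using R by (auto simp: d_def add_pos_nonneg)
    have k_eq: "(k x)\<^sup>2 = pos_sq (x \<bullet> x / M\<^sup>2 - 1)" for x by (simp add: k_def pos_sq_def)
    have m_eq: "(m x)\<^sup>2 = pos_sq (1 - (k x)\<^sup>2)" for x by (simp add: m_def pos_sq_def)
    define w where "w i x = (m x)\<^sup>2 * (\<psi> x * ?D i \<psi> x + (\<psi> x)\<^sup>2 / 4 * (x $ i / d x))" for i x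
    define w' where "w' i x = (m x)\<^sup>2 * ((?D i \<psi> x)\<^sup>2 + \<psi> x * ?D i (?D i \<psi>) x
        + (\<psi> x)\<^sup>2 / 4 * (1 / d x - 2 * (x $ i)\<^sup>2 / (d x)\<^sup>2) + \<psi> x * (?D i \<psi> x * x $ i) / (2 * d x))
        + 2 * m x * (- (4 * k x * x $ i / M\<^sup>2)) * (\<psi> x * ?D i \<psi> x + (\<psi> x)\<^sup>2 / 4 * (x $ i / d x))" for i x
    have m_cont: "continuous_on UNIV (\<lambda>x. m x)" "continuous_on UNIV (\<lambda>x. k x)" "continuous_on UNIV d"
      unfolding m_def k_def d_def using M0 by (intro continuous_intros; simp)+
    have \<psi>_cont: "continuous_on UNIV \<psi>" "continuous_on UNIV (?D i \<psi>)" "continuous_on UNIV (?D i (?D i \<psi>))" for i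
      by (intro smooth_continuous smooth_dird \<psi>)+
    have m0: "x \<bullet> x < 2 * M\<^sup>2" if "m x \<noteq> 0" for x
    proof (rule ccontr)
      assume "\<not> x \<bullet> x < 2 * M\<^sup>2"
      then have "2 \<le> x \<bullet> x / M\<^sup>2" using M0 by (simp add: pos_le_divide_eq)
      then have "k x \<ge> 1" by (simp add: k_def)
      then have "(k x)\<^sup>2 \<ge> 1" by simp
      then show False using that by (simp add: m_def)
    qed
    have inner_ball: "norm x \<le> 2 * M" if "x \<bullet> x < 2 * M\<^sup>2" for x :: vec3
    proof (rule power2_le_imp_le)
      show "(norm x)\<^sup>2 \<le> (2 * M)\<^sup>2"
        unfolding power2_norm_eq_inner power_mult_distrib using that zero_le_power2[of M]
        by (simp, linarith)
    qed (use M0 in simp)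
    have m_bsupp: "bsupp m"
    proof (rule bsuppI)
      fix x assume "m x \<noteq> 0"
      then show "norm x \<le> 2 * M" using m0 inner_ball by blast
    qed
    have zero: "(LBINT x. w' i x) = 0" for i
    proof (rule integral_dir_derivative_eq_0)
      fix x :: vec3
      let ?l = "\<lambda>s. x + s *\<^sub>R axis i 1"
      have dr: "((\<lambda>s. ?l s \<bullet> ?l s) has_real_derivative 2 * x $ i) (at 0)"
        unfolding inner_along_axis by (auto intro!: derivative_eq_intros)
      have dx: "((\<lambda>s. ?l s $ i) has_real_derivative 1) (at 0)"
        by (auto intro!: derivative_eq_intros simp: axis_def)
      have d1: "((\<lambda>s. \<psi> (?l s)) has_real_derivative ?D i \<psi> x) (at 0)"
      by (rule smooth_DERIV_along_line(2)[OF \<psi>])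
      have d2: "((\<lambda>s. ?D i \<psi> (?l s)) has_real_derivative ?D i (?D i \<psi>) x) (at 0)"
      by (rule smooth_DERIV_along_line(2)[OF smooth_dird[OF \<psi>]])
      have dk: "((\<lambda>s. (k (?l s))\<^sup>2) has_real_derivative 2 * k x * (2 * x $ i / M\<^sup>2)) (at 0)"
        unfolding k_eq
      proof -
        have "((\<lambda>s. ?l s \<bullet> ?l s / M\<^sup>2 - 1) has_real_derivative 2 * x $ i / M\<^sup>2) (at 0)"
          using DERIV_diff[OF DERIV_cdivide[OF dr] DERIV_const[of 1]] by simp
        from DERIV_chain2[OF DERIV_pos_sq this]
        show "((\<lambda>s. pos_sq (?l s \<bullet> ?l s / M\<^sup>2 - 1)) has_real_derivative 2 * k x * (2 * x $ i / M\<^sup>2)) (at 0)"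
          by (simp add: k_def)
      qed
      have dm: "((\<lambda>s. (m (?l s))\<^sup>2) has_real_derivative 2 * m x * (- (4 * k x * x $ i / M\<^sup>2))) (at 0)"
        unfolding m_eq
      proof -
        have "((\<lambda>s. 1 - (k (?l s))\<^sup>2) has_real_derivative - (2 * k x * (2 * x $ i / M\<^sup>2))) (at 0)"
          by (rule derivative_eq_intros dk refl)+ simp
        from DERIV_chain2[OF DERIV_pos_sq this]
        show "((\<lambda>s. pos_sq (1 - (k (?l s))\<^sup>2)) has_real_derivative 2 * m x * (- (4 * k x * x $ i / M\<^sup>2))) (at 0)"
          by (simp add: m_def)
      qed
      have dd: "((\<lambda>s. d (?l s)) has_real_derivative 2 * x $ i) (at 0)"
        unfolding d_def by (rule derivative_eq_intros dr refl)+ simp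
      have e: "((\<lambda>s. ?l s $ i / d (?l s)) has_real_derivative
          (1 * d (?l 0) - ?l 0 $ i * (2 * x $ i)) / (d (?l 0) * d (?l 0))) (at 0)"
        by (rule DERIV_divide[OF dx dd]) (use d0[of x] in simp)
      show "((\<lambda>s. w i (?l s)) has_real_derivative w' i x) (at 0)"
        unfolding w_def
        by (rule DERIV_cong[OF DERIV_mult[OF dm DERIV_add[OF DERIV_mult[OF d1 d2]
                DERIV_mult[OF DERIV_cdivide[OF DERIV_power[OF d1, of 2]] e]]]])
           (use d0[of x] in \<open>simp add: w'_def field_simps power2_eq_square\<close>)
    next
      show "continuous_on UNIV (w i)" "continuous_on UNIV (w' i)"
        unfolding w_def w'_def using d0 M0
        by (intro continuous_intros m_cont \<psi>_cont; simp add: less_imp_neq[symmetric])+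
      show "bsupp (w i)" by (rule bsupp_mono[OF m_bsupp]) (auto simp: w_def)
    qed
    define W where "W x = (\<Sum>i\<in>UNIV. w' i x)" for x
    have w'_int: "integrable lborel (w' i)" for i
    proof (rule integrable_bsupp)
      show "continuous_on UNIV (w' i)"
        unfolding w'_def using d0 M0
        by (intro continuous_intros m_cont \<psi>_cont; simp add: less_imp_neq[symmetric])
      show "bsupp (w' i)" by (rule bsupp_mono[OF m_bsupp]) (auto simp: w'_def)
    qed
    have W0: "(LBINT x. W x) = 0" and W_int: "integrable lborel W"
      unfolding W_def using zero w'_int by (auto simp: Bochner_Integration.integral_sum)
    let ?T = "\<lambda>x. grad \<psi> x \<bullet> x"
    have W_eq: "W x = (m x)\<^sup>2 * (?A x + \<psi> x * ?\<sigma> x + (\<psi> x)\<^sup>2 / 4 * (3 / d x - 2 * (x \<bullet> x) / (d x)\<^sup>2)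
          + \<psi> x * ?T x / (2 * d x))
        + 2 * m x * (- (4 * k x / M\<^sup>2)) * (\<psi> x * ?T x + (\<psi> x)\<^sup>2 / 4 * (x \<bullet> x) / d x)" for x
      unfolding sum_power2_partial_eq_norm_grad[symmetric] 
      unfolding W_def w'_def laplacian_eq inner_vec_def grad_def partial_eq_dird UNIV_3
      by (simp add: algebra_simps add_divide_distrib power2_eq_square)
    let ?E = "130 * a\<^sup>2 / M ^ 4"
    have lower: "(m x)\<^sup>2 * ?A x / 4 - 4 * R\<^sup>2 * (?\<sigma> x)\<^sup>2 - ?E * indicator (cball 0 (2 * M)) x \<le> W x" for x
    proof -
      have "(?T x)\<^sup>2 \<le> ?A x * (x \<bullet> x)"
        using Cauchy_Schwarz_ineq[of "grad \<psi> x" x] by (simp add: power2_norm_eq_inner)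
      then have "(m x)\<^sup>2 * ?A x / 4 - 2 * d x * (?\<sigma> x)\<^sup>2 - (if M\<^sup>2 < x \<bullet> x \<and> x \<bullet> x < 2 * M\<^sup>2 then 130 * (\<psi> x)\<^sup>2 / M\<^sup>2 else 0) \<le> W x"
        unfolding W_eq m_def k_def d_def
        by (intro energy_density_bound R M0) auto
      moreover have "2 * d x * (?\<sigma> x)\<^sup>2 \<le> 4 * R\<^sup>2 * (?\<sigma> x)\<^sup>2"
      proof (cases "?\<sigma> x = 0")
        case False
        then have "x \<bullet> x \<le> R\<^sup>2"
          using supp[of x] by (simp add: power2_norm_eq_inner[symmetric] power_mono)
        then show ?thesis by (intro mult_right_mono) (auto simp: d_def)
      qed simp
      moreover have "(if M\<^sup>2 < x \<bullet> x \<and> x \<bullet> x < 2 * M\<^sup>2 then 130 * (\<psi> x)\<^sup>2 / M\<^sup>2 else 0) \<le> ?E * indicator (cball 0 (2 * M)) x"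
      proof (cases "M\<^sup>2 < x \<bullet> x \<and> x \<bullet> x < 2 * M\<^sup>2")
        case True
        then have n: "norm x \<le> 2 * M" using inner_ball by blast
        have "(\<psi> x)\<^sup>2 \<le> a\<^sup>2 / M\<^sup>2"
          using \<psi>2[of x] True M0 by (elim order_trans) (auto intro!: divide_left_mono mult_pos_pos add_pos_pos)
        then have "130 * (\<psi> x)\<^sup>2 / M\<^sup>2 \<le> 130 * (a\<^sup>2 / M\<^sup>2) / M\<^sup>2"
          by (intro divide_right_mono mult_left_mono) auto
        also have "\<dots> = ?E" by (simp add: power2_eq_square power4_eq_xxxx)
        finally show ?thesis using True n by simp
      next
        case False
        then show ?thesis by (simp only: if_False) simp
      qed
      ultimately show ?thesis by linarith
    qed
    have mA_int: "integrable lborel (\<lambda>x. (m x)\<^sup>2 * ?A x)"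
      by (intro integrable_bsupp continuous_intros m_cont A_cont bsupp_mono[OF m_bsupp]) auto
    note ball_int = integrable_indicator_cball[of "0::vec3" "2 * M"]
    have "(LBINT x. (m x)\<^sup>2 * ?A x / 4 - 4 * R\<^sup>2 * (?\<sigma> x)\<^sup>2 - ?E * indicator (cball 0 (2 * M)) x)
        \<le> (LBINT x. W x)"
      using mA_int \<sigma>2_int ball_int W_int lower
      by (intro integral_mono) auto
    also have "(LBINT x. (m x)\<^sup>2 * ?A x / 4 - 4 * R\<^sup>2 * (?\<sigma> x)\<^sup>2 - ?E * indicator (cball 0 (2 * M)) x)
        = (LBINT x. (m x)\<^sup>2 * ?A x) / 4 - 4 * R\<^sup>2 * (LBINT x. (?\<sigma> x)\<^sup>2) - ?E * measure lborel (cball (0::vec3) (2 * M))"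
      using mA_int \<sigma>2_int ball_int by (simp add: Bochner_Integration.integral_diff)
    finally have up: "(LBINT x. (m x)\<^sup>2 * ?A x) \<le> 16 * R\<^sup>2 * (LBINT x. (?\<sigma> x)\<^sup>2) + 4 * ?E * measure lborel (cball (0::vec3) (2 * M))"
      using W0 by simp
    have vol: "measure lborel (cball (0::vec3) (2 * M)) = 8 * M ^ 3 * measure lborel (cball (0::vec3) 1)"
      using M0 by (simp add: content_cball power_mult_distrib)
    have "(LBINT x. indicator (cball 0 R) x * ?A x) \<le> (LBINT x. (m x)\<^sup>2 * ?A x)"
    proof (rule integral_mono[OF _ mA_int])
      show "integrable lborel (\<lambda>x. indicator (cball 0 R) x * ?A x)"
        using borel_integrable_compact[OF compact_cball A_cont] by simp
      fix x
      show "indicator (cball 0 R) x * ?A x \<le> (m x)\<^sup>2 * ?A x"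
      proof (cases "x \<in> cball 0 R")
        case True
        then have "x \<bullet> x \<le> M\<^sup>2"
          using M power_mono[of "norm x" M 2] by (simp add: power2_norm_eq_inner)
        then have "k x = 0" using M0 by (simp add: k_def)
        then show ?thesis by (simp add: m_def indicator_def)
      qed auto
    qed
    also note up
    also have "4 * ?E * measure lborel (cball (0::vec3) (2 * M)) = 520 * a\<^sup>2 * measure lborel (cball (0::vec3) 1) * 8 / M"
      unfolding vol using M0 by (simp add: field_simps power_numeral_reduce)
    finally show ?thesis .
  qed
  have "((\<lambda>M. 16 * R\<^sup>2 * (LBINT x. (?\<sigma> x)\<^sup>2) + 520 * a\<^sup>2 * measure lborel (cball (0::vec3) 1) * 8 / M)
      \<longlongrightarrow> 16 * R\<^sup>2 * (LBINT x. (?\<sigma> x)\<^sup>2) + 0) at_top"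
    by (intro tendsto_intros tendsto_divide_0[OF tendsto_const] filterlim_at_top_imp_at_infinity filterlim_ident)
  then have "(LBINT x. indicator (cball 0 R) x * ?A x) \<le> 16 * R\<^sup>2 * (LBINT x. (?\<sigma> x)\<^sup>2) + 0"
    by (rule tendsto_lowerbound) (use est in \<open>auto simp: eventually_at_top_linorder\<close>)
  then show ?thesis by simp
qed

section \<open>Velocity averages and the vector fields \<open>L\<^sub>i\<close>\<close>

text \<open>The vector field \<open>Lfield\<close> on uncurried functions.\<close>
definition Lop :: "(vec3 \<Rightarrow> real) \<Rightarrow> real \<Rightarrow> 3 \<Rightarrow> (vec3 \<times> vec3 \<Rightarrow> real) \<Rightarrow> vec3 \<times> vec3 \<Rightarrow> real" where
  "Lop \<phi> t i h = (\<lambda>z. t * dird (axis i 1, 0) h z + dird (0, axis i 1) h z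
     + ln t / t * (\<Sum>k\<in>UNIV. partial i (partial k \<phi>) (snd z) * dird (0, axis k 1) h z))"

lemma Lfield_eq_Lop: "case_prod (Lfield \<phi> t i g) = Lop \<phi> t i (case_prod g)"
  by (auto simp: Lfield_def Lop_def fun_eq_iff dx_eq_dird[symmetric] dp_eq_dird[symmetric])

lemma smooth_partial: "smooth h \<Longrightarrow> smooth (partial i h)" for h :: "vec3 \<Rightarrow> real"
  unfolding partial_eq_dird by (rule smooth_dird)

lemma smooth_snd_compose:
  fixes c :: "'b::euclidean_space \<Rightarrow> real"
  shows "smooth c \<Longrightarrow> smooth (\<lambda>z::'a::euclidean_space \<times> 'b. c (snd z))"
  by (rule smooth_compose) (auto intro: smooth_intros)

lemma smooth_Lop: "smooth \<phi> \<Longrightarrow> smooth h \<Longrightarrow> smooth (Lop \<phi> t i h)"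
  unfolding Lop_def by (intro smooth_intros smooth_dird smooth_partial smooth_snd_compose)

lemma Lop_eq_0_outside:
  assumes "\<And>z. h z \<noteq> 0 \<Longrightarrow> z \<in> S" "closed S" "z \<notin> S" shows "Lop \<phi> t i h z = 0"
  using dird_eq_0_outside[of h S z, OF assms] by (simp add: Lop_def)

lemma bsupp_Lop: "bsupp h \<Longrightarrow> bsupp (Lop \<phi> t i h)"
  unfolding Lop_def by (intro bsupp_add bsupp_mult_right bsupp_sum bsupp_dird)

lemma Lop_mult:
  assumes "smooth f" "smooth g"
  shows "Lop \<phi> t i (\<lambda>z. f z * g z) = (\<lambda>z. f z * Lop \<phi> t i g z + Lop \<phi> t i f z * g z)"
  unfolding Lop_def by (simp add: fun_eq_iff dird_mult[OF assms] algebra_simps sum.distrib sum_distrib_left)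

lemma Lop_add:
  assumes "smooth f" "smooth g"
  shows "Lop \<phi> t i (\<lambda>z. f z + g z) = (\<lambda>z. Lop \<phi> t i f z + Lop \<phi> t i g z)"
  unfolding Lop_def by (simp add: fun_eq_iff dird_add[OF assms] algebra_simps sum.distrib sum_distrib_left)

text \<open>With \<open>H\<close> the Hessian of \<open>\<phi>\<close>, the momentum part of \<open>L\<^sub>i\<close> is \<open>\<partial>\<^sub>i + (ln t / t) \<Sum>\<^sub>k H\<^sub>i\<^sub>k \<partial>\<^sub>k\<close>. Below,
\<open>hess_dir\<close> is the vector field \<open>\<Sum>\<^sub>k H\<^sub>i\<^sub>k \<partial>\<^sub>k\<close> and \<open>hess_div\<close> its divergence.\<close>

definition hess_dir :: "(vec3 \<Rightarrow> real) \<Rightarrow> 3 \<Rightarrow> (vec3 \<Rightarrow> real) \<Rightarrow> vec3 \<Rightarrow> real" where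
  "hess_dir \<phi> i c p = (\<Sum>k\<in>UNIV. partial i (partial k \<phi>) p * partial k c p)"

definition hess_div :: "(vec3 \<Rightarrow> real) \<Rightarrow> 3 \<Rightarrow> vec3 \<Rightarrow> real" where
  "hess_div \<phi> i p = (\<Sum>k\<in>UNIV. partial k (partial i (partial k \<phi>)) p)"

lemma smooth_hess_dir: "smooth \<phi> \<Longrightarrow> smooth c \<Longrightarrow> smooth (hess_dir \<phi> i c)"
  unfolding hess_dir_def[abs_def] by (intro smooth_intros smooth_partial)

lemma smooth_hess_div: "smooth \<phi> \<Longrightarrow> smooth (hess_div \<phi> i)"
  unfolding hess_div_def[abs_def] by (intro smooth_intros smooth_partial)

lemma dird_snd_compose:
  fixes c :: "'b::euclidean_space \<Rightarrow> real"
  shows "dird (v, w) (\<lambda>z::'a::euclidean_space \<times> 'b. c (snd z)) z = dird w c (snd z)"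
  by (simp add: dird_def)

lemma Lop_momentum:
  "Lop \<phi> t i (\<lambda>z. c (snd z)) = (\<lambda>z. partial i c (snd z) + ln t / t * hess_dir \<phi> i c (snd z))"
  by (simp add: fun_eq_iff Lop_def dird_snd_compose hess_dir_def partial_eq_dird)
     (simp add: dird_def)

text \<open>\<open>L\<^sub>i\<close> completed to divergence form: it differs from \<open>t \<partial>\<^sub>x\<close> by a divergence in \<open>p\<close>.\<close>
definition Top :: "(vec3 \<Rightarrow> real) \<Rightarrow> real \<Rightarrow> 3 \<Rightarrow> (vec3 \<times> vec3 \<Rightarrow> real) \<Rightarrow> vec3 \<times> vec3 \<Rightarrow> real" where
  "Top \<phi> t i h = (\<lambda>z. Lop \<phi> t i h z + ln t / t * hess_div \<phi> i (snd z) * h z)"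

lemma smooth_Top: "smooth \<phi> \<Longrightarrow> smooth h \<Longrightarrow> smooth (Top \<phi> t i h)"
  unfolding Top_def by (intro smooth_intros smooth_Lop smooth_snd_compose smooth_hess_div)

lemma bsupp_Top: "bsupp h \<Longrightarrow> bsupp (Top \<phi> t i h)"
  unfolding Top_def by (intro bsupp_add bsupp_mult_right bsupp_Lop)

lemma integrable_slice:
  fixes h :: "'a::euclidean_space \<times> 'b::euclidean_space \<Rightarrow> real"
  shows "smooth h \<Longrightarrow> bsupp h \<Longrightarrow> integrable lborel (\<lambda>p. h (x, p))"
  by (intro integrable_smooth smooth_slice bsupp_slice)

text \<open>The \<open>p\<close>-divergence integrates to zero, so under the integral over \<open>p\<close> the derivative \<open>\<partial>\<^sub>x\<close>, for which there
is no estimate, becomes \<open>1/t\<close> times an operator built from \<open>L\<^sub>i\<close>.\<close>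
lemma integral_dx_eq_integral_Top:
  assumes \<phi>: "smooth \<phi>" and h: "smooth h" "bsupp h" and t: "t > 0"
  shows "(LBINT p. dird (axis i 1, 0) h (x, p)) = (LBINT p. Top \<phi> t i h (x, p)) / t"
proof -
  let ?H = "\<lambda>k. partial i (partial k \<phi>)"
  have H: "smooth (?H k)" for k by (intro smooth_partial \<phi>)
  have int: "integrable lborel (\<lambda>p. dird v h (x, p))" for v
    by (intro integrable_slice smooth_dird bsupp_dird h)
  have intH: "integrable lborel (\<lambda>p. ?H k p * dird (0, axis k 1) h (x, p) + partial k (?H k) p * h (x, p))" for k
    by (intro integrable_smooth smooth_intros smooth_slice smooth_dird smooth_partial bsupp_add bsupp_mult_right
        bsupp_slice bsupp_dird h \<phi>)
  have 1: "(LBINT p. dird (0, axis i 1) h (x, p)) = 0"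
    using integral_dird_eq_0[of "\<lambda>p. h (x, p)" "axis i 1"] smooth_slice[OF h(1)] bsupp_slice[OF h(2)]
    by (simp add: dird_slice)
  have 2: "(LBINT p. ?H k p * dird (0, axis k 1) h (x, p) + partial k (?H k) p * h (x, p)) = 0" for k
  proof -
    have "dird (axis k 1) (\<lambda>p. ?H k p * h (x, p)) p
        = ?H k p * dird (0, axis k 1) h (x, p) + partial k (?H k) p * h (x, p)" for p
      by (subst dird_mult[OF H smooth_slice[OF h(1)]]) (simp add: dird_slice partial_eq_dird)
    then show ?thesis
      using integral_dird_eq_0[of "\<lambda>p. ?H k p * h (x, p)" "axis k 1"] h H
      by (simp add: smooth_mult smooth_slice bsupp_mult_right bsupp_slice)
  qed
  have "Top \<phi> t i h (x, p) = t * dird (axis i 1, 0) h (x, p) + dird (0, axis i 1) h (x, p)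
      + ln t / t * (\<Sum>k\<in>UNIV. ?H k p * dird (0, axis k 1) h (x, p) + partial k (?H k) p * h (x, p))" for p
    unfolding Top_def Lop_def hess_div_def by (simp add: sum.distrib sum_distrib_left sum_distrib_right algebra_simps)
  then have "(LBINT p. Top \<phi> t i h (x, p)) = t * (LBINT p. dird (axis i 1, 0) h (x, p))"
    using int intH 1 2 by (simp add: Bochner_Integration.integral_sum)
  then show ?thesis using t by simp
qed

text \<open>Expansion by the Leibniz rule. Every factor \<open>u\<close> is differentiated by \<open>L\<^sub>1, L\<^sub>2, L\<^sub>3\<close> at most once each and in this
order, so exactly the derivatives \<open>L\<^sup>I u\<close> occur and no commutators have to be estimated.\<close>
lemma Top_cubed_square:
  fixes t :: real
  assumes \<phi>: "smooth \<phi>" and u: "smooth u"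
  defines "L \<equiv> Lop \<phi> t" and "a \<equiv> \<lambda>i z. ln t / t * hess_div \<phi> i (snd z)"
  shows "Top \<phi> t 1 (Top \<phi> t 2 (Top \<phi> t 3 (\<lambda>z. u z * u z))) =
    (\<lambda>z. 2 * (u z * L 1 (L 2 (L 3 u)) z + L 1 u z * L 2 (L 3 u) z + L 2 u z * L 1 (L 3 u) z + L 1 (L 2 u) z * L 3 u z)
      + 2 * L 1 (a 3) z * (u z * L 2 u z) + 2 * a 3 z * (u z * L 1 (L 2 u) z + L 1 u z * L 2 u z)
      + L 1 (L 2 (a 3)) z * (u z * u z) + 2 * L 2 (a 3) z * (u z * L 1 u z)
      + 2 * L 1 (a 2) z * (u z * L 3 u z) + 2 * a 2 z * (u z * L 1 (L 3 u) z + L 1 u z * L 3 u z)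
      + (L 1 (a 2) z * a 3 z + a 2 z * L 1 (a 3) z) * (u z * u z) + 2 * a 2 z * a 3 z * (u z * L 1 u z)
      + a 1 z * (2 * (u z * L 2 (L 3 u) z + L 2 u z * L 3 u z) + 2 * a 3 z * (u z * L 2 u z)
          + L 2 (a 3) z * (u z * u z) + 2 * a 2 z * (u z * L 3 u z) + a 2 z * a 3 z * (u z * u z)))"
proof -
  have T: "Top \<phi> t i h = (\<lambda>z. L i h z + a i z * h z)" for i h
    by (simp add: Top_def L_def a_def)
  have sa: "smooth (a i)" for i
    unfolding a_def by (intro smooth_intros smooth_snd_compose smooth_hess_div \<phi>)
  have sL: "smooth h \<Longrightarrow> smooth (L i h)" for i h unfolding L_def by (rule smooth_Lop[OF \<phi>])
  have Lm: "smooth f \<Longrightarrow> smooth g \<Longrightarrow> L i (\<lambda>z. f z * g z) = (\<lambda>z. f z * L i g z + L i f z * g z)" for f g i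
    unfolding L_def by (rule Lop_mult)
  have La: "smooth f \<Longrightarrow> smooth g \<Longrightarrow> L i (\<lambda>z. f z + g z) = (\<lambda>z. L i f z + L i g z)" for f g i
    unfolding L_def by (rule Lop_add)
  show ?thesis
    unfolding T
    by (simp only: Lm La u sa sL smooth_mult smooth_add) (simp add: fun_eq_iff algebra_simps)
qed

text \<open>The expansion, with the coefficients and derivatives at a point replaced by numbers: \<open>a\<^sub>i\<close> are the zero
order terms, \<open>b\<close> their \<open>L\<close>-derivatives and \<open>v\<close> those of \<open>u\<close>. All products are at most \<open>K\<^sup>3 q\<^sup>2\<close>, and the
integer coefficients add up to less than \<open>40\<close>.\<close>
lemma Top_cubed_square_coeff_bound:
  fixes K q a1 a2 a3 b12 b13 b23 b123 v v1 v2 v3 v12 v13 v23 v123 :: real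
  assumes K: "K \<ge> 1" and c: "\<bar>a1\<bar> \<le> K" "\<bar>a2\<bar> \<le> K" "\<bar>a3\<bar> \<le> K" "\<bar>b13\<bar> \<le> K" "\<bar>b23\<bar> \<le> K" "\<bar>b12\<bar> \<le> K" "\<bar>b123\<bar> \<le> K"
    and q: "\<bar>v\<bar> \<le> q" "\<bar>v1\<bar> \<le> q" "\<bar>v2\<bar> \<le> q" "\<bar>v3\<bar> \<le> q" "\<bar>v12\<bar> \<le> q" "\<bar>v13\<bar> \<le> q" "\<bar>v23\<bar> \<le> q" "\<bar>v123\<bar> \<le> q"
  shows "\<bar>2 * (v * v123 + v1 * v23 + v2 * v13 + v12 * v3)
      + 2 * b13 * (v * v2) + 2 * a3 * (v * v12 + v1 * v2)
      + b123 * (v * v) + 2 * b23 * (v * v1)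
      + 2 * b12 * (v * v3) + 2 * a2 * (v * v13 + v1 * v3)
      + (b12 * a3 + a2 * b13) * (v * v) + 2 * a2 * a3 * (v * v1)
      + a1 * (2 * (v * v23 + v2 * v3) + 2 * a3 * (v * v2)
          + b23 * (v * v) + 2 * a2 * (v * v3) + a2 * a3 * (v * v))\<bar> \<le> 40 * K ^ 3 * q\<^sup>2"
proof -
  have q0: "q \<ge> 0" using q(1) by linarith
  have p: "\<bar>x * y\<bar> \<le> q\<^sup>2" if "\<bar>x\<bar> \<le> q" "\<bar>y\<bar> \<le> q" for x y
    using mult_mono[OF that q0] by (simp add: abs_mult power2_eq_square)
  have K12: "K \<le> K ^ 3" "K\<^sup>2 \<le> K ^ 3" "1 \<le> K ^ 3"
    using K power_increasing[of 1 3 K] power_increasing[of 2 3 K] by auto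
  have kk: "\<bar>x * y\<bar> \<le> K\<^sup>2" if "\<bar>x\<bar> \<le> K" "\<bar>y\<bar> \<le> K" for x y
    using mult_mono[OF that] K by (simp add: abs_mult power2_eq_square)
  have kkk: "\<bar>x * y * w\<bar> \<le> K ^ 3" if "\<bar>x\<bar> \<le> K" "\<bar>y\<bar> \<le> K" "\<bar>w\<bar> \<le> K" for x y w
    using mult_mono[OF kk[OF that(1,2)] that(3)] K by (simp add: abs_mult power2_eq_square power3_eq_cube)
  have m: "\<bar>d * w\<bar> \<le> K ^ 3 * q\<^sup>2" if "\<bar>d\<bar> \<le> K ^ 3" "\<bar>w\<bar> \<le> q\<^sup>2" for d w
    using mult_mono[OF that] K by (simp add: abs_mult)
  have m0: "\<bar>w\<bar> \<le> K ^ 3 * q\<^sup>2" if "\<bar>w\<bar> \<le> q\<^sup>2" for w using m[of 1 w] that K12 by simp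
  have m1: "\<bar>d * (x * y)\<bar> \<le> K ^ 3 * q\<^sup>2" if "\<bar>d\<bar> \<le> K" "\<bar>x\<bar> \<le> q" "\<bar>y\<bar> \<le> q" for d x y
    using m[OF _ p[OF that(2,3)]] that(1) K12 by simp
  have m2: "\<bar>d * e * (x * y)\<bar> \<le> K ^ 3 * q\<^sup>2" if "\<bar>d\<bar> \<le> K" "\<bar>e\<bar> \<le> K" "\<bar>x\<bar> \<le> q" "\<bar>y\<bar> \<le> q" for d e x y
    using m[OF _ p[OF that(3,4)]] kk[OF that(1,2)] K12 by simp
  have m3: "\<bar>d * e * f * (x * y)\<bar> \<le> K ^ 3 * q\<^sup>2" if "\<bar>d\<bar> \<le> K" "\<bar>e\<bar> \<le> K" "\<bar>f\<bar> \<le> K" "\<bar>x\<bar> \<le> q" "\<bar>y\<bar> \<le> q" for d e f x y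
    using m[OF kkk[OF that(1,2,3)] p[OF that(4,5)]] .
  note ts = m0[OF p[OF q(1) q(8)]] m0[OF p[OF q(2) q(7)]] m0[OF p[OF q(3) q(6)]] m0[OF p[OF q(5) q(4)]]
    m1[OF c(4) q(1) q(3)] m1[OF c(3) q(1) q(5)] m1[OF c(3) q(2) q(3)] m1[OF c(7) q(1) q(1)] m1[OF c(5) q(1) q(2)]
    m1[OF c(6) q(1) q(4)] m1[OF c(2) q(1) q(6)] m1[OF c(2) q(2) q(4)]
    m2[OF c(6) c(3) q(1) q(1)] m2[OF c(2) c(4) q(1) q(1)] m2[OF c(2) c(3) q(1) q(2)]
    m1[OF c(1) q(1) q(7)] m1[OF c(1) q(3) q(4)] m2[OF c(1) c(3) q(1) q(3)] m2[OF c(1) c(5) q(1) q(1)]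
    m2[OF c(1) c(2) q(1) q(4)] m3[OF c(1) c(2) c(3) q(1) q(1)]
  have "2 * (v * v123 + v1 * v23 + v2 * v13 + v12 * v3)
      + 2 * b13 * (v * v2) + 2 * a3 * (v * v12 + v1 * v2)
      + b123 * (v * v) + 2 * b23 * (v * v1)
      + 2 * b12 * (v * v3) + 2 * a2 * (v * v13 + v1 * v3)
      + (b12 * a3 + a2 * b13) * (v * v) + 2 * a2 * a3 * (v * v1)
      + a1 * (2 * (v * v23 + v2 * v3) + 2 * a3 * (v * v2)
          + b23 * (v * v) + 2 * a2 * (v * v3) + a2 * a3 * (v * v))
    = 2 * (v * v123) + 2 * (v1 * v23) + 2 * (v2 * v13) + 2 * (v12 * v3)
      + 2 * (b13 * (v * v2)) + 2 * (a3 * (v * v12)) + 2 * (a3 * (v1 * v2))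
      + b123 * (v * v) + 2 * (b23 * (v * v1))
      + 2 * (b12 * (v * v3)) + 2 * (a2 * (v * v13)) + 2 * (a2 * (v1 * v3))
      + b12 * a3 * (v * v) + a2 * b13 * (v * v) + 2 * (a2 * a3 * (v * v1))
      + 2 * (a1 * (v * v23)) + 2 * (a1 * (v2 * v3)) + 2 * (a1 * a3 * (v * v2))
          + a1 * b23 * (v * v) + 2 * (a1 * a2 * (v * v3)) + a1 * a2 * a3 * (v * v)"
    by (simp add: algebra_simps)
  also have "\<bar>\<dots>\<bar> \<le> 40 * (K ^ 3 * q\<^sup>2)"
    using ts mult_nonneg_nonneg[of "K ^ 3" "q\<^sup>2"] K12(3) zero_le_power2[of q] unfolding abs_le_iff by linarith
  finally show ?thesis by simp
qed

text \<open>The zero order terms and their \<open>L\<close>-derivatives are polynomials in \<open>ln t / t \<in> [0, 1]\<close> whose coefficients are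
smooth functions of \<open>p\<close> alone; this is why one bound serves all \<open>t \<ge> 1\<close>.\<close>
lemma Lop_momentum_bound:
  assumes \<phi>: "smooth \<phi>"
  obtains K where "K \<ge> 1"
    "\<And>t i j (z :: vec3 \<times> vec3). t \<ge> 1 \<Longrightarrow> norm (snd z) \<le> P \<Longrightarrow> \<bar>ln t / t * hess_div \<phi> i (snd z)\<bar> \<le> K"
    "\<And>t i j (z :: vec3 \<times> vec3). t \<ge> 1 \<Longrightarrow> norm (snd z) \<le> P \<Longrightarrow> \<bar>Lop \<phi> t i (\<lambda>z. ln t / t * hess_div \<phi> j (snd z)) z\<bar> \<le> K"
    "\<And>t i j l (z :: vec3 \<times> vec3). t \<ge> 1 \<Longrightarrow> norm (snd z) \<le> P \<Longrightarrow>
       \<bar>Lop \<phi> t i (Lop \<phi> t j (\<lambda>z. ln t / t * hess_div \<phi> l (snd z))) z\<bar> \<le> K"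
proof -
  \<comment> \<open>\<open>L\<^sub>i c = op False i c + (ln t / t) op True i c\<close> for functions \<open>c\<close> of the momentum.\<close>
  define op where "op b i c = (if b then hess_dir \<phi> i c else partial i c)" for b :: bool and i c
  have sop: "smooth (op b i c)" if "smooth c" for b i c
    unfolding op_def using smooth_hess_dir[OF \<phi> that] smooth_partial[OF that] by auto
  let ?\<alpha> = "hess_div \<phi>"
  note s\<alpha> = smooth_hess_div[OF \<phi>]
  obtain K0 where K0: "K0 \<ge> 0" "\<And>i p. norm p \<le> P \<Longrightarrow> \<bar>?\<alpha> i p\<bar> \<le> K0"
    using smooth_family_bounded_on_cball[of "\<lambda>i::3. ?\<alpha> i" P] s\<alpha> unfolding real_norm_def by metis
  obtain K1 where K1: "K1 \<ge> 0" "\<And>b i j p. norm p \<le> P \<Longrightarrow> \<bar>op b i (?\<alpha> j) p\<bar> \<le> K1"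
  proof -
    have "smooth (case x of (b, i, j) \<Rightarrow> op b i (?\<alpha> j))" for x using s\<alpha> sop by (cases x) auto
    then obtain K where "K \<ge> 0" "\<And>x p. norm p \<le> P \<Longrightarrow> norm ((case x of (b, i, j) \<Rightarrow> op b i (?\<alpha> j)) p) \<le> K"
      using smooth_family_bounded_on_cball[of "\<lambda>(b, i, j). op b i (?\<alpha> j)" P] by metis
    then show ?thesis by (intro that[of K]) fastforce+
  qed
  obtain K2 where K2: "K2 \<ge> 0" "\<And>b b' i j l p. norm p \<le> P \<Longrightarrow> \<bar>op b' i (op b j (?\<alpha> l)) p\<bar> \<le> K2"
  proof -
    have "smooth (case x of (b', b, i, j, l) \<Rightarrow> op b' i (op b j (?\<alpha> l)))" for x using s\<alpha> sop by (cases x) auto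
    then obtain K where "K \<ge> 0" "\<And>x p. norm p \<le> P \<Longrightarrow> norm ((case x of (b', b, i, j, l) \<Rightarrow> op b' i (op b j (?\<alpha> l))) p) \<le> K"
      using smooth_family_bounded_on_cball[of "\<lambda>(b', b, i, j, l). op b' i (op b j (?\<alpha> l))" P] by metis
    then show ?thesis by (intro that[of K]) fastforce+
  qed
  define K where "K = 1 + K0 + 2 * K1 + 4 * K2"
  have \<tau>: "\<bar>ln t / t\<bar> \<le> 1" if "t \<ge> 1" for t :: real
    using that ln_le_minus_one[of t] by (auto simp: abs_le_iff field_simps)
  have m: "\<bar>\<tau> * x\<bar> \<le> k" if "\<bar>\<tau>\<bar> \<le> 1" "\<bar>x\<bar> \<le> k" for \<tau> x k :: real
    using mult_mono[OF that] by (simp add: abs_mult)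
  have L1: "Lop \<phi> t i (\<lambda>z. \<tau> * c (snd z)) = (\<lambda>z. \<tau> * (op False i c (snd z) + ln t / t * op True i c (snd z)))"
    if "smooth c" for t \<tau> i c
    by (subst Lop_mult[OF smooth_const smooth_snd_compose[OF that]])
       (simp add: Lop_momentum op_def fun_eq_iff, simp add: Lop_def dird_const)
  have L2: "Lop \<phi> t i (\<lambda>z. \<tau> * (c (snd z) + \<tau>' * c' (snd z))) = (\<lambda>z. \<tau> * (op False i c (snd z) + ln t / t * op True i c (snd z)
       + \<tau>' * (op False i c' (snd z) + ln t / t * op True i c' (snd z))))"
    if "smooth c" "smooth c'" for t \<tau> \<tau>' i c c'
  proof -
    have "Lop \<phi> t i (\<lambda>z. \<tau> * c (snd z) + (\<tau> * \<tau>') * c' (snd z)) =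
      (\<lambda>z. \<tau> * (op False i c (snd z) + ln t / t * op True i c (snd z)) +
        (\<tau> * \<tau>') * (op False i c' (snd z) + ln t / t * op True i c' (snd z)))"
      by (simp only: Lop_add[OF smooth_mult[OF smooth_const smooth_snd_compose] smooth_mult[OF smooth_const smooth_snd_compose]]
          that L1[OF that(1)] L1[OF that(2)])
    then show ?thesis by (simp add: algebra_simps)
  qed
  show ?thesis
  proof (rule that[of K])
    show "K \<ge> 1" using K0 K1 K2 by (simp add: K_def)
    fix t :: real and i j l :: 3 and z :: "vec3 \<times> vec3" assume t: "t \<ge> 1" and z: "norm (snd z) \<le> P"
    let ?\<tau> = "ln t / t"
    show "\<bar>?\<tau> * ?\<alpha> i (snd z)\<bar> \<le> K"
      using m[OF \<tau>[OF t] K0(2)[OF z, of i]] K0 K1 K2 unfolding K_def by linarith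
    have "\<bar>op False i (?\<alpha> j) (snd z) + ?\<tau> * op True i (?\<alpha> j) (snd z)\<bar> \<le> 2 * K1"
      using K1(2)[OF z, of False i j] m[OF \<tau>[OF t] K1(2)[OF z, of True i j]] by linarith
    from m[OF \<tau>[OF t] this]
    show "\<bar>Lop \<phi> t i (\<lambda>z. ?\<tau> * ?\<alpha> j (snd z)) z\<bar> \<le> K"
      unfolding L1[OF s\<alpha>] using K0 K1 K2 unfolding K_def by linarith
    let ?o = "\<lambda>b b'. op b i (op b' j (?\<alpha> l)) (snd z)"
    have e: "\<bar>?o False b + ?\<tau> * ?o True b\<bar> \<le> 2 * K2" for b
      using K2(2)[OF z, of False i b j l] m[OF \<tau>[OF t] K2(2)[OF z, of True i b j l]] by linarith
    have "\<bar>?o False False + ?\<tau> * ?o True False + ?\<tau> * (?o False True + ?\<tau> * ?o True True)\<bar> \<le> 4 * K2"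
      using e[of False] m[OF \<tau>[OF t] e[of True]] by linarith
    from m[OF \<tau>[OF t] this]
    show "\<bar>Lop \<phi> t i (Lop \<phi> t j (\<lambda>z. ?\<tau> * ?\<alpha> l (snd z))) z\<bar> \<le> K"
      unfolding L1[OF s\<alpha>] L2[OF sop[OF s\<alpha>] sop[OF s\<alpha>]] using K0 K1 K2 unfolding K_def by linarith
  qed
qed

lemma Basis_vec3: "(Basis :: vec3 set) = {axis 1 1, axis 2 1, axis 3 1}"
  unfolding Basis_vec_def using exhaust_3 by (auto simp: Basis_real_def) metis

text \<open>The Sobolev inequality on \<open>\<real>\<^sup>3\<close> for \<open>G x = \<integral> u\<^sup>2 dp\<close> asks for \<open>\<partial>\<^sub>1\<partial>\<^sub>2\<partial>\<^sub>3 G\<close>. Trading each derivative for an \<open>L\<^sub>i\<close> gains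
\<open>t\<^sup>-\<^sup>3\<close> and leaves a quadratic form in the eight derivatives \<open>L\<^sup>I u\<close> with \<open>I \<le> (1, 1, 1)\<close>.\<close>
lemma velocity_average_bound:
  assumes \<phi>: "smooth \<phi>"
  obtains K where "K \<ge> 0"
    "\<And>t u E x. t \<ge> 1 \<Longrightarrow> smooth u \<Longrightarrow> bsupp u \<Longrightarrow> (\<And>z. u z \<noteq> 0 \<Longrightarrow> norm (snd z) \<le> P) \<Longrightarrow>
      (\<And>I. mabs I \<le> 3 \<Longrightarrow> (LBINT z. (mpow (Lop \<phi> t) I u z)\<^sup>2) \<le> E) \<Longrightarrow>
      (LBINT p. (u (x, p))\<^sup>2) \<le> K * E / t ^ 3"
proof -
  obtain K where K: "K \<ge> 1"
    "\<And>t i j (z :: vec3 \<times> vec3). t \<ge> 1 \<Longrightarrow> norm (snd z) \<le> P \<Longrightarrow> \<bar>ln t / t * hess_div \<phi> i (snd z)\<bar> \<le> K"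
    "\<And>t i j (z :: vec3 \<times> vec3). t \<ge> 1 \<Longrightarrow> norm (snd z) \<le> P \<Longrightarrow> \<bar>Lop \<phi> t i (\<lambda>z. ln t / t * hess_div \<phi> j (snd z)) z\<bar> \<le> K"
    "\<And>t i j l (z :: vec3 \<times> vec3). t \<ge> 1 \<Longrightarrow> norm (snd z) \<le> P \<Longrightarrow>
       \<bar>Lop \<phi> t i (Lop \<phi> t j (\<lambda>z. ln t / t * hess_div \<phi> l (snd z))) z\<bar> \<le> K"
    using Lop_momentum_bound[OF \<phi>, of P] by blast
  show ?thesis
  proof (rule that[of "40 * K ^ 3 * 8"])
    show "0 \<le> 40 * K ^ 3 * 8" using K by simp
    fix t :: real and u :: "vec3 \<times> vec3 \<Rightarrow> real" and E :: real and x :: vec3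
    assume t: "t \<ge> 1" and u: "smooth u" "bsupp u" and P: "\<And>z. u z \<noteq> 0 \<Longrightarrow> norm (snd z) \<le> P"
      and E: "\<And>I. mabs I \<le> 3 \<Longrightarrow> (LBINT z. (mpow (Lop \<phi> t) I u z)\<^sup>2) \<le> E"
    let ?L = "Lop \<phi> t" and ?T = "Top \<phi> t"
    let ?W = "?T 1 (?T 2 (?T 3 (\<lambda>z. u z * u z)))"
    let ?avg = "\<lambda>h x. LBINT p. h (x, p)"
    have sb: "smooth (?L i h)" "bsupp (?L i h)" "smooth (?T i h)" "bsupp (?T i h)" if "smooth h" "bsupp h" for i h
      using that \<phi> by (auto intro: smooth_Lop bsupp_Lop smooth_Top bsupp_Top)
    have s0: "smooth (\<lambda>z. u z * u z)" "bsupp (\<lambda>z. u z * u z)"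
      using u by (auto intro: smooth_mult bsupp_mult_left)
    have avg: "dird (axis i 1) (\<lambda>x. c * ?avg h x) x = c / t * ?avg (?T i h) x" if "smooth h" "bsupp h" for h i c x
    proof -
      have "dird (axis i 1) (\<lambda>x. c * ?avg h x) x = c * dird (axis i 1) (?avg h) x"
        using dird_mult[OF smooth_const smooth_integral_out(1)[OF that], of "axis i 1" c x] by (simp add: dird_const)
      then show ?thesis
        using t by (simp add: smooth_integral_out(2)[OF that] integral_dx_eq_integral_Top[OF \<phi> that, of t])
    qed
    have W: "smooth ?W" "bsupp ?W" using s0 sb by auto
    let ?h = "\<lambda>z. u z * u z"
    have "dird (axis 3 1) (?avg ?h) = (\<lambda>x. 1 / t * ?avg (?T 3 ?h) x)"
      using avg[OF s0, of 3 1] by (simp add: fun_eq_iff)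
    moreover have "dird (axis 2 1) (\<lambda>x. 1 / t * ?avg (?T 3 ?h) x) = (\<lambda>x. 1 / t / t * ?avg (?T 2 (?T 3 ?h)) x)"
      by (rule ext, rule avg) (intro sb s0)+
    moreover have "dird (axis 1 1) (\<lambda>x. 1 / t / t * ?avg (?T 2 (?T 3 ?h)) x) = (\<lambda>x. 1 / t / t / t * ?avg ?W x)"
      by (rule ext, rule avg) (intro sb s0)+
    ultimately have "foldr dird [axis 1 1, axis 2 1, axis 3 1] (?avg (\<lambda>z. u z * u z)) = (\<lambda>x. 1 / t ^ 3 * ?avg ?W x)"
      by (simp only: foldr.simps o_apply id_apply) (simp add: power3_eq_cube)
    moreover have "\<bar>?avg (\<lambda>z. u z * u z) x\<bar> \<le> (LBINT x. \<bar>foldr dird [axis 1 1, axis 2 1, axis 3 1] (?avg (\<lambda>z. u z * u z)) x\<bar>)"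
    proof (rule sobolev_sup_bound)
      show "smooth (?avg (\<lambda>z. u z * u z))" by (rule smooth_integral_out(1)[OF s0])
      show "bsupp (?avg (\<lambda>z. u z * u z))"
      proof -
        obtain r where r: "\<And>z. u z \<noteq> 0 \<Longrightarrow> norm z \<le> r" by (rule bsuppE[OF u(2)]) blast
        have "u (x, p) = 0" if "norm x > r" for x p
          using r[of "(x, p)"] norm_fst_le[of x p] that by force
        then show ?thesis unfolding bsupp_def by (intro exI[of _ r]) auto
      qed
      show "distinct [axis 1 1, axis 2 1, axis 3 (1::real) :: vec3]" by (simp add: axis_eq_axis)
      show "set [axis 1 1, axis 2 1, axis 3 1] = (Basis :: vec3 set)" by (simp add: Basis_vec3)
    qed
    ultimately have 1: "?avg (\<lambda>z. u z * u z) x \<le> (LBINT x. \<bar>?avg ?W x\<bar>) / t ^ 3"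
      using t by (simp add: abs_mult)
    let ?Q = "\<lambda>z. (u z)\<^sup>2 + (?L 1 u z)\<^sup>2 + (?L 2 u z)\<^sup>2 + (?L 3 u z)\<^sup>2 + (?L 1 (?L 2 u) z)\<^sup>2 + (?L 1 (?L 3 u) z)\<^sup>2
       + (?L 2 (?L 3 u) z)\<^sup>2 + (?L 1 (?L 2 (?L 3 u)) z)\<^sup>2"
    have WQ: "\<bar>?W z\<bar> \<le> 40 * K ^ 3 * ?Q z" for z
    proof (cases "norm (snd z) \<le> P")
      case True
      have q: "\<bar>y\<bar> \<le> sqrt (?Q z)" if "y\<^sup>2 \<le> ?Q z" for y
        using real_le_rsqrt[of "\<bar>y\<bar>" "?Q z"] that by simp
      have "\<bar>?W z\<bar> \<le> 40 * K ^ 3 * (sqrt (?Q z))\<^sup>2"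
        unfolding Top_cubed_square[OF \<phi> u(1)]
        by (rule Top_cubed_square_coeff_bound[OF K(1) K(2)[OF t True] K(2)[OF t True] K(2)[OF t True]
              K(3)[OF t True] K(3)[OF t True] K(3)[OF t True] K(4)[OF t True]]; rule q; simp add: add_nonneg_nonneg)
      then show ?thesis by (simp add: add_nonneg_nonneg)
    next
      case False
      let ?S = "{z :: vec3 \<times> vec3. norm (snd z) \<le> P}"
      have S: "closed ?S" by (intro closed_Collect_le continuous_intros)
      have "z \<notin> ?S" using False by simp
      have uS: "\<And>z. u z \<noteq> 0 \<Longrightarrow> z \<in> ?S" using P by simp
      have zS: "Top \<phi> t i h z = 0" if h: "\<And>z. z \<notin> ?S \<Longrightarrow> h z = 0" and z: "z \<notin> ?S" for h i z
      proof -
        have "Lop \<phi> t i h z = 0"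
          by (rule Lop_eq_0_outside[OF _ S z]) (use h in blast)
        then show ?thesis using h[OF z] by (simp add: Top_def)
      qed
      have u0: "u z * u z = 0" if "z \<notin> ?S" for z using P[of z] that by (cases "u z = 0") auto
      have "?W z = 0"
        by (rule zS[OF zS[OF zS[OF u0]] \<open>z \<notin> ?S\<close>])
      then show ?thesis using K by simp
    qed
    note i = integrable_square[OF u] integrable_square[OF sb(1,2)[OF u]] integrable_square[OF sb(1,2)[OF sb(1,2)[OF u]]] integrable_square[OF sb(1,2)[OF sb(1,2)[OF sb(1,2)[OF u]]]]
    have mp: "mpow ?L (vector [a, b, c]) u = (?L 1 ^^ a) ((?L 2 ^^ b) ((?L 3 ^^ c) u))" for a b c
      by (simp add: mpow_def)
    have E': "(LBINT z. ((?L 1 ^^ a) ((?L 2 ^^ b) ((?L 3 ^^ c) u)) z)\<^sup>2) \<le> E" if "a + b + c \<le> 3" for a b c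
      using E[of "vector [a, b, c]"] that unfolding mp by (simp add: mabs_def sum_3)
    have "(LBINT z. ?Q z) \<le> 8 * E"
      using E'[of 0 0 0] E'[of 1 0 0] E'[of 0 1 0] E'[of 0 0 1] E'[of 1 1 0] E'[of 1 0 1] E'[of 0 1 1] E'[of 1 1 1] i
      by simp
    have "(LBINT x. \<bar>?avg ?W x\<bar>) \<le> (LBINT x. ?avg (\<lambda>z. 40 * K ^ 3 * ?Q z) x)"
    proof (rule integral_mono)
      have sQ: "smooth (\<lambda>z. 40 * K ^ 3 * ?Q z)" "bsupp (\<lambda>z. 40 * K ^ 3 * ?Q z)"
        unfolding power2_eq_square using u sb
        by (intro smooth_intros bsupp_add bsupp_mult_right; simp)+
      show "integrable lborel (\<lambda>x. \<bar>?avg ?W x\<bar>)"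
        by (intro integrable_abs integral_slice(2) W smooth_continuous)
      show "integrable lborel (?avg (\<lambda>z. 40 * K ^ 3 * ?Q z))"
        by (intro integral_slice(2) sQ smooth_continuous)
      fix x
      have "\<bar>?avg ?W x\<bar> \<le> ?avg (\<lambda>z. \<bar>?W z\<bar>) x" by (rule integral_abs_bound)
      also have "\<dots> \<le> ?avg (\<lambda>z. 40 * K ^ 3 * ?Q z) x"
        by (intro integral_mono integrable_abs integrable_slice W sQ WQ)
      finally show "\<bar>?avg ?W x\<bar> \<le> ?avg (\<lambda>z. 40 * K ^ 3 * ?Q z) x" .
    qed
    also have "\<dots> = (LBINT z. 40 * K ^ 3 * ?Q z)"
    proof (rule integral_slice(1))
      show "continuous_on UNIV (\<lambda>z. 40 * K ^ 3 * ?Q z)" "bsupp (\<lambda>z. 40 * K ^ 3 * ?Q z)"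
        unfolding power2_eq_square using u sb
        by (intro smooth_continuous smooth_intros bsupp_add bsupp_mult_right; simp)+
    qed
    also have "\<dots> = 40 * K ^ 3 * (LBINT z. ?Q z)" by simp
    also have "\<dots> \<le> 40 * K ^ 3 * (8 * E)"
      using \<open>(LBINT z. ?Q z) \<le> 8 * E\<close> K by (intro mult_left_mono) auto
    finally have "(LBINT x. \<bar>?avg ?W x\<bar>) / t ^ 3 \<le> 40 * K ^ 3 * 8 * E / t ^ 3"
      using t by (intro divide_right_mono) auto
    then show "(LBINT p. (u (x, p))\<^sup>2) \<le> 40 * K ^ 3 * 8 * E / t ^ 3"
      using 1 by (simp add: power2_eq_square)
  qed
qed

section \<open>The energy inequality for the difference of two solutions\<close>

subsection \<open>Smooth functions on a time slab\<close>

lemma has_derivative_time_slice: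
  assumes "(F has_derivative D) (at (t, z) within {T0..} \<times> UNIV)" "t \<ge> T0"
  shows "((\<lambda>z. F (t, z)) has_derivative (\<lambda>v. D (0, v))) (at z)"
proof (rule has_derivative_in_compose[of "\<lambda>z. (t, z)" "\<lambda>v. (0, v)" z UNIV F D])
  show "((\<lambda>z. (t, z)) has_derivative (\<lambda>v. (0, v))) (at z)" by (auto intro!: derivative_eq_intros)
  show "(F has_derivative D) (at (t, z) within range (\<lambda>z. (t, z)))"
    by (rule has_derivative_subset[OF assms(1)]) (use assms(2) in auto)
qed

lemma Ck_time_slice:
  fixes F :: "real \<times> 'a::euclidean_space \<Rightarrow> 'b::real_normed_vector"
  assumes "t \<ge> T0"
  shows "Ck_on k ({T0..} \<times> UNIV) F \<Longrightarrow> Ck_on k UNIV (\<lambda>z. F (t, z))"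
proof (induction k arbitrary: F)
  case 0
  then show ?case
    using assms by (auto intro!: continuous_on_compose2[of "{T0..} \<times> UNIV" F] continuous_intros)
next
  case (Suc k)
  then obtain D where D: "\<And>z. z \<in> {T0..} \<times> UNIV \<Longrightarrow> (F has_derivative D z) (at z within {T0..} \<times> UNIV)"
    "\<And>v. Ck_on k ({T0..} \<times> UNIV) (\<lambda>z. D z v)" by auto
  show ?case
    unfolding Ck_on.simps
  proof (intro exI conjI ballI allI)
    show "((\<lambda>z. F (t, z)) has_derivative (\<lambda>v. D (t, z) (0, v))) (at z)" for z
      by (rule has_derivative_time_slice) (use D assms in auto)
    show "Ck_on k UNIV (\<lambda>z. D (t, z) (0, v))" for v
      using Suc.IH[OF D(2)[of "(0, v)"]] by simp
  qed
qed

lemma smooth_time_slice: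
  fixes F :: "real \<times> 'a::euclidean_space \<Rightarrow> 'b::real_normed_vector"
  shows "smooth_on ({T0..} \<times> UNIV) F \<Longrightarrow> t \<ge> T0 \<Longrightarrow> smooth (\<lambda>z. F (t, z))"
  unfolding smooth_on_def using Ck_time_slice by blast

text \<open>The derivative within the slab is one-sided at the initial time. Evaluated in a pure space or a pure time
direction it coincides with the operators that occur in the equation, which are therefore jointly continuous.\<close>
lemma smooth_slab_continuity:
  fixes F :: "real \<times> 'a::euclidean_space \<Rightarrow> 'b::real_normed_vector"
  assumes F: "smooth_on ({T0..} \<times> UNIV) F"
  shows "continuous_on ({T0..} \<times> UNIV) F"
    and "continuous_on ({T0..} \<times> UNIV) (\<lambda>(t, z). dird v (\<lambda>z. F (t, z)) z)"
    and "continuous_on ({T0..} \<times> UNIV) (\<lambda>(t, z). vector_derivative (\<lambda>s. F (s, z)) (at t within {T0..}))"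
    and "t \<ge> T0 \<Longrightarrow> ((\<lambda>s. F (s, z)) has_vector_derivative vector_derivative (\<lambda>s. F (s, z)) (at t within {T0..}))
      (at t within {T0..})"
proof -
  have "Ck_on 1 ({T0..} \<times> UNIV) F" using F unfolding smooth_on_def by blast
  then obtain D where D: "\<And>z. z \<in> {T0..} \<times> UNIV \<Longrightarrow> (F has_derivative D z) (at z within {T0..} \<times> UNIV)"
    "\<And>v. continuous_on ({T0..} \<times> UNIV) (\<lambda>z. D z v)" by (auto simp: One_nat_def simp del: One_nat_def[symmetric])
  show "continuous_on ({T0..} \<times> UNIV) F"
    using D(1) by (auto simp: continuous_on_eq_continuous_within intro: has_derivative_continuous)
  have "dird v (\<lambda>z. F (t, z)) z = D (t, z) (0, v)" if "t \<ge> T0" for t z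
    by (rule dird_eqI, rule has_derivative_time_slice) (use D(1) that in auto)
  then show "continuous_on ({T0..} \<times> UNIV) (\<lambda>(t, z). dird v (\<lambda>z. F (t, z)) z)"
    using D(2)[of "(0, v)"] by (subst continuous_on_cong[OF refl, of _ _ "\<lambda>z. D z (0, v)"]) auto
  have vd: "((\<lambda>s. F (s, z)) has_vector_derivative D (t, z) (1, 0)) (at t within {T0..})" if "t \<ge> T0" for t z
  proof -
    have D': "(F has_derivative D (t, z)) (at (t, z) within {T0..} \<times> UNIV)" using D(1) that by auto
    have "((\<lambda>s. F (s, z)) has_derivative (\<lambda>h. D (t, z) (h, 0))) (at t within {T0..})"
    proof (rule has_derivative_in_compose[of "\<lambda>s. (s, z)" "\<lambda>h. (h, 0)" t "{T0..}" F "D (t, z)"])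
      show "((\<lambda>s. (s, z)) has_derivative (\<lambda>h. (h, 0))) (at t within {T0..})" by (auto intro!: derivative_eq_intros)
      show "(F has_derivative D (t, z)) (at (t, z) within (\<lambda>s. (s, z)) ` {T0..})"
        by (rule has_derivative_subset[OF D']) auto
    qed
    then show ?thesis
      unfolding has_vector_derivative_def
    proof (rule has_derivative_eq_rhs, intro ext)
      show "D (t, z) (h, 0) = h *\<^sub>R D (t, z) (1, 0)" for h
        using linear_cmul[OF bounded_linear.linear[OF has_derivative_bounded_linear[OF D']], of h "(1, 0)"] by simp
    qed
  qed
  have bot: "at t within {T0..} \<noteq> bot" if "t \<ge> T0" for t
  proof -
    have "t islimpt {t..t + 1}" by (simp add: islimpt_Icc)
    then have "t islimpt {T0..}" by (rule islimpt_subset) (use that in auto)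
    then show ?thesis by (simp add: trivial_limit_within)
  qed
  have eq: "vector_derivative (\<lambda>s. F (s, z)) (at t within {T0..}) = D (t, z) (1, 0)" if "t \<ge> T0" for t z
    by (rule vector_derivative_within[OF bot[OF that] vd[OF that]])
  show "t \<ge> T0 \<Longrightarrow> ((\<lambda>s. F (s, z)) has_vector_derivative vector_derivative (\<lambda>s. F (s, z)) (at t within {T0..}))
      (at t within {T0..})"
    using vd eq by simp
  show "continuous_on ({T0..} \<times> UNIV) (\<lambda>(t, z). vector_derivative (\<lambda>s. F (s, z)) (at t within {T0..}))"
    using D(2)[of "(1, 0)"] eq by (subst continuous_on_cong[OF refl, of _ _ "\<lambda>z. D z (1, 0)"]) auto
qed

lemma VP_solutionD:
  assumes "VP_solution T0 f \<rho> \<phi>"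
  shows "smooth_on ({T0..} \<times> UNIV) (\<lambda>(t, x, p). f t x p)"
    and "t \<ge> T0 \<Longrightarrow> smooth (case_prod (f t))"
    and "t \<ge> T0 \<Longrightarrow> smooth (\<phi> t)"
    and "t \<ge> T0 \<Longrightarrow> laplacian (\<phi> t) x = \<rho> t x"
    and "t \<ge> T0 \<Longrightarrow> integrable lborel (\<lambda>p. f t x p)"
    and "t \<ge> T0 \<Longrightarrow> \<rho> t x = (LBINT p. f t x p)"
    and "t \<ge> T0 \<Longrightarrow> (\<phi> t \<longlongrightarrow> 0) at_infinity"
    and "t \<ge> T0 \<Longrightarrow> vector_derivative (\<lambda>s. case_prod (f s) z) (at t within {T0..})
       = - ((\<Sum>i\<in>UNIV. snd z $ i * dird (axis i 1, 0) (case_prod (f t)) z)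
          + (\<Sum>i\<in>UNIV. partial i (\<phi> t) (fst z) * dird (0, axis i 1) (case_prod (f t)) z))"
proof -
  note v = assms[unfolded VP_solution_def]
  show s: "smooth_on ({T0..} \<times> UNIV) (\<lambda>(t, x, p). f t x p)" using v by blast
  show "smooth (case_prod (f t))" if "t \<ge> T0"
    using smooth_time_slice[OF s that] by simp
  have s\<phi>: "smooth_on ({T0..} \<times> UNIV) (\<lambda>(t, x). \<phi> t x)" using v by blast
  show "smooth (\<phi> t)" if "t \<ge> T0"
    using smooth_time_slice[OF s\<phi> that] by simp
  show "t \<ge> T0 \<Longrightarrow> laplacian (\<phi> t) x = \<rho> t x" using v by blast
  show "t \<ge> T0 \<Longrightarrow> integrable lborel (\<lambda>p. f t x p)" "t \<ge> T0 \<Longrightarrow> \<rho> t x = (LBINT p. f t x p)"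
    using v by (auto simp: has_bochner_integral_iff)
  show "t \<ge> T0 \<Longrightarrow> (\<phi> t \<longlongrightarrow> 0) at_infinity" using v by blast
  assume t: "t \<ge> T0"
  obtain x p where z: "z = (x, p)" by (cases z)
  have "vector_derivative (\<lambda>s. f s x p) (at t within {T0..})
                 + (\<Sum>i\<in>UNIV. p $ i * dx i (f t) x p)
                 + (\<Sum>i\<in>UNIV. partial i (\<phi> t) x * dp i (f t) x p) = 0"
    using v t by blast
  then show "vector_derivative (\<lambda>s. case_prod (f s) z) (at t within {T0..})
       = - ((\<Sum>i\<in>UNIV. snd z $ i * dird (axis i 1, 0) (case_prod (f t)) z)
          + (\<Sum>i\<in>UNIV. partial i (\<phi> t) (fst z) * dird (0, axis i 1) (case_prod (f t)) z))"
    by (simp add: z dx_eq_dird[symmetric] dp_eq_dird[symmetric] eq_neg_iff_add_eq_0 add.assoc)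
qed

subsection \<open>The force term\<close>

text \<open>Cauchy--Schwarz on a ball, from \<open>\<integral> (g - c)\<^sup>2 \<ge> 0\<close> with \<open>c\<close> the mean of \<open>g\<close> over the ball.\<close>
lemma integral_square_le:
  fixes g :: "'a::euclidean_space \<Rightarrow> real"
  assumes g: "continuous_on UNIV g" "\<And>p. g p \<noteq> 0 \<Longrightarrow> p \<in> cball q r" and r: "r > 0"
  shows "(LBINT p. g p)\<^sup>2 \<le> measure lborel (cball (0::'a) r) * (LBINT p. (g p)\<^sup>2)"
proof -
  let ?V = "measure lborel (cball (0::'a) r)"
  have Vq: "measure lborel (cball q r) = ?V" using r by (simp add: content_cball)
  have V: "?V > 0" using r by simp
  have "norm p \<le> norm q + r" if "g p \<noteq> 0" for p
    using g(2)[OF that] norm_triangle_ineq2[of p q] by (simp add: dist_norm norm_minus_commute)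
  then have b: "bsupp g" by (rule bsuppI)
  have i1: "integrable lborel g" by (rule integrable_bsupp[OF g(1) b])
  have i2: "integrable lborel (\<lambda>p. (g p)\<^sup>2)"
    by (intro integrable_bsupp continuous_intros g(1) bsupp_mono[OF b]) auto
  note i3 = integrable_indicator_cball[of q r]
  define c where "c = (LBINT p. g p) / ?V"
  have "0 \<le> (LBINT p. (g p)\<^sup>2 - 2 * c * g p + c\<^sup>2 * indicator (cball q r) p)"
  proof (rule Bochner_Integration.integral_nonneg)
    fix p
    show "0 \<le> (g p)\<^sup>2 - 2 * c * g p + c\<^sup>2 * indicator (cball q r) p"
    proof (cases "g p = 0")
      case False
      then have "(g p)\<^sup>2 - 2 * c * g p + c\<^sup>2 * indicator (cball q r) p = (g p - c)\<^sup>2"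
        using g(2)[OF False] by (simp add: power2_diff algebra_simps)
      then show ?thesis by simp
    qed simp
  qed
  also have "\<dots> = (LBINT p. (g p)\<^sup>2) - 2 * c * (LBINT p. g p) + c\<^sup>2 * ?V"
    using i1 i2 i3 by (simp add: Vq)
  also have "\<dots> = (LBINT p. (g p)\<^sup>2) - (LBINT p. g p)\<^sup>2 / ?V"
    using V by (simp add: c_def field_simps power2_eq_square)
  finally show ?thesis using V by (simp add: field_simps)
qed

text \<open>Pointwise \<open>2 \<bar>\<nabla>\<psi> \<cdot> F g\<bar> \<le> \<mu> \<bar>\<nabla>\<psi>\<bar>\<^sup>2 \<bar>F\<bar>\<^sup>2 + g\<^sup>2 / \<mu>\<close>. In the first term \<open>\<nabla>\<psi>\<close> does not depend on \<open>p\<close>, so \<open>F\<close> enters only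
through \<open>sup\<^sub>x \<integral> \<bar>F\<bar>\<^sup>2 dp\<close>, and \<open>\<nabla>\<psi>\<close> is needed on the ball of radius \<open>R\<close> only. The parameter \<open>\<mu>\<close> is chosen
as \<open>t\<close> for large times, to make both terms of order \<open>1/t\<close>, and as \<open>1\<close> on compact time intervals.\<close>
lemma force_term_bound:
  fixes g :: "vec3 \<times> vec3 \<Rightarrow> real" and F :: "3 \<Rightarrow> vec3 \<times> vec3 \<Rightarrow> real" and \<psi> :: "vec3 \<Rightarrow> real"
  assumes g: "smooth g" "bsupp g" and F: "\<And>i. smooth (F i)" "\<And>i. bsupp (F i)"
    and \<psi>: "smooth \<psi>" "(\<psi> \<longlongrightarrow> 0) at_infinity" "\<And>x. laplacian \<psi> x = (LBINT p. g (x, p))"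
    and R: "R > 0" "\<And>x p. g (x, p) \<noteq> 0 \<Longrightarrow> norm x \<le> R" "\<And>i x p. F i (x, p) \<noteq> 0 \<Longrightarrow> norm x \<le> R"
    and r: "r > 0" "\<And>x. \<exists>q. \<forall>p. g (x, p) \<noteq> 0 \<longrightarrow> p \<in> cball q r"
    and S: "\<And>x. (\<Sum>i\<in>UNIV. LBINT p. (F i (x, p))\<^sup>2) \<le> S"
    and mu: "\<mu> > 0"
  shows "\<bar>LBINT z. 2 * (\<Sum>i\<in>UNIV. partial i \<psi> (fst z) * F i z) * g z\<bar>
    \<le> (16 * S * R\<^sup>2 * measure lborel (cball (0::vec3) r) * \<mu> + 1 / \<mu>) * (LBINT z. (g z)\<^sup>2)"
proof -
  let ?V = "measure lborel (cball (0::vec3) r)" and ?y = "LBINT z. (g z)\<^sup>2"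
  let ?A = "\<lambda>x. (norm (grad \<psi> x))\<^sup>2" and ?FF = "\<lambda>z. \<Sum>i\<in>UNIV. (F i z)\<^sup>2"
  have A: "?A x = (\<Sum>i\<in>UNIV. (partial i \<psi> x)\<^sup>2)" for x
    using sum_power2_partial_eq_norm_grad[of \<psi> x] by (simp add: partial_eq_dird)
  have FF: "smooth ?FF" "bsupp ?FF"
    using F unfolding power2_eq_square by (auto intro!: smooth_intros bsupp_sum bsupp_mult_left)
  have sA: "smooth ?A"
    unfolding A by (intro smooth_intros smooth_partial \<psi>)
  have AFF: "smooth (\<lambda>z. ?A (fst z) * ?FF z)" "bsupp (\<lambda>z. ?A (fst z) * ?FF z)"
    by (intro smooth_mult smooth_compose[OF sA smooth_fst[OF smooth_id]] FF bsupp_mult_right)+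
  have g2: "smooth (\<lambda>z. (g z)\<^sup>2)" "bsupp (\<lambda>z. (g z)\<^sup>2)"
    using g unfolding power2_eq_square by (auto intro: smooth_mult bsupp_mult_left)
  have FFx: "(LBINT p. ?FF (x, p)) \<le> S" for x
  proof -
    have "integrable lborel (\<lambda>p. (F i (x, p))\<^sup>2)" for i
      by (intro integrable_square smooth_slice bsupp_slice F)
    then show ?thesis using S[of x] by (simp add: Bochner_Integration.integral_sum)
  qed
  have S0: "S \<ge> 0"
    using FFx[of 0] Bochner_Integration.integral_nonneg[of lborel "\<lambda>p. ?FF (0, p)"] by (meson order_trans sum_nonneg zero_le_power2)
  have "\<bar>LBINT z. 2 * (\<Sum>i\<in>UNIV. partial i \<psi> (fst z) * F i z) * g z\<bar>
      \<le> (LBINT z. \<bar>2 * (\<Sum>i\<in>UNIV. partial i \<psi> (fst z) * F i z) * g z\<bar>)"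
    by (rule integral_abs_bound)
  also have "\<dots> \<le> (LBINT z. \<mu> * (?A (fst z) * ?FF z) + (g z)\<^sup>2 / \<mu>)"
  proof (rule integral_mono)
    show "integrable lborel (\<lambda>z. \<bar>2 * (\<Sum>i\<in>UNIV. partial i \<psi> (fst z) * F i z) * g z\<bar>)"
      by (intro integrable_abs integrable_smooth smooth_intros smooth_compose[OF smooth_partial[OF \<psi>(1)]] F g bsupp_mult_right)
    show "integrable lborel (\<lambda>z. \<mu> * (?A (fst z) * ?FF z) + (g z)\<^sup>2 / \<mu>)"
      using integrable_smooth[OF AFF] integrable_smooth[OF g2] by simp
    fix z
    let ?a = "\<Sum>i\<in>UNIV. partial i \<psi> (fst z) * F i z"
    have "?a\<^sup>2 \<le> ?A (fst z) * ?FF z" unfolding A by (rule Cauchy_Schwarz_ineq_sum)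
    then have "\<mu> * ?a\<^sup>2 \<le> \<mu> * (?A (fst z) * ?FF z)" using mu by simp
    moreover have "\<bar>2 * ?a * g z\<bar> \<le> \<mu> * ?a\<^sup>2 + (g z)\<^sup>2 / \<mu>"
    proof -
      have "0 \<le> (\<mu> * \<bar>?a\<bar> - \<bar>g z\<bar>)\<^sup>2 / \<mu>" using mu by simp
      also have "\<dots> = \<mu> * ?a\<^sup>2 + (g z)\<^sup>2 / \<mu> - \<bar>2 * ?a * g z\<bar>"
        using mu by (simp add: power2_diff power_mult_distrib abs_mult field_simps) (simp add: power2_eq_square)
      finally show ?thesis by simp
    qed
    ultimately show "\<bar>2 * ?a * g z\<bar> \<le> \<mu> * (?A (fst z) * ?FF z) + (g z)\<^sup>2 / \<mu>" by linarith
  qed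
  also have "\<dots> = \<mu> * (LBINT z. ?A (fst z) * ?FF z) + ?y / \<mu>"
    using integrable_smooth[OF AFF] integrable_smooth[OF g2] by simp
  also have "(LBINT z. ?A (fst z) * ?FF z) \<le> S * (LBINT x. indicator (cball 0 R) x * ?A x)"
  proof -
    have "(LBINT z. ?A (fst z) * ?FF z) = (LBINT x. (LBINT p. ?A x * ?FF (x, p)))"
      using integral_slice(1)[OF smooth_continuous[OF AFF(1)] AFF(2)] by simp
    also have "\<dots> \<le> (LBINT x. S * (indicator (cball 0 R) x * ?A x))"
    proof (rule integral_mono)
      show "integrable lborel (\<lambda>x. LBINT p. ?A x * ?FF (x, p))"
        using integral_slice(2)[OF smooth_continuous[OF AFF(1)] AFF(2)] by simp
      have "integrable lborel (\<lambda>x. indicator (cball 0 R) x *\<^sub>R ?A x)"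
        by (intro borel_integrable_compact smooth_continuous sA) simp
      then show "integrable lborel (\<lambda>x. S * (indicator (cball 0 R) x * ?A x))" by simp
      fix x
      show "(LBINT p. ?A x * ?FF (x, p)) \<le> S * (indicator (cball 0 R) x * ?A x)"
      proof (cases "norm x \<le> R")
        case True
        have "?A x * (LBINT p. ?FF (x, p)) \<le> ?A x * S"
          by (intro mult_left_mono FFx) auto
        then show ?thesis using True by (simp add: mult.commute)
      next
        case False
        then have "F i (x, p) = 0" for i p using R(3) by blast
        then show ?thesis using False by simp
      qed
    qed
    finally show ?thesis by simp
  qed
  also have "(LBINT x. indicator (cball 0 R) x * ?A x) \<le> 16 * R\<^sup>2 * (?V * ?y)"
  proof -
    have supp: "norm x \<le> R" if "laplacian \<psi> x \<noteq> 0" for x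
    proof (rule ccontr)
      assume "\<not> norm x \<le> R"
      then have "g (x, p) = 0" for p using R(2) by blast
      then show False using that \<psi>(3) by simp
    qed
    have s\<sigma>: "smooth (laplacian \<psi>)" unfolding laplacian_eq[abs_def] by (intro smooth_intros smooth_dird \<psi>)
    have b\<sigma>: "bsupp (laplacian \<psi>)" using supp by (rule bsuppI)
    have "(LBINT x. (laplacian \<psi> x)\<^sup>2) \<le> (LBINT x. ?V * (LBINT p. (g (x, p))\<^sup>2))"
    proof (rule integral_mono)
      show "integrable lborel (\<lambda>x. (laplacian \<psi> x)\<^sup>2)"
        by (intro integrable_smooth smooth_power2 s\<sigma> bsupp_mono[OF b\<sigma>]) auto
      show "integrable lborel (\<lambda>x. ?V * (LBINT p. (g (x, p))\<^sup>2))"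
        using integral_slice(2)[OF smooth_continuous[OF g2(1)] g2(2)] by simp
      fix x
      obtain q where "\<forall>p. g (x, p) \<noteq> 0 \<longrightarrow> p \<in> cball q r" using r(2) by blast
      then show "(laplacian \<psi> x)\<^sup>2 \<le> ?V * (LBINT p. (g (x, p))\<^sup>2)"
        unfolding \<psi>(3) using r(1) by (intro integral_square_le[of _ q] smooth_continuous smooth_slice g) auto
    qed
    also have "\<dots> = ?V * ?y"
      using integral_slice(1)[OF smooth_continuous[OF g2(1)] g2(2)] by simp
    finally have "16 * R\<^sup>2 * (LBINT x. (laplacian \<psi> x)\<^sup>2) \<le> 16 * R\<^sup>2 * (?V * ?y)"
      by (intro mult_left_mono) auto
    then show ?thesis using poisson_energy_estimate[OF \<psi>(1,2) supp R(1)] by linarith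
  qed
  finally have "\<bar>LBINT z. 2 * (\<Sum>i\<in>UNIV. partial i \<psi> (fst z) * F i z) * g z\<bar>
    \<le> \<mu> * (S * (16 * R\<^sup>2 * (?V * ?y))) + ?y / \<mu>"
    using mu S0 by (simp add: mult_left_mono)
  then show ?thesis by (simp add: algebra_simps)
qed

subsection \<open>The energy identity\<close>

text \<open>Differentiation under the integral sign over a box containing all supports. The equation gives
\<open>\<partial>\<^sub>t g = - p \<cdot> \<partial>\<^sub>x g - \<nabla>\<phi>' \<cdot> \<partial>\<^sub>p g - \<nabla>\<psi> \<cdot> \<partial>\<^sub>p f\<close>; multiplied by \<open>2 g\<close>, the first two terms are divergences of multiples
of \<open>g\<^sup>2\<close>.\<close>
lemma energy_identity:
  assumes vp: "VP_solution T0 f \<rho> \<phi>" "VP_solution T0 f' \<rho>' \<phi>'"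
    and supp: "\<And>t x p. t \<in> {T0..T1} \<Longrightarrow> f' t x p - f t x p \<noteq> 0 \<Longrightarrow> norm (x, p) \<le> b"
    and t: "t \<in> {T0..T1}"
  defines "g \<equiv> \<lambda>t z. case_prod (f' t) z - case_prod (f t) z"
  shows "((\<lambda>t. LBINT z. (g t z)\<^sup>2) has_real_derivative
      - (LBINT z. 2 * (\<Sum>i\<in>UNIV. partial i (\<lambda>x. \<phi>' t x - \<phi> t x) (fst z) * dird (0, axis i 1) (case_prod (f t)) z) * g t z))
    (at t within {T0..T1})"
proof -
  let ?U = "{T0..T1}"
  obtain b1 b2 :: "vec3 \<times> vec3" where box: "cball 0 b \<subseteq> cbox b1 b2"
    using bounded_cball bounded_subset_cbox_symmetric by metis
  have out: "g t z \<noteq> 0 \<Longrightarrow> norm z \<le> b" if "t \<in> ?U" for t z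
    using supp[OF that] by (cases z) (simp add: g_def)
  have gb: "bsupp (g t)" if "t \<in> ?U" for t using out[OF that] by (rule bsuppI)
  have sg: "smooth (g t)" if "t \<in> ?U" for t
    unfolding g_def using that by (intro smooth_diff VP_solutionD(2)[OF vp(1)] VP_solutionD(2)[OF vp(2)]) auto
  let ?d = "\<lambda>f t z. vector_derivative (\<lambda>s. case_prod (f s) z) (at t within {T0..})"
  define gt where "gt t z = ?d f' t z - ?d f t z" for t z
  have dt: "((\<lambda>s. g s z) has_vector_derivative gt t z) (at t within ?U)" if "t \<in> ?U" for t z
  proof -
    have "((\<lambda>s. case_prod (f' s) z - case_prod (f s) z) has_vector_derivative gt t z) (at t within {T0..})"
      unfolding gt_def
      using smooth_slab_continuity(4)[OF VP_solutionD(1)[OF vp(1)], of t z]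
        smooth_slab_continuity(4)[OF VP_solutionD(1)[OF vp(2)], of t z] that
      by (intro has_vector_derivative_diff) (auto simp: case_prod_beta)
    then show ?thesis unfolding g_def by (rule has_vector_derivative_within_subset) auto
  qed
  have cg: "continuous_on (?U \<times> X) (\<lambda>(t, z). g t z)" for X
  proof -
    have "continuous_on ({T0..} \<times> UNIV) (\<lambda>(t, z). g t z)"
      unfolding g_def
      using smooth_slab_continuity(1)[OF VP_solutionD(1)[OF vp(1)]] smooth_slab_continuity(1)[OF VP_solutionD(1)[OF vp(2)]]
      by (auto simp: case_prod_beta intro: continuous_on_diff)
    then show ?thesis by (rule continuous_on_subset) auto
  qed
  have cgt: "continuous_on (?U \<times> X) (\<lambda>(t, z). gt t z)" for X
  proof -
    have "continuous_on ({T0..} \<times> UNIV) (\<lambda>(t, z). gt t z)"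
      unfolding gt_def
      using smooth_slab_continuity(3)[OF VP_solutionD(1)[OF vp(1)]] smooth_slab_continuity(3)[OF VP_solutionD(1)[OF vp(2)]]
      by (auto simp: case_prod_beta intro: continuous_on_diff)
    then show ?thesis by (rule continuous_on_subset) auto
  qed
  let ?f = "case_prod (f t)" and ?f' = "case_prod (f' t)"
  have t0: "t \<ge> T0" using t by simp
  note sf = VP_solutionD(2)[OF vp(1) t0] and sf' = VP_solutionD(2)[OF vp(2) t0]
  note s\<phi> = VP_solutionD(3)[OF vp(1) t0] and s\<phi>' = VP_solutionD(3)[OF vp(2) t0]
  let ?D = "\<lambda>i::3. dird (axis i (1::real), 0::vec3)" and ?E = "\<lambda>i::3. dird (0::vec3, axis i (1::real))"
  let ?force = "\<lambda>z. 2 * (\<Sum>i\<in>UNIV. partial i (\<lambda>x. \<phi>' t x - \<phi> t x) (fst z) * ?E i ?f z) * g t z"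
  have g2: "smooth (\<lambda>z. (g t z)\<^sup>2)" "bsupp (\<lambda>z. (g t z)\<^sup>2)"
    using sg[OF t] gb[OF t] unfolding power2_eq_square by (auto intro: smooth_mult bsupp_mult_left)
  have dg2: "dird v (\<lambda>z. (g t z)\<^sup>2) z = 2 * g t z * dird v (g t) z" for v z
    unfolding power2_eq_square by (subst dird_mult[OF sg[OF t] sg[OF t]]) simp
  have sp: "smooth (\<lambda>z::vec3 \<times> vec3. snd z $ i)" for i
    using smooth_inner[OF smooth_snd[OF smooth_id] smooth_const, of "axis i 1 :: vec3"] by (simp add: inner_axis)
  have sf\<phi>: "smooth (\<lambda>z::vec3 \<times> vec3. partial i (\<phi>' t) (fst z))" for i
    by (rule smooth_compose[OF smooth_partial[OF s\<phi>']]) (intro smooth_intros)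
  define X where "X i z = ?D i (\<lambda>z. snd z $ i * (g t z)\<^sup>2) z" for i z
  define P where "P i z = ?E i (\<lambda>z. partial i (\<phi>' t) (fst z) * (g t z)\<^sup>2) z" for i z
  have X: "X i z = snd z $ i * (2 * g t z * ?D i (g t) z)" for i z
    unfolding X_def by (subst dird_mult[OF sp g2(1)]) (simp add: dg2, simp add: dird_def)
  have P: "P i z = partial i (\<phi>' t) (fst z) * (2 * g t z * ?E i (g t) z)" for i z
    unfolding P_def by (subst dird_mult[OF sf\<phi> g2(1)]) (simp add: dg2, simp add: dird_def)
  have XP0: "(LBINT z. X i z) = 0" "(LBINT z. P i z) = 0"
    and XP_int: "integrable lborel (X i)" "integrable lborel (P i)" for i
    unfolding X_def[abs_def] P_def[abs_def]
    by (intro integral_dird_eq_0 integrable_smooth smooth_dird bsupp_dird smooth_mult sp sf\<phi> g2 bsupp_mult_right)+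
  have gt: "2 * g t z * gt t z = - (\<Sum>i\<in>UNIV. X i z) - (\<Sum>i\<in>UNIV. P i z) - ?force z" for z
  proof -
    have dg: "dird v (g t) z = dird v ?f' z - dird v ?f z" for v
      unfolding g_def by (rule dird_diff[OF sf' sf])
    have d\<phi>: "partial i (\<lambda>x. \<phi>' t x - \<phi> t x) x = partial i (\<phi>' t) x - partial i (\<phi> t) x" for i x
      unfolding partial_eq_dird by (rule dird_diff[OF s\<phi>' s\<phi>])
    show ?thesis
      unfolding gt_def VP_solutionD(8)[OF vp(1) t0] VP_solutionD(8)[OF vp(2) t0] X P dg d\<phi> sum_3
      by (simp add: algebra_simps)
  qed
  have force_int: "integrable lborel ?force"
  proof (rule integrable_smooth)
    have "smooth (\<lambda>z::vec3 \<times> vec3. partial i (\<lambda>x. \<phi>' t x - \<phi> t x) (fst z))" for i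
      by (rule smooth_compose[OF smooth_partial[OF smooth_diff[OF s\<phi>' s\<phi>]]]) (intro smooth_intros)
    then show "smooth ?force" by (intro smooth_intros smooth_dird sf sg[OF t])
    show "bsupp ?force" by (intro bsupp_mult_right gb[OF t])
  qed
  have cgs: "continuous_on UNIV (g s)" if "s \<in> ?U" for s by (rule smooth_continuous[OF sg[OF that]])
  have inbox: "z \<in> cbox b1 b2" if "g s z \<noteq> 0" "s \<in> ?U" for s z
    using out[OF that(2,1)] box by auto
  have "((\<lambda>s. integral (cbox b1 b2) (\<lambda>z. (g s z)\<^sup>2)) has_real_derivative
      integral (cbox b1 b2) (\<lambda>z. 2 * g t z * gt t z)) (at t within ?U)"
  proof (rule leibniz_rule_field_derivative)
    show "((\<lambda>s. (g s z)\<^sup>2) has_real_derivative 2 * g s z * gt s z) (at s within ?U)" if "s \<in> ?U" for s z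
      using DERIV_power[OF dt[OF that, of z, folded has_real_derivative_iff_has_vector_derivative], of 2]
      by (simp add: mult_ac)
    show "(\<lambda>z. (g s z)\<^sup>2) integrable_on cbox b1 b2" if "s \<in> ?U" for s
      by (intro integrable_continuous continuous_intros continuous_on_subset[OF cgs[OF that]]) auto
    show "continuous_on (?U \<times> cbox b1 b2) (\<lambda>(s, z). 2 * g s z * gt s z)"
      using cg[of "cbox b1 b2"] cgt[of "cbox b1 b2"] unfolding case_prod_beta by (intro continuous_intros)
  qed (use t in auto)
  moreover have y_eq: "integral (cbox b1 b2) (\<lambda>z. (g s z)\<^sup>2) = (LBINT z. (g s z)\<^sup>2)" if "s \<in> ?U" for s
    by (rule integral_eq_integral_cbox[symmetric]) (use inbox that in \<open>auto intro!: continuous_intros cgs\<close>)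
  moreover have "integral (cbox b1 b2) (\<lambda>z. 2 * g t z * gt t z) = - (LBINT z. ?force z)"
  proof -
    have "continuous_on UNIV (gt t)"
      using continuous_on_compose2[OF cgt[of UNIV], of UNIV "\<lambda>z. (t, z)"] t
      by (force simp: continuous_on_Pair)
    then have "integral (cbox b1 b2) (\<lambda>z. 2 * g t z * gt t z) = (LBINT z. 2 * g t z * gt t z)"
      by (intro integral_eq_integral_cbox[symmetric]) (use inbox t in \<open>auto intro!: continuous_intros cgs\<close>)
    also have "\<dots> = - (LBINT z. ?force z)"
      unfolding gt using XP_int force_int XP0
      by (simp add: Bochner_Integration.integral_diff Bochner_Integration.integral_sum)
    finally show ?thesis .
  qed
  ultimately have "((\<lambda>s. integral (cbox b1 b2) (\<lambda>z. (g s z)\<^sup>2)) has_real_derivative - (LBINT z. ?force z)) (at t within ?U)"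
    by simp
  then show ?thesis
    by (rule has_field_derivative_transform_within[of _ _ _ _ 1]) (use t y_eq in auto)
qed

subsection \<open>Gronwall's inequality and elementary estimates\<close>

text \<open>\<open>E\<close> is an integrating factor: \<open>exp (M t)\<close> on compact intervals, a power of \<open>t\<close> near infinity. It is used
backwards, since the information about \<open>y\<close> comes from late times.\<close>
lemma gronwall_backward:
  fixes y y' E E' :: "real \<Rightarrow> real"
  assumes ab: "a \<le> b"
    and y: "\<And>t. t \<in> {a..b} \<Longrightarrow> (y has_real_derivative y' t) (at t within {a..b})"
    and E: "\<And>t. t \<in> {a..b} \<Longrightarrow> (E has_real_derivative E' t) (at t)"
    and ineq: "\<And>t. t \<in> {a..b} \<Longrightarrow> y' t * E t + y t * E' t \<ge> 0"
  shows "y a * E a \<le> y b * E b"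
proof (rule DERIV_nonneg_imp_increasing_open[OF ab])
  show "\<exists>l. ((\<lambda>t. y t * E t) has_real_derivative l) (at t) \<and> 0 \<le> l" if "a < t" "t < b" for t
  proof -
    have "(y has_real_derivative y' t) (at t)"
      using y[of t] that by (simp add: at_within_Icc_at)
    then have "((\<lambda>t. y t * E t) has_real_derivative (y' t * E t + y t * E' t)) (at t)"
      using E[of t] that by (auto intro!: derivative_eq_intros)
    then show ?thesis using ineq[of t] that by auto
  qed
  show "continuous_on {a..b} (\<lambda>t. y t * E t)"
  proof (rule continuous_on_mult)
    show "continuous_on {a..b} y" by (rule DERIV_continuous_on[OF y])
    show "continuous_on {a..b} E" by (rule DERIV_continuous_on[OF has_field_derivative_at_within[OF E]])
  qed
qed

lemma integral_square_eq_0: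
  fixes g :: "'a::euclidean_space \<Rightarrow> real"
  assumes "continuous_on UNIV g" "bsupp g" "(LBINT z. (g z)\<^sup>2) = 0"
  shows "g z = 0"
proof -
  have i: "integrable lborel (\<lambda>z. (g z)\<^sup>2)"
    by (intro integrable_bsupp continuous_intros assms bsupp_mono[OF assms(2)]) auto
  obtain r where r: "r > 0" "\<And>x. g x \<noteq> 0 \<Longrightarrow> norm x \<le> r" by (rule bsuppE[OF assms(2)]) blast
  obtain a where a: "cball 0 (max r (norm z) + 1) \<subseteq> cbox (- a) (a :: 'a)"
    using bounded_cball bounded_subset_cbox_symmetric by metis
  have "integral (cbox (- a) a) (\<lambda>z. (g z)\<^sup>2) = 0"
    using integral_eq_integral_cbox[of "\<lambda>z. (g z)\<^sup>2" "- a" a] r(2) a assms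
    by (force intro!: continuous_intros)
  moreover have "(\<lambda>z. (g z)\<^sup>2) integrable_on cbox (- a) a"
    by (intro integrable_continuous continuous_intros continuous_on_subset[OF assms(1)]) auto
  ultimately have hi: "((\<lambda>z. (g z)\<^sup>2) has_integral 0) (cbox (- a) a)"
    by (metis integrable_integral)
  have z: "z \<in> cbox (- a) a" using a by auto
  have "ball 0 1 \<subseteq> interior (cbox (- a) a)"
  proof (rule interior_maximal)
    have "ball 0 1 \<subseteq> cball (0::'a) (max r (norm z) + 1)" using r(1) by auto
    then show "ball 0 1 \<subseteq> cbox (- a) a" using a by blast
  qed simp
  then have "box (- a) a \<noteq> {}" by (auto simp: interior_cbox)
  then have "(g z)\<^sup>2 = 0"
    by (intro has_integral_0_cbox_imp_0[OF _ _ hi _ z]) (auto intro!: continuous_intros continuous_on_subset[OF assms(1)])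
  then show ?thesis by simp
qed

lemma smooth_lipschitz_on_cball:
  fixes h :: "'a::euclidean_space \<Rightarrow> 'b::euclidean_space"
  assumes h: "smooth h"
  obtains K where "K \<ge> 0" "\<And>p q. norm p \<le> P \<Longrightarrow> norm q \<le> P \<Longrightarrow> norm (h p - h q) \<le> K * norm (p - q)"
proof -
  have "\<forall>b. \<exists>K\<ge>0. \<forall>p. norm p \<le> P \<longrightarrow> norm (dird b h p) \<le> K"
    using smooth_bounded_on_cball[OF smooth_dird[OF h], of P] by metis
  then obtain K where K: "\<And>b. K b \<ge> 0" "\<And>b p. norm p \<le> P \<Longrightarrow> norm (dird b h p) \<le> K b" by metis
  show ?thesis
  proof (rule that[of "sum K Basis"])
    show "sum K Basis \<ge> 0" using K by (intro sum_nonneg) auto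
    fix p q :: 'a assume pq: "norm p \<le> P" "norm q \<le> P"
    show "norm (h p - h q) \<le> sum K Basis * norm (p - q)"
    proof (rule differentiable_bound[of "cball 0 P"])
      fix x :: 'a assume x: "x \<in> cball 0 P"
      have d: "(h has_derivative (\<lambda>v. dird v h x)) (at x)" by (rule smooth_has_derivative[OF h])
      show "(h has_derivative (\<lambda>v. dird v h x)) (at x within cball 0 P)"
        by (rule has_derivative_at_withinI[OF d])
      have "onorm (\<lambda>v. dird v h x) \<le> (\<Sum>i\<in>Basis. norm (dird i h x))"
        by (rule onorm_componentwise[OF has_derivative_bounded_linear[OF d]])
      also have "\<dots> \<le> sum K Basis" using x by (intro sum_mono K) auto
      finally show "onorm (\<lambda>v. dird v h x) \<le> sum K Basis" .
    qed (use pq in auto)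
  qed
qed

lemma integral_square_le_sup:
  fixes h :: "vec3 \<Rightarrow> real"
  assumes "continuous_on UNIV h" "\<And>p. h p \<noteq> 0 \<Longrightarrow> p \<in> cball q r" "\<And>p. \<bar>h p\<bar> \<le> s" "r > 0"
  shows "(LBINT p. (h p)\<^sup>2) \<le> s\<^sup>2 * measure lborel (cball (0::vec3) r)"
proof -
  note i3 = integrable_indicator_cball[of q r]
  have "norm p \<le> norm q + r" if "h p \<noteq> 0" for p
    using assms(2)[OF that] norm_triangle_ineq2[of p q] by (simp add: dist_norm norm_minus_commute)
  then have b: "bsupp h" by (rule bsuppI)
  have "(LBINT p. (h p)\<^sup>2) \<le> (LBINT p. s\<^sup>2 * indicator (cball q r) p)"
  proof (rule integral_mono)
    show "integrable lborel (\<lambda>p. (h p)\<^sup>2)"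
      by (intro integrable_bsupp continuous_intros assms(1) bsupp_mono[OF b]) auto
    show "integrable lborel (\<lambda>p. s\<^sup>2 * indicator (cball q r) p)" using i3 by simp
    fix p
    have "(h p)\<^sup>2 \<le> s\<^sup>2" using power_mono[OF assms(3)[of p], of 2] by simp
    then show "(h p)\<^sup>2 \<le> s\<^sup>2 * indicator (cball q r) p"
      using assms(2)[of p] by (cases "h p = 0") auto
  qed
  also have "\<dots> = s\<^sup>2 * measure lborel (cball q r)" by simp
  finally show ?thesis using assms(4) by (simp add: content_cball)
qed

lemma norm_le_norm_shifted:
  fixes x a b :: "'a::real_normed_vector"
  shows "norm x \<le> norm (x - a + b) + norm a + norm b"
  using norm_triangle_ineq[of "x - a + b" a] norm_triangle_ineq4[of "x - a + b + a" b] by simp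

lemma ln_power_div_tendsto_0: "((\<lambda>t::real. ln t ^ k / t) \<longlongrightarrow> 0) at_top"
proof (rule Lim_transform_eventually)
  show "((\<lambda>t::real. ln t ^ k / exp (ln t)) \<longlongrightarrow> 0) at_top"
    by (rule filterlim_compose[OF tendsto_power_div_exp_0 ln_at_top])
  show "\<forall>\<^sub>F t::real in at_top. ln t ^ k / exp (ln t) = ln t ^ k / t"
    using eventually_gt_at_top[of 0] by eventually_elim simp
qed

subsection \<open>Two solutions with the same support\<close>

text \<open>The radius \<open>R0\<close> stands for the bound \<open>2 F_inf 3 + B\<close> of the support property, or anything larger.\<close>
locale vp_pair =
  fixes T0 B R0 :: real and \<Phi> :: "vec3 \<Rightarrow> real"
    and f f' :: "real \<Rightarrow> phase" and \<rho> \<rho>' \<phi> \<phi>' :: "real \<Rightarrow> vec3 \<Rightarrow> real"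
  assumes T0: "T0 > 0" and B: "B > 0" and R0: "R0 > 0" and \<Phi>: "smooth \<Phi>"
    and vp: "VP_solution T0 f \<rho> \<phi>" "VP_solution T0 f' \<rho>' \<phi>'"
    and support: "\<And>t x p. t \<ge> T0 \<Longrightarrow> f t x p \<noteq> 0 \<or> f' t x p \<noteq> 0 \<Longrightarrow>
       norm (x - t *\<^sub>R p + ln t *\<^sub>R grad \<Phi> p) \<le> R0 \<and> norm p \<le> 2 * B"
begin

definition "g t z = case_prod (f' t) z - case_prod (f t) z"
definition "y t = (LBINT z. (g t z)\<^sup>2)"
definition "mom_deriv t i = dird (0, axis i 1) (case_prod (f t))"
text \<open>Oriented such that \<open>y' = - force\<close>.\<close>
definition "force t = (LBINT z. 2 * (\<Sum>i\<in>UNIV. partial i (\<lambda>x. \<phi>' t x - \<phi> t x) (fst z) * mom_deriv t i z) * g t z)"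

lemma sf: "t \<ge> T0 \<Longrightarrow> smooth (case_prod (f t))" and sf': "t \<ge> T0 \<Longrightarrow> smooth (case_prod (f' t))"
  using VP_solutionD(2) vp by blast+

lemma space_support:
  obtains G where "G \<ge> 0"
    "\<And>t x p. t \<ge> T0 \<Longrightarrow> f t x p \<noteq> 0 \<or> f' t x p \<noteq> 0 \<Longrightarrow> norm x \<le> R0 + 2 * B * t + \<bar>ln t\<bar> * G"
proof -
  obtain G where G: "G \<ge> 0" "\<And>p. norm p \<le> 2 * B \<Longrightarrow> norm (grad \<Phi> p) \<le> G"
    using smooth_bounded_on_cball[OF smooth_grad[OF \<Phi>], of "2 * B"] by blast
  show ?thesis
  proof (rule that[OF G(1)])
    fix t x p assume t: "t \<ge> T0" and nz: "f t x p \<noteq> 0 \<or> f' t x p \<noteq> 0"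
    have s: "norm (x - t *\<^sub>R p + ln t *\<^sub>R grad \<Phi> p) \<le> R0" "norm p \<le> 2 * B" using support[OF t nz] by auto
    have "norm x \<le> norm (x - t *\<^sub>R p + ln t *\<^sub>R grad \<Phi> p) + norm (t *\<^sub>R p) + norm (ln t *\<^sub>R grad \<Phi> p)"
      by (rule norm_le_norm_shifted)
    also have "\<dots> \<le> R0 + t * (2 * B) + \<bar>ln t\<bar> * G"
      using s G(2)[OF s(2)] t T0 by (auto intro!: add_mono mult_left_mono)
    finally show "norm x \<le> R0 + 2 * B * t + \<bar>ln t\<bar> * G" by (simp add: mult_ac)
  qed
qed

lemma support_bounded:
  obtains b where "b > 0" "\<And>t x p. t \<in> {T0..T1} \<Longrightarrow> f t x p \<noteq> 0 \<or> f' t x p \<noteq> 0 \<Longrightarrow> norm (x, p) \<le> b \<and> norm x \<le> b"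
proof -
  obtain G where G: "G \<ge> 0"
    "\<And>t x p. t \<ge> T0 \<Longrightarrow> f t x p \<noteq> 0 \<or> f' t x p \<noteq> 0 \<Longrightarrow> norm x \<le> R0 + 2 * B * t + \<bar>ln t\<bar> * G"
    by (rule space_support) blast
  let ?b = "R0 + 2 * B * \<bar>T1\<bar> + (\<bar>ln T0\<bar> + \<bar>ln T1\<bar>) * G + 2 * B"
  show ?thesis
  proof (rule that[of ?b])
    show "?b > 0" using R0 B G by (intro add_nonneg_pos add_nonneg_nonneg) auto
    fix t x p assume t: "t \<in> {T0..T1}" and nz: "f t x p \<noteq> 0 \<or> f' t x p \<noteq> 0"
    have p: "norm p \<le> 2 * B" using support nz t by auto
    have "\<bar>ln t\<bar> \<le> \<bar>ln T0\<bar> + \<bar>ln T1\<bar>"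
    proof -
      have "ln T0 \<le> ln t" "ln t \<le> ln T1" using t T0 by auto
      then show ?thesis by linarith
    qed
    then have "\<bar>ln t\<bar> * G \<le> (\<bar>ln T0\<bar> + \<bar>ln T1\<bar>) * G" using G by (intro mult_right_mono)
    moreover have "2 * B * t \<le> 2 * B * \<bar>T1\<bar>" using t B by (intro mult_left_mono) auto
    ultimately have x: "norm x \<le> R0 + 2 * B * \<bar>T1\<bar> + (\<bar>ln T0\<bar> + \<bar>ln T1\<bar>) * G"
      using G(2)[of t x p] t nz by auto
    have "norm (x, p) \<le> norm x + norm p" by (simp add: norm_Pair sqrt_sum_squares_le_sum)
    then show "norm (x, p) \<le> ?b \<and> norm x \<le> ?b" using x p B by auto
  qed
qed

lemma bsupp_fields: "t \<ge> T0 \<Longrightarrow> bsupp (case_prod (f t))" "t \<ge> T0 \<Longrightarrow> bsupp (g t)"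
proof -
  assume t: "t \<ge> T0"
  obtain b where b: "\<And>s x p. s \<in> {T0..t} \<Longrightarrow> f s x p \<noteq> 0 \<or> f' s x p \<noteq> 0 \<Longrightarrow> norm (x, p) \<le> b \<and> norm x \<le> b"
    by (rule support_bounded[of t]) blast
  show "bsupp (case_prod (f t))" by (rule bsuppI[of _ b]) (use b[of t] t in auto)
  show "bsupp (g t)"
  proof (rule bsuppI[of _ b])
    fix z assume "g t z \<noteq> 0"
    then show "norm z \<le> b" using b[of t "fst z" "snd z"] t by (cases z) (auto simp: g_def)
  qed
qed

lemma smooth_g: "t \<ge> T0 \<Longrightarrow> smooth (g t)"
  unfolding g_def[abs_def] by (intro smooth_diff sf sf')

lemma y_derivative:
  assumes "t \<in> {T0..T1}" shows "(y has_real_derivative - force t) (at t within {T0..T1})"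
proof -
  obtain b where b: "\<And>t x p. t \<in> {T0..T1} \<Longrightarrow> f t x p \<noteq> 0 \<or> f' t x p \<noteq> 0 \<Longrightarrow> norm (x, p) \<le> b \<and> norm x \<le> b"
    by (rule support_bounded[of T1]) blast
  show ?thesis
    unfolding y_def[abs_def] force_def g_def mom_deriv_def
    by (rule energy_identity[OF vp _ assms, of b]) (use b in fastforce)
qed

lemma y_nonneg: "y t \<ge> 0" by (simp add: y_def)

lemma force_bound:
  assumes t: "t \<ge> T0" and R: "R > 0" "\<And>x p. f t x p \<noteq> 0 \<or> f' t x p \<noteq> 0 \<Longrightarrow> norm x \<le> R"
    and r: "r > 0" "\<And>x. \<exists>q. \<forall>p. f t x p \<noteq> 0 \<or> f' t x p \<noteq> 0 \<longrightarrow> p \<in> cball q r"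
    and S: "\<And>x. (\<Sum>i\<in>UNIV. LBINT p. (mom_deriv t i (x, p))\<^sup>2) \<le> S"
    and mu: "\<mu> > 0"
  shows "\<bar>force t\<bar> \<le> (16 * S * R\<^sup>2 * measure lborel (cball (0::vec3) r) * \<mu> + 1 / \<mu>) * y t"
  unfolding force_def y_def
proof (rule force_term_bound)
  show "smooth (g t)" "bsupp (g t)" by (rule smooth_g[OF t], rule bsupp_fields(2)[OF t])
  show "smooth (mom_deriv t i)" "bsupp (mom_deriv t i)" for i
    unfolding mom_deriv_def by (rule smooth_dird[OF sf[OF t]], rule bsupp_dird[OF bsupp_fields(1)[OF t]])
  note s\<phi> = VP_solutionD(3)[OF vp(1) t] and s\<phi>' = VP_solutionD(3)[OF vp(2) t]
  show "smooth (\<lambda>x. \<phi>' t x - \<phi> t x)" by (rule smooth_diff[OF s\<phi>' s\<phi>])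
  show "((\<lambda>x. \<phi>' t x - \<phi> t x) \<longlongrightarrow> 0) at_infinity"
    using tendsto_diff[OF VP_solutionD(7)[OF vp(2) t] VP_solutionD(7)[OF vp(1) t]] by simp
  show "laplacian (\<lambda>x. \<phi>' t x - \<phi> t x) x = (LBINT p. g t (x, p))" for x
    using VP_solutionD(4,5,6)[OF vp(1) t] VP_solutionD(4,5,6)[OF vp(2) t] by (simp add: laplacian_diff[OF s\<phi>' s\<phi>] g_def)
  show "R > 0" "r > 0" "\<mu> > 0" by fact+
  show "g t (x, p) \<noteq> 0 \<Longrightarrow> norm x \<le> R" for x p using R(2)[of x p] by (auto simp: g_def)
  show "norm x \<le> R" if "mom_deriv t i (x, p) \<noteq> 0" for i x p
  proof (rule ccontr)
    assume "\<not> norm x \<le> R"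
    have "closed {z :: vec3 \<times> vec3. norm (fst z) \<le> R}" by (intro closed_Collect_le continuous_intros)
    moreover have "z \<in> {z. norm (fst z) \<le> R}" if "case_prod (f t) z \<noteq> 0" for z
      using that by (cases z) (auto intro!: R(2))
    ultimately have "mom_deriv t i (x, p) = 0"
      unfolding mom_deriv_def using \<open>\<not> norm x \<le> R\<close> by (intro dird_eq_0_outside[of _ "{z. norm (fst z) \<le> R}"]) auto
    then show False using that by simp
  qed
  show "\<exists>q. \<forall>p. g t (x, p) \<noteq> 0 \<longrightarrow> p \<in> cball q r" for x
    using r(2)[of x] unfolding g_def by (metis case_prod_conv diff_self)
  show "(\<Sum>i\<in>UNIV. LBINT p. (mom_deriv t i (x, p))\<^sup>2) \<le> S" for x by (rule S)
qed

text \<open>On a compact time interval all quantities in the force bound are bounded, however large, by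
continuity and compact support.\<close>
lemma y_eq_0_backward:
  assumes T1: "T1 \<ge> T0" "y T1 = 0" and s: "s \<in> {T0..T1}"
  shows "y s = 0"
proof -
  obtain b where b: "b > 0" "\<And>t x p. t \<in> {T0..T1} \<Longrightarrow> f t x p \<noteq> 0 \<or> f' t x p \<noteq> 0 \<Longrightarrow> norm (x, p) \<le> b \<and> norm x \<le> b"
    by (rule support_bounded[of T1]) blast
  have "\<exists>K. \<forall>t\<in>{T0..T1}. \<forall>z. norm z \<le> b \<longrightarrow> \<bar>mom_deriv t i z\<bar> \<le> K" for i
  proof -
    have "continuous_on ({T0..} \<times> UNIV) (\<lambda>(t, z). mom_deriv t i z)"
      using smooth_slab_continuity(2)[OF VP_solutionD(1)[OF vp(1)], of "(0, axis i 1)"]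
      by (simp add: mom_deriv_def)
    then have "compact ((\<lambda>(t, z). mom_deriv t i z) ` ({T0..T1} \<times> cball 0 b))"
      by (intro compact_continuous_image compact_Times) (auto intro: continuous_on_subset)
    then obtain K where "\<And>w. w \<in> (\<lambda>(t, z). mom_deriv t i z) ` ({T0..T1} \<times> cball 0 b) \<Longrightarrow> norm w \<le> K"
      using compact_imp_bounded bounded_iff by metis
    then show ?thesis by (intro exI[of _ K]) force
  qed
  then obtain K where K: "\<And>i t z. t \<in> {T0..T1} \<Longrightarrow> norm z \<le> b \<Longrightarrow> \<bar>mom_deriv t i z\<bar> \<le> K i" by metis
  have Ez: "z \<in> cball 0 b" "norm (snd z) \<le> 2 * B" if "mom_deriv t i z \<noteq> 0" "t \<in> {T0..T1}" for t i z
  proof -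
    have "z \<in> cball 0 b \<inter> {z. norm (snd z) \<le> 2 * B}"
    proof (rule ccontr)
      assume z: "z \<notin> cball 0 b \<inter> {z. norm (snd z) \<le> 2 * B}"
      have c: "closed (cball 0 b \<inter> {z :: vec3 \<times> vec3. norm (snd z) \<le> 2 * B})"
        by (intro closed_Int closed_cball closed_Collect_le continuous_intros)
      have "mom_deriv t i z = 0"
        unfolding mom_deriv_def
      proof (rule dird_eq_0_outside[OF _ c z])
        fix w assume "case_prod (f t) w \<noteq> 0"
        then show "w \<in> cball 0 b \<inter> {z. norm (snd z) \<le> 2 * B}"
          using b(2)[OF that(2), of "fst w" "snd w"] support[of t "fst w" "snd w"] that(2) by (cases w) auto
      qed
      then show False using that by simp
    qed
    then show "z \<in> cball 0 b" "norm (snd z) \<le> 2 * B" by auto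
  qed
  let ?V = "measure lborel (cball (0::vec3) (2 * B))"
  define S where "S = (\<Sum>i\<in>UNIV. (max 0 (K i))\<^sup>2 * ?V)"
  define M where "M = 16 * S * b\<^sup>2 * ?V * 1 + 1 / 1"
  have fb: "\<bar>force t\<bar> \<le> M * y t" if t: "t \<in> {T0..T1}" for t
    unfolding M_def
  proof (rule force_bound)
    show "\<exists>q. \<forall>p. f t x p \<noteq> 0 \<or> f' t x p \<noteq> 0 \<longrightarrow> p \<in> cball q (2 * B)" for x
      by (rule exI[of _ 0]) (use support t in auto)
    show "(\<Sum>i\<in>UNIV. LBINT p. (mom_deriv t i (x, p))\<^sup>2) \<le> S" for x
      unfolding S_def
    proof (rule sum_mono)
      fix i :: 3
      show "(LBINT p. (mom_deriv t i (x, p))\<^sup>2) \<le> (max 0 (K i))\<^sup>2 * ?V"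
      proof (rule integral_square_le_sup[of _ 0])
        show "continuous_on UNIV (\<lambda>p. mom_deriv t i (x, p))"
          unfolding mom_deriv_def using t by (intro smooth_continuous smooth_slice smooth_dird sf) auto
        show "p \<in> cball 0 (2 * B)" if "mom_deriv t i (x, p) \<noteq> 0" for p using Ez(2)[OF that t] by simp
        show "\<bar>mom_deriv t i (x, p)\<bar> \<le> max 0 (K i)" for p
        proof (cases "mom_deriv t i (x, p) = 0")
          case False
          then show ?thesis using K[OF t, of "(x, p)" i] Ez(1)[OF False t] by simp
        qed simp
      qed (use B in simp)
    qed
  qed (use t b B in auto)
  have "y s * exp (M * s) \<le> y T1 * exp (M * T1)"
  proof (rule gronwall_backward[where y' = "\<lambda>t. - force t" and E' = "\<lambda>t. M * exp (M * t)"])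
    show "s \<le> T1" using s by simp
    show "(y has_real_derivative - force t) (at t within {s..T1})" if "t \<in> {s..T1}" for t
      by (rule has_field_derivative_subset[OF y_derivative]) (use that s in auto)
    show "((\<lambda>t. exp (M * t)) has_real_derivative M * exp (M * t)) (at t)" for t
      by (auto intro!: derivative_eq_intros)
    show "0 \<le> - force t * exp (M * t) + y t * (M * exp (M * t))" if "t \<in> {s..T1}" for t
    proof -
      have "0 \<le> (M * y t - force t) * exp (M * t)"
        using fb[of t] that s by (intro mult_nonneg_nonneg) auto
      then show ?thesis by (simp add: algebra_simps)
    qed
  qed
  then have "y s * exp (M * s) \<le> 0" using T1 by simp
  then show ?thesis using y_nonneg[of s] by (simp add: mult_le_0_iff)
qed

text \<open>Equal distribution functions have equal densities, and the difference of the potentials is then harmonic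
and decaying.\<close>
lemma solutions_agree:
  assumes "t \<ge> T0" "y t = 0"
  shows "f' t = f t \<and> \<rho>' t = \<rho> t \<and> \<phi>' t = \<phi> t"
proof -
  have "g t z = 0" for z
    by (rule integral_square_eq_0[OF smooth_continuous[OF smooth_g] bsupp_fields(2)])
       (use assms in \<open>auto simp: y_def\<close>)
  then have f: "f' t x p = f t x p" for x p using g_def[of t "(x, p)"] by simp
  then have \<rho>: "\<rho>' t x = \<rho> t x" for x
    using VP_solutionD(6)[OF vp(1) assms(1)] VP_solutionD(6)[OF vp(2) assms(1)] by simp
  note s\<phi> = VP_solutionD(3)[OF vp(1) assms(1)] and s\<phi>' = VP_solutionD(3)[OF vp(2) assms(1)]
  have "\<phi>' t x - \<phi> t x = 0" for x
  proof (rule decaying_harmonic_eq_0)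
    show "smooth (\<lambda>x. \<phi>' t x - \<phi> t x)" by (rule smooth_diff[OF s\<phi>' s\<phi>])
    show "((\<lambda>x. \<phi>' t x - \<phi> t x) \<longlongrightarrow> 0) at_infinity"
      using tendsto_diff[OF VP_solutionD(7)[OF vp(2) assms(1)] VP_solutionD(7)[OF vp(1) assms(1)]] by simp
    show "laplacian (\<lambda>x. \<phi>' t x - \<phi> t x) x = 0" for x
      using laplacian_diff[OF s\<phi>' s\<phi>] \<rho> VP_solutionD(4)[OF vp(1) assms(1)] VP_solutionD(4)[OF vp(2) assms(1)] by simp
  qed
  then show ?thesis using f \<rho> by (auto simp: fun_eq_iff)
qed

text \<open>If \<open>p\<close> and \<open>q\<close> both occur over \<open>x\<close> then \<open>t \<bar>p - q\<bar> \<le> 2 R0 + ln t \<bar>\<nabla>\<Phi> p - \<nabla>\<Phi> q\<bar>\<close>, and the logarithmic term is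
absorbed once \<open>ln t\<close> times the Lipschitz constant of \<open>\<nabla>\<Phi>\<close> is less than \<open>t / 2\<close>. Any momentum over \<open>x\<close> serves as
the centre of the ball.\<close>
lemma momentum_support:
  "\<forall>\<^sub>F t in at_top. \<forall>x. \<exists>q. \<forall>p. norm (x - t *\<^sub>R p + ln t *\<^sub>R grad \<Phi> p) \<le> R0 \<and> norm p \<le> 2 * B \<longrightarrow> p \<in> cball q (4 * R0 / t)"
proof -
  obtain K where K: "K \<ge> 0" "\<And>p q. norm p \<le> 2 * B \<Longrightarrow> norm q \<le> 2 * B \<Longrightarrow> norm (grad \<Phi> p - grad \<Phi> q) \<le> K * norm (p - q)"
    using smooth_lipschitz_on_cball[OF smooth_grad[OF \<Phi>], of "2 * B"] by blast
  have "((\<lambda>t. ln t / t * K) \<longlongrightarrow> 0 * K) at_top"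
    by (intro tendsto_intros ln_power_div_tendsto_0[of 1, simplified])
  then have "\<forall>\<^sub>F t in at_top. ln t / t * K < 1 / 2" by (intro order_tendstoD(2)[of _ 0]) auto
  then show ?thesis
    using eventually_ge_at_top[of 1]
  proof eventually_elim
    case (elim t)
    show ?case
    proof
      fix x
      let ?Q = "\<lambda>p. norm (x - t *\<^sub>R p + ln t *\<^sub>R grad \<Phi> p) \<le> R0 \<and> norm p \<le> 2 * B"
      show "\<exists>q. \<forall>p. ?Q p \<longrightarrow> p \<in> cball q (4 * R0 / t)"
      proof (cases "\<exists>q. ?Q q")
        case True
        then obtain q where q: "?Q q" by blast
        have "p \<in> cball q (4 * R0 / t)" if p: "?Q p" for p
        proof -
          have "norm (t *\<^sub>R (p - q)) = norm ((x - t *\<^sub>R q + ln t *\<^sub>R grad \<Phi> q)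
              - (x - t *\<^sub>R p + ln t *\<^sub>R grad \<Phi> p) + ln t *\<^sub>R (grad \<Phi> p - grad \<Phi> q))"
            by (rule arg_cong[where f=norm]) (simp add: algebra_simps)
          then have "norm (t *\<^sub>R (p - q)) \<le> norm (x - t *\<^sub>R q + ln t *\<^sub>R grad \<Phi> q) + norm (x - t *\<^sub>R p + ln t *\<^sub>R grad \<Phi> p)
             + norm (ln t *\<^sub>R (grad \<Phi> p - grad \<Phi> q))"
            using norm_triangle_ineq4[of "x - t *\<^sub>R q + ln t *\<^sub>R grad \<Phi> q" "x - t *\<^sub>R p + ln t *\<^sub>R grad \<Phi> p"]
              norm_triangle_ineq[of "(x - t *\<^sub>R q + ln t *\<^sub>R grad \<Phi> q) - (x - t *\<^sub>R p + ln t *\<^sub>R grad \<Phi> p)"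
                "ln t *\<^sub>R (grad \<Phi> p - grad \<Phi> q)"]
            by linarith
          also have "\<dots> \<le> R0 + R0 + ln t * (K * norm (p - q))"
            using p q K(2)[of p q] elim by (auto intro!: add_mono mult_left_mono)
          finally have "t * norm (p - q) \<le> 2 * R0 + ln t * K * norm (p - q)" using elim by simp
          moreover have "ln t * K * norm (p - q) \<le> t / 2 * norm (p - q)"
            using elim by (intro mult_right_mono) (auto simp: field_simps)
          ultimately have "t * norm (p - q) \<le> 4 * R0" by linarith
          then show ?thesis using elim by (simp add: dist_norm norm_minus_commute field_simps)
        qed
        then show ?thesis by blast
      qed blast
    qed
  qed
qed

lemma space_support_linear:
  "\<forall>\<^sub>F t in at_top. \<forall>x p. f t x p \<noteq> 0 \<or> f' t x p \<noteq> 0 \<longrightarrow> norm x \<le> 3 * B * t"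
proof -
  obtain G where G: "G \<ge> 0"
    "\<And>t x p. t \<ge> T0 \<Longrightarrow> f t x p \<noteq> 0 \<or> f' t x p \<noteq> 0 \<Longrightarrow> norm x \<le> R0 + 2 * B * t + \<bar>ln t\<bar> * G"
    by (rule space_support) blast
  have "((\<lambda>t. R0 * inverse t + ln t / t * G) \<longlongrightarrow> R0 * 0 + 0 * G) at_top"
    by (intro tendsto_intros ln_power_div_tendsto_0[of 1, simplified] tendsto_inverse_0_at_top filterlim_ident)
  then have "\<forall>\<^sub>F t in at_top. R0 * inverse t + ln t / t * G < B"
    using B by (intro order_tendstoD(2)[of _ 0]) auto
  then show ?thesis
    using eventually_ge_at_top[of 1] eventually_ge_at_top[of T0]
  proof eventually_elim
    case (elim t)
    then have "R0 + ln t * G \<le> B * t" by (simp add: field_simps)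
    then show ?case using G(2)[OF elim(3)] elim(2) by fastforce
  qed
qed

end

section \<open>Bounds by the scattering data\<close>

text \<open>The norms of the statement involve curried functions, the calculus above uncurried ones.\<close>
lemma mpow_case_prod:
  assumes "\<And>i g. case_prod (A i g) = Bo i (case_prod g)"
  shows "case_prod (mpow A I g) = mpow Bo I (case_prod g)"
proof -
  have "case_prod ((A i ^^ n) g) = (Bo i ^^ n) (case_prod g)" for i n g
    by (induction n) (auto simp: assms)
  then show ?thesis by (simp add: mpow_def)
qed

lemma L2norm_nonneg: "L2norm g \<ge> 0"
  by (simp add: L2norm_def)

lemma L2norm_power2:
  fixes h :: "'a::euclidean_space \<Rightarrow> real"
  shows "(L2norm h)\<^sup>2 = (LBINT z. (h z)\<^sup>2)"
  by (simp add: L2norm_def)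

lemma F_inf_nonneg: "F_inf \<nu> f n \<ge> 0"
  unfolding F_inf_def by (intro sum_nonneg) (auto intro!: add_nonneg_nonneg zero_le_power L2norm_nonneg)

lemma L2norm_le_F_inf:
  assumes "mabs I + mabs J \<le> n"
  shows "L2norm (case_prod (mpow dx I (mpow dp J f))) \<le> F_inf \<nu> f n"
proof -
  let ?l = "\<lambda>(I, J). L2norm (\<lambda>(x, p). mpow dx I (mpow dp J f) x p)"
  have "?l (I, J) \<le> ?l (I, J) + ?l (I, J) ^ \<nu> n" by (simp add: L2norm_nonneg)
  also have "\<dots> \<le> (\<Sum>IJ\<in>{(I, J). mabs I + mabs J \<le> n}. ?l IJ + ?l IJ ^ \<nu> n)"
  proof (rule member_le_sum[of "(I, J)" _ "\<lambda>IJ. ?l IJ + ?l IJ ^ \<nu> n"])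
    have "?l IJ \<ge> 0" for IJ by (cases IJ) (simp add: L2norm_nonneg)
    then show "0 \<le> ?l IJ + ?l IJ ^ \<nu> n" for IJ by (intro add_nonneg_nonneg zero_le_power)
  qed (use assms finite_mabs_pair_le in auto)
  also have "\<dots> = F_inf \<nu> f n" unfolding F_inf_def by (intro sum.cong) auto
  finally show ?thesis by simp
qed

text \<open>Compares two norms with different exponent sequences: every \<open>L\<^sup>2\<close> norm of order at most \<open>k\<close> is a summand of
the norm of order \<open>n\<close>. With \<open>k = 3\<close> it bounds the radius in the support property by the quantity on which
\<open>K\<close> may depend.\<close>
lemma F_inf_le:
  assumes "k \<le> n"
  shows "F_inf \<nu> f k \<le> real (card {(I, J). mabs I + mabs J \<le> k}) * (F_inf \<nu>' f n + F_inf \<nu>' f n ^ \<nu> k)"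
  unfolding F_inf_def[of \<nu> f k]
proof (rule sum_bounded_above)
  fix IJ assume "IJ \<in> {(I, J). mabs I + mabs J \<le> k}"
  then show "(case IJ of (I, J) \<Rightarrow> L2norm (\<lambda>(x, p). mpow dx I (mpow dp J f) x p)
        + L2norm (\<lambda>(x, p). mpow dx I (mpow dp J f) x p) ^ \<nu> k) \<le> F_inf \<nu>' f n + F_inf \<nu>' f n ^ \<nu> k"
    using assms by (auto intro!: add_mono power_mono L2norm_le_F_inf L2norm_nonneg)
qed

lemma scattering_dataD:
  assumes "scattering_data B f_inf"
  shows "smooth (case_prod f_inf)" "case_prod f_inf z \<noteq> 0 \<Longrightarrow> norm (fst z) + norm (snd z) \<le> B" "bsupp (case_prod f_inf)"
proof -
  note d = assms[unfolded scattering_data_def supp_def]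
  show "smooth (case_prod f_inf)" using d by blast
  show s: "norm (fst z) + norm (snd z) \<le> B" if "case_prod f_inf z \<noteq> 0" for z
    using subsetD[OF closure_subset, of z "{z. case_prod f_inf z \<noteq> 0}"] d that by auto
  show "bsupp (case_prod f_inf)"
  proof (rule bsuppI)
    fix z assume "case_prod f_inf z \<noteq> 0"
    then show "norm z \<le> B" using s[of z] norm_Pair_le[of "fst z" "snd z"] by simp
  qed
qed

lemma foldr_dird_eq_0_outside:
  assumes "\<And>z. h z \<noteq> 0 \<Longrightarrow> z \<in> S" "closed S"
  shows "foldr dird bs h z \<noteq> 0 \<Longrightarrow> z \<in> S"
proof (induction bs arbitrary: z)
  case (Cons b bs)
  then show ?case using dird_eq_0_outside[of "foldr dird bs h" S z b] assms(2) by auto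
qed (use assms in auto)

text \<open>Sobolev inequality on phase space: one derivative in each of the six directions on top of \<open>\<partial>\<^sub>x f_inf\<close>, of
total order seven. Since the support is bounded, \<open>2 \<bar>W\<bar> \<le> 1 + W\<^sup>2\<close> turns the \<open>L\<^sup>1\<close> norm into the square of an
\<open>L\<^sup>2\<close> norm; a nonlinear bound is good enough.\<close>
lemma abs_dx_f_inf_le:
  assumes sd: "scattering_data B f_inf" and n: "n \<ge> 7"
  shows "\<bar>dird (axis i 1, 0) (case_prod f_inf) z\<bar>
    \<le> (measure lborel (cball (0::vec3 \<times> vec3) B) + (F_inf \<nu> f_inf n)\<^sup>2) / 2"
proof -
  let ?f = "case_prod f_inf"
  let ?D = "\<lambda>i::3. dird (axis i (1::real), 0::vec3) :: (vec3 \<times> vec3 \<Rightarrow> real) \<Rightarrow> _"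
  let ?E = "\<lambda>i::3. dird (0::vec3, axis i (1::real)) :: (vec3 \<times> vec3 \<Rightarrow> real) \<Rightarrow> _"
  note f = scattering_dataD[OF sd]
  let ?bs = "[(axis 1 1, 0), (axis 2 1, 0), (axis 3 1, 0), (0, axis 1 1), (0, axis 2 1), (0, axis 3 1)] :: (vec3 \<times> vec3) list"
  have bs: "distinct ?bs" "set ?bs = Basis"
    by (auto simp: axis_eq_axis axis_eq_0_iff Basis_prod_def Basis_vec3)
  have h: "smooth (?D i ?f)" "bsupp (?D i ?f)" using f by (auto intro: smooth_dird bsupp_dird)
  let ?W = "foldr dird ?bs (?D i ?f)"
  have C: "dird u (dird v h) = dird v (dird u h)" if "smooth h" for u v and h :: "vec3 \<times> vec3 \<Rightarrow> real"
    by (rule ext, rule dird_commute[OF that])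
  let ?k = "?E 1 (?E 2 (?E 3 ?f))"
  have sE: "smooth (?E 3 ?f)" "smooth (?E 2 (?E 3 ?f))" and sk: "smooth ?k" "smooth (?D 3 ?k)" "smooth (?D 2 (?D 3 ?k))"
    by (intro smooth_dird f)+
  \<comment> \<open>The extra derivative \<open>\<partial>\<^sub>x\<^sub>i\<close> stands innermost; it is moved to its place among the other \<open>x\<close>-derivatives.\<close>
  have W_eq: "?W = ?D 1 (?D 2 (?D 3 (?D i ?k)))"
    by (simp only: foldr.simps o_apply id_apply C[OF f(1), of "(0, axis 3 1)" "(axis i 1, 0)"] C[OF sE(1), of "(0, axis 2 1)" "(axis i 1, 0)"]
        C[OF sE(2), of "(0, axis 1 1)" "(axis i 1, 0)"])
  have "\<exists>I. mabs I = 4 \<and> ?D 1 (?D 2 (?D 3 (?D i ?k))) = mpow ?D I ?k"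
  proof -
    consider "i = 1" | "i = 2" | "i = 3" using exhaust_3 by blast
    then show ?thesis
    proof cases
      case 1
      have "?D 1 (?D 2 (?D 3 (?D i ?k))) = ?D 1 (?D 1 (?D 2 (?D 3 ?k)))"
        by (simp only: 1 C[OF sk(1), of "(axis 3 1, 0)" "(axis 1 1, 0)"] C[OF sk(2), of "(axis 2 1, 0)" "(axis 1 1, 0)"])
      then show ?thesis
        by (intro exI[of _ "vector [2, 1, 1]"]) (simp add: mpow_def mabs_def sum_3 numeral_2_eq_2)
    next
      case 2
      have "?D 1 (?D 2 (?D 3 (?D i ?k))) = ?D 1 (?D 2 (?D 2 (?D 3 ?k)))"
        by (simp only: 2 C[OF sk(1), of "(axis 3 1, 0)" "(axis 2 1, 0)"])
      then show ?thesis
        by (intro exI[of _ "vector [1, 2, 1]"]) (simp add: mpow_def mabs_def sum_3 numeral_2_eq_2)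
    next
      case 3
      then show ?thesis
        by (intro exI[of _ "vector [1, 1, 2]"]) (simp add: mpow_def mabs_def sum_3 numeral_2_eq_2)
    qed
  qed
  then obtain I where I: "mabs I = 4" "?W = mpow ?D I ?k" unfolding W_eq by blast
  define J :: "nat ^ 3" where "J = vector [1, 1, 1]"
  have J: "mabs J = 3" "?k = mpow ?E J ?f" by (simp_all add: J_def mabs_def sum_3 mpow_def)
  have "?W = case_prod (mpow dx I (mpow dp J f_inf))"
    by (simp only: I(2) J(2) mpow_case_prod[of dx ?D, OF dx_eq_dird] mpow_case_prod[of dp ?E, OF dp_eq_dird])
  then have "L2norm ?W \<le> F_inf \<nu> f_inf n"
    using L2norm_le_F_inf[of I J n f_inf \<nu>] I(1) J(1) n by simp
  then have W2: "(LBINT z. (?W z)\<^sup>2) \<le> (F_inf \<nu> f_inf n)\<^sup>2"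
    unfolding L2norm_power2[symmetric] by (intro power_mono L2norm_nonneg)
  have W: "smooth ?W" "bsupp ?W" by (intro smooth_foldr_dird bsupp_foldr_dird h)+
  have W_out: "z \<in> cball 0 B" if "?W z \<noteq> 0" for z
  proof -
    have 1: "w \<in> cball 0 B" if "?f w \<noteq> 0" for w
      using f(2)[OF that] norm_Pair_le[of "fst w" "snd w"] by simp
    have 2: "w \<in> cball 0 B" if "?D i ?f w \<noteq> 0" for w
      using dird_eq_0_outside[OF 1 closed_cball] that by blast
    show ?thesis by (rule foldr_dird_eq_0_outside[OF 2 closed_cball that])
  qed
  note ball = integrable_indicator_cball[of "0::vec3 \<times> vec3" B]
  have W2i: "integrable lborel (\<lambda>z. (?W z)\<^sup>2)"
    by (intro integrable_square W)
  have "\<bar>?D i ?f z\<bar> \<le> (LBINT z. \<bar>?W z\<bar>)" by (rule sobolev_sup_bound[OF h bs])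
  also have "\<dots> \<le> (LBINT z. (indicator (cball 0 B) z + (?W z)\<^sup>2) / 2)"
  proof (rule integral_mono)
    show "integrable lborel (\<lambda>z. \<bar>?W z\<bar>)" by (intro integrable_abs integrable_smooth W)
    show "integrable lborel (\<lambda>z. (indicator (cball 0 B) z + (?W z)\<^sup>2) / 2)" using ball W2i by simp
    fix z
    show "\<bar>?W z\<bar> \<le> (indicator (cball 0 B) z + (?W z)\<^sup>2) / 2"
    proof (cases "?W z = 0")
      case False
      have "0 \<le> (\<bar>?W z\<bar> - 1)\<^sup>2" by simp
      then have "2 * \<bar>?W z\<bar> \<le> 1 + (?W z)\<^sup>2" unfolding power2_diff by simp
      then show ?thesis using W_out[OF False] by simp
    qed simp
  qed
  also have "\<dots> = (measure lborel (cball (0::vec3 \<times> vec3) B) + (LBINT z. (?W z)\<^sup>2)) / 2"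
    using ball W2i by simp
  finally show ?thesis using W2 by simp
qed

subsection \<open>The leading order approximation\<close>

text \<open>The leading approximation is \<open>f_inf\<close> composed with this map, the modified free transport to time \<open>0\<close>.\<close>
definition shear :: "(vec3 \<Rightarrow> real) \<Rightarrow> real \<Rightarrow> vec3 \<times> vec3 \<Rightarrow> vec3 \<times> vec3" where
  "shear \<Phi> t z = (fst z - t *\<^sub>R snd z + ln t *\<^sub>R grad \<Phi> (snd z), snd z)"

lemma f_approx_0:
  assumes "approx_coeffs B f_inf fc rhoc phic"
  shows "case_prod (f_approx \<Phi> fc 0 t) = (\<lambda>z. case_prod f_inf (shear \<Phi> t z))"
  using assms by (auto simp: fun_eq_iff f_approx_def shear_def approx_coeffs_def)

lemma smooth_shear: "smooth \<Phi> \<Longrightarrow> smooth (shear \<Phi> t)"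
  unfolding shear_def[abs_def]
  by (intro smooth_intros smooth_compose[OF smooth_grad])

lemma dird_shear:
  assumes "smooth \<Phi>"
  shows "dird (0, w) (shear \<Phi> t) z = (- t *\<^sub>R w + ln t *\<^sub>R dird w (grad \<Phi>) (snd z), w)"
proof -
  have "((\<lambda>z. grad \<Phi> (snd z)) has_derivative (\<lambda>v. dird (snd v) (grad \<Phi>) (snd z))) (at z)"
    by (rule has_derivative_compose[OF _ smooth_has_derivative[OF smooth_grad[OF assms]]])
       (auto intro!: derivative_eq_intros)
  then have "(shear \<Phi> t has_derivative (\<lambda>v. (fst v - t *\<^sub>R snd v + ln t *\<^sub>R dird (snd v) (grad \<Phi>) (snd z), snd v))) (at z)"
    unfolding shear_def[abs_def] by (auto intro!: derivative_eq_intros)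
  from dird_eqI[OF this, of "(0, w)"] show ?thesis by simp
qed

text \<open>By the chain rule \<open>\<partial>\<^sub>p\<close> produces \<open>- t \<partial>\<^sub>x f_inf\<close> and terms of order \<open>ln t\<close> and \<open>1\<close>, which are at most \<open>t\<close> for large \<open>t\<close>.\<close>
lemma free_transport_dp_bound:
  assumes \<Phi>: "smooth \<Phi>" and sd: "scattering_data B f_inf"
    and \<sigma>: "\<And>i z. \<bar>dird (axis i 1, 0) (case_prod f_inf) z\<bar> \<le> \<sigma>"
  shows "\<forall>\<^sub>F t in at_top. \<forall>i z. \<bar>dird (0, axis i 1) (\<lambda>z. case_prod f_inf (shear \<Phi> t z)) z\<bar> \<le> t * (\<sigma> + 1)"
proof -
  let ?f = "case_prod f_inf"
  note f = scattering_dataD[OF sd]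
  have \<sigma>0: "\<sigma> \<ge> 0" using \<sigma>[of 1 0] by linarith
  obtain k where k: "k \<ge> 0" "\<And>i p. norm p \<le> B \<Longrightarrow> norm (dird (axis (i::3) 1) (grad \<Phi>) p) \<le> k"
    using smooth_family_bounded_on_cball[of "\<lambda>i::3. dird (axis i 1) (grad \<Phi>)" B] smooth_dird[OF smooth_grad[OF \<Phi>]] by metis
  have "\<forall>i. \<exists>M\<ge>0. \<forall>z. \<bar>dird (0, axis i 1) ?f z\<bar> \<le> M"
    using bounded_bsupp[OF smooth_continuous[OF smooth_dird[OF f(1)]] bsupp_dird[OF f(3)]] by metis
  then obtain M where M: "\<And>i. M i \<ge> 0" "\<And>i z. \<bar>dird (0, axis (i::3) 1) ?f z\<bar> \<le> M i" by metis
  define m where "m = sum M UNIV"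
  have m: "M i \<le> m" for i unfolding m_def by (rule member_le_sum) (use M in auto)
  have "((\<lambda>t. ln t / t * (3 * k * \<sigma>) + m * inverse t) \<longlongrightarrow> 0 * (3 * k * \<sigma>) + m * 0) at_top"
    by (intro tendsto_intros ln_power_div_tendsto_0[of 1, simplified] tendsto_inverse_0_at_top filterlim_ident)
  then have "\<forall>\<^sub>F t in at_top. ln t / t * (3 * k * \<sigma>) + m * inverse t < 1"
    by (intro order_tendstoD(2)[of _ 0]) auto
  then show ?thesis
    using eventually_ge_at_top[of 1]
  proof eventually_elim
    case (elim t)
    then have small: "ln t * (3 * k * \<sigma>) + m \<le> t" by (simp add: field_simps)
    show ?case
    proof (intro allI)
      fix i :: 3 and z
      let ?z = "shear \<Phi> t z" and ?w = "dird (axis i 1) (grad \<Phi>) (snd z)"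
      have eq: "dird (0, axis i 1) (\<lambda>z. ?f (shear \<Phi> t z)) z = dird (- t *\<^sub>R axis i 1 + ln t *\<^sub>R ?w, axis i 1) ?f ?z"
        by (simp add: dird_compose[OF f(1) smooth_shear[OF \<Phi>]] dird_shear[OF \<Phi>])
      show "\<bar>dird (0, axis i 1) (\<lambda>z. ?f (shear \<Phi> t z)) z\<bar> \<le> t * (\<sigma> + 1)"
      proof (cases "norm (snd z) \<le> B")
        case False
        have "closed {z :: vec3 \<times> vec3. norm (snd z) \<le> B}" by (intro closed_Collect_le continuous_intros)
        moreover have "w \<in> {z. norm (snd z) \<le> B}" if "?f w \<noteq> 0" for w
          using f(2)[OF that] norm_ge_zero[of "fst w"] by (simp del: norm_ge_zero)
        ultimately have "dird (- t *\<^sub>R axis i 1 + ln t *\<^sub>R ?w, axis i 1) ?f ?z = 0"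
          using False by (intro dird_eq_0_outside[of _ "{z. norm (snd z) \<le> B}"]) (auto simp: shear_def)
        then show ?thesis using eq elim \<sigma>0 by simp
      next
        case True
        note lin = linear_dird[OF f(1), of ?z]
        have w: "?w = (\<Sum>j\<in>UNIV. ?w $ j *\<^sub>R axis j 1)"
          by (simp add: vec_eq_iff axis_def if_distrib cong: if_cong)
        have v: "(- t *\<^sub>R axis i 1 + ln t *\<^sub>R ?w, axis i 1)
            = (- t) *\<^sub>R (axis i 1, 0) + ln t *\<^sub>R (\<Sum>j\<in>UNIV. ?w $ j *\<^sub>R (axis j 1, 0)) + (0, axis i 1)"
          by (subst w) (simp add: prod_eq_iff fst_sum snd_sum)
        have "dird (- t *\<^sub>R axis i 1 + ln t *\<^sub>R ?w, axis i 1) ?f ?z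
            = (- t) *\<^sub>R dird (axis i 1, 0) ?f ?z + ln t *\<^sub>R (\<Sum>j\<in>UNIV. ?w $ j *\<^sub>R dird (axis j 1, 0) ?f ?z) + dird (0, axis i 1) ?f ?z"
          unfolding v linear_add[OF lin] linear_cmul[OF lin] linear_sum[OF lin] ..
        moreover have "\<bar>(- t) *\<^sub>R dird (axis i 1, 0) ?f ?z\<bar> \<le> t * \<sigma>"
          using \<sigma>[of i ?z] elim by (simp add: abs_mult)
        moreover have "\<bar>ln t *\<^sub>R (\<Sum>j\<in>UNIV. ?w $ j *\<^sub>R dird (axis j 1, 0) ?f ?z)\<bar> \<le> ln t * (3 * k * \<sigma>)"
        proof -
          have "\<bar>?w $ j *\<^sub>R dird (axis j 1, 0) ?f ?z\<bar> \<le> k * \<sigma>" for j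
          proof -
            have "\<bar>?w $ j\<bar> \<le> k"
              using component_le_norm_cart[of ?w j] k(2)[OF True, of i] by linarith
            then show ?thesis using \<sigma>[of j ?z] by (simp add: abs_mult mult_mono)
          qed
          then have "\<bar>\<Sum>j\<in>UNIV. ?w $ j *\<^sub>R dird (axis j 1, 0) ?f ?z\<bar> \<le> (\<Sum>j\<in>(UNIV::3 set). k * \<sigma>)"
            by (intro sum_abs[THEN order_trans] sum_mono)
          then show ?thesis using elim by (simp add: abs_mult mult_left_mono mult.assoc)
        qed
        moreover have "\<bar>dird (0, axis i 1) ?f ?z\<bar> \<le> m" using M(2)[of i ?z] m[of i] by linarith
        ultimately have "\<bar>dird (- t *\<^sub>R axis i 1 + ln t *\<^sub>R ?w, axis i 1) ?f ?z\<bar> \<le> t * \<sigma> + (ln t * (3 * k * \<sigma>) + m)"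
          by linarith
        then show ?thesis using eq small by (simp add: algebra_simps)
      qed
    qed
  qed
qed

subsection \<open>The rate of growth\<close>

text \<open>The constant in the force bound \<open>(16 S R\<^sup>2 P \<mu> + 1/\<mu>) y\<close> after factoring out \<open>1/t\<close>, for \<open>\<mu> = t\<close>, the radius \<open>3 B t\<close>
in space, \<open>P = w / t\<^sup>3\<close> the volume of a ball of radius \<open>4 R / t\<close>, and \<open>S = (6 (\<sigma> + 1)\<^sup>2 w + 2) / t\<close>.\<close>
definition growth_rate :: "real \<Rightarrow> real \<Rightarrow> real \<Rightarrow> real" where
  "growth_rate B R \<sigma> = (let w = measure lborel (cball (0::vec3) 1) * (4 * R) ^ 3
     in 16 * (6 * (\<sigma> + 1)\<^sup>2 * w + 2) * (3 * B)\<^sup>2 * w + 1)"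

text \<open>In \<open>S\<close>, the term with \<open>\<sigma>\<close> comes from the leading approximation and \<open>2 / t\<close> from the remainder. The
estimate assumed for the remainder gives \<open>\<integral> \<bar>\<partial>\<^sub>p e\<bar>\<^sup>2 dp = O((ln t)\<^sup>2 / t\<^sup>3)\<close>; of this only smallness compared with
\<open>1/t\<close> is kept, whatever the constant \<open>c\<close>.\<close>
lemma (in vp_pair) force_growth_rate:
  assumes sd: "scattering_data B f_inf" and BR: "B \<le> R0"
    and \<sigma>: "\<And>i z. \<bar>dird (axis i 1, 0) (case_prod f_inf) z\<bar> \<le> \<sigma>"
    and est: "\<And>t I i. t \<ge> T0 \<Longrightarrow> mabs I \<le> 3 \<Longrightarrow>
       L2norm (mpow (Lop \<Phi> t) I (\<lambda>z. dird (0, axis i 1) (\<lambda>z. case_prod (f t) z - case_prod f_inf (shear \<Phi> t z)) z / t))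
         \<le> c * ln t / t"
  shows "\<forall>\<^sub>F t in at_top. \<bar>force t\<bar> \<le> growth_rate B R0 \<sigma> / t * y t"
proof -
  obtain K where K: "K \<ge> 0"
    "\<And>t u E x. t \<ge> 1 \<Longrightarrow> smooth u \<Longrightarrow> bsupp u \<Longrightarrow> (\<And>z. u z \<noteq> 0 \<Longrightarrow> norm (snd z) \<le> 2 * B) \<Longrightarrow>
      (\<And>I. mabs I \<le> 3 \<Longrightarrow> (LBINT z. (mpow (Lop \<Phi> t) I u z)\<^sup>2) \<le> E) \<Longrightarrow>
      (LBINT p. (u (x, p))\<^sup>2) \<le> K * E / t ^ 3"
    using velocity_average_bound[OF \<Phi>, of "2 * B"] by blast
  note fi = scattering_dataD[OF sd]
  have "((\<lambda>t. K * c\<^sup>2 * (ln t / t)\<^sup>2) \<longlongrightarrow> K * c\<^sup>2 * 0\<^sup>2) at_top"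
    by (intro tendsto_intros ln_power_div_tendsto_0[of 1, simplified])
  then have "\<forall>\<^sub>F t in at_top. K * c\<^sup>2 * (ln t / t)\<^sup>2 < 1 / 3" by (intro order_tendstoD(2)[of _ 0]) auto
  then show ?thesis
    using free_transport_dp_bound[OF \<Phi> sd \<sigma>] momentum_support space_support_linear
      eventually_ge_at_top[of 1] eventually_ge_at_top[of T0]
  proof eventually_elim
    case (elim t)
    let ?f0 = "\<lambda>z. case_prod f_inf (shear \<Phi> t z)"
    let ?e = "\<lambda>z. case_prod (f t) z - ?f0 z"
    let ?r = "4 * R0 / t"
    let ?P = "measure lborel (cball (0::vec3) ?r)"
    define w where "w = measure lborel (cball (0::vec3) 1) * (4 * R0) ^ 3"
    have r: "?r > 0" using R0 elim by simp
    have P: "?P = w / t ^ 3" using r by (simp add: content_cball w_def power_divide)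
    have f0: "smooth ?f0" by (rule smooth_compose[OF fi(1) smooth_shear[OF \<Phi>]])
    have e: "smooth ?e" by (rule smooth_diff[OF sf f0]) (use elim in simp)
    let ?Q = "\<lambda>x p. norm (x - t *\<^sub>R p + ln t *\<^sub>R grad \<Phi> p) \<le> R0 \<and> norm p \<le> 2 * B"
    have Qf: "?Q x p" if "f t x p \<noteq> 0 \<or> f' t x p \<noteq> 0" for x p using support that elim by simp
    have Qf0: "?Q (fst z) (snd z)" if "?f0 z \<noteq> 0" for z
    proof -
      have "norm (fst (shear \<Phi> t z)) \<le> B" "norm (snd (shear \<Phi> t z)) \<le> B"
        using fi(2)[OF that] norm_ge_zero[of "fst (shear \<Phi> t z)"] norm_ge_zero[of "snd (shear \<Phi> t z)"] by linarith+
      then show ?thesis using BR B by (simp add: shear_def)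
    qed
    have Qclosed: "closed {z. ?Q (fst z) (snd z)}"
      by (intro closed_Collect_conj closed_Collect_le continuous_intros
          continuous_on_compose2[OF smooth_continuous[OF smooth_grad[OF \<Phi>], of UNIV]]) auto
    have Qdf0: "?Q (fst z) (snd z)" if "dird v ?f0 z \<noteq> 0" for v z
      using dird_eq_0_outside[OF _ Qclosed, of ?f0 z v] Qf0 that by blast
    have Qe: "?Q (fst z) (snd z)" if "?e z \<noteq> 0" for z
    proof -
      have "?f0 z \<noteq> 0 \<or> f t (fst z) (snd z) \<noteq> 0" using that by (cases z) auto
      then show ?thesis using Qf0 Qf by blast
    qed
    have Qde: "?Q (fst z) (snd z)" if "dird v ?e z \<noteq> 0" for v z
      using dird_eq_0_outside[OF _ Qclosed, of ?e z v] Qe that by blast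
    have e_bsupp: "bsupp ?e"
    proof -
      obtain G where G: "G \<ge> 0" "\<And>p. norm p \<le> 2 * B \<Longrightarrow> norm (grad \<Phi> p) \<le> G"
        using smooth_bounded_on_cball[OF smooth_grad[OF \<Phi>], of "2 * B"] by blast
      show ?thesis
      proof (rule bsuppI)
        fix z assume "?e z \<noteq> 0"
        from Qe[OF this] have q: "norm (fst z - t *\<^sub>R snd z + ln t *\<^sub>R grad \<Phi> (snd z)) \<le> R0" "norm (snd z) \<le> 2 * B" by auto
        have "norm (fst z) \<le> norm (fst z - t *\<^sub>R snd z + ln t *\<^sub>R grad \<Phi> (snd z)) + norm (t *\<^sub>R snd z)
            + norm (ln t *\<^sub>R grad \<Phi> (snd z))"
          by (rule norm_le_norm_shifted)
        also have "\<dots> \<le> R0 + t * (2 * B) + ln t * G"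
          using q G(2)[OF q(2)] elim by (auto intro!: add_mono mult_left_mono)
        finally show "norm z \<le> R0 + t * (2 * B) + ln t * G + 2 * B"
          using q norm_Pair_le[of "fst z" "snd z"] by simp
      qed
    qed
    define S where "S = 6 * (t * (\<sigma> + 1))\<^sup>2 * ?P + 2 / t"
    have "\<bar>force t\<bar> \<le> (16 * S * (3 * B * t)\<^sup>2 * ?P * t + 1 / t) * y t"
    proof (rule force_bound)
      show "t \<ge> T0" "3 * B * t > 0" "?r > 0" "t > 0" using elim B r by auto
      show "f t x p \<noteq> 0 \<or> f' t x p \<noteq> 0 \<Longrightarrow> norm x \<le> 3 * B * t" for x p using elim by blast
      show "\<exists>q. \<forall>p. f t x p \<noteq> 0 \<or> f' t x p \<noteq> 0 \<longrightarrow> p \<in> cball q ?r" for x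
        using elim(3) Qf by meson
      fix x
      obtain q where q: "\<And>p. ?Q x p \<Longrightarrow> p \<in> cball q ?r" using elim(3) by blast
      have "(LBINT p. (mom_deriv t i (x, p))\<^sup>2) \<le> 2 * ((t * (\<sigma> + 1))\<^sup>2 * ?P) + 2 * (1 / (3 * t))" for i
      proof -
        let ?d = "dird (0::vec3, axis i (1::real)) :: (vec3 \<times> vec3 \<Rightarrow> real) \<Rightarrow> _"
        have mom_deriv: "mom_deriv t i z = ?d ?f0 z + ?d ?e z" for z
        proof -
          have "?d ?e z = ?d (case_prod (f t)) z - ?d ?f0 z" using sf elim f0 by (intro dird_diff) auto
          then show ?thesis by (simp add: mom_deriv_def)
        qed
        have b0: "bsupp (\<lambda>p. ?d ?f0 (x, p))"
        proof (rule bsuppI)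
          fix p assume "?d ?f0 (x, p) \<noteq> 0"
          from Qdf0[OF this] show "norm p \<le> 2 * B" by simp
        qed
        have i0: "integrable lborel (\<lambda>p. (?d ?f0 (x, p))\<^sup>2)" by (rule integrable_square[OF smooth_slice[OF smooth_dird[OF f0]] b0])
        have ie: "integrable lborel (\<lambda>p. (?d ?e (x, p))\<^sup>2)"
          by (rule integrable_square[OF smooth_slice[OF smooth_dird[OF e]] bsupp_slice[OF bsupp_dird[OF e_bsupp]]])
        have iE: "integrable lborel (\<lambda>p. (mom_deriv t i (x, p))\<^sup>2)"
          unfolding mom_deriv_def using elim
          by (intro integrable_square smooth_slice smooth_dird sf bsupp_slice bsupp_dird bsupp_fields) auto
        have 1: "(LBINT p. (?d ?f0 (x, p))\<^sup>2) \<le> (t * (\<sigma> + 1))\<^sup>2 * ?P"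
        proof (rule integral_square_le_sup[of _ q])
          show "continuous_on UNIV (\<lambda>p. ?d ?f0 (x, p))" by (intro smooth_continuous smooth_slice smooth_dird f0)
          show "p \<in> cball q ?r" if "?d ?f0 (x, p) \<noteq> 0" for p using q Qdf0[OF that] by simp
          show "\<bar>?d ?f0 (x, p)\<bar> \<le> t * (\<sigma> + 1)" for p using elim(2) by blast
        qed (rule r)
        have 2: "(LBINT p. (?d ?e (x, p))\<^sup>2) \<le> 1 / (3 * t)"
        proof -
          let ?u = "\<lambda>z. ?d ?e z / t"
          have u_eq: "?u = (\<lambda>z. (1 / t) * ?d ?e z)" by auto
          have "(LBINT p. (?u (x, p))\<^sup>2) \<le> K * (c * ln t / t)\<^sup>2 / t ^ 3"
          proof (rule K(2))
            show "t \<ge> 1" by (rule elim)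
            show "smooth ?u" "bsupp ?u"
              unfolding u_eq by (intro smooth_mult smooth_const smooth_dird e bsupp_mult_right bsupp_dird e_bsupp)+
            show "norm (snd z) \<le> 2 * B" if "?u z \<noteq> 0" for z using Qde[of "(0, axis i 1)" z] that by auto
            show "(LBINT z. (mpow (Lop \<Phi> t) I ?u z)\<^sup>2) \<le> (c * ln t / t)\<^sup>2" if "mabs I \<le> 3" for I
              unfolding L2norm_power2[symmetric] using est[of t I i] that elim by (intro power_mono L2norm_nonneg) auto
          qed
          also have "(LBINT p. (?u (x, p))\<^sup>2) = (LBINT p. (?d ?e (x, p))\<^sup>2) / t\<^sup>2"
            by (simp add: power_divide)
          finally have "(LBINT p. (?d ?e (x, p))\<^sup>2) \<le> t\<^sup>2 * (K * (c * ln t / t)\<^sup>2 / t ^ 3)"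
            using elim by (simp add: field_simps)
          also have "\<dots> = K * c\<^sup>2 * (ln t / t)\<^sup>2 / t"
            using elim by (simp add: field_simps power2_eq_square power3_eq_cube)
          also have "\<dots> \<le> (1 / 3) / t" using elim by (intro divide_right_mono) auto
          finally show ?thesis by simp
        qed
        have "(LBINT p. (mom_deriv t i (x, p))\<^sup>2) \<le> (LBINT p. 2 * (?d ?f0 (x, p))\<^sup>2 + 2 * (?d ?e (x, p))\<^sup>2)"
        proof (rule integral_mono[OF iE])
          show "integrable lborel (\<lambda>p. 2 * (?d ?f0 (x, p))\<^sup>2 + 2 * (?d ?e (x, p))\<^sup>2)" using i0 ie by simp
          fix p
          have "0 \<le> (?d ?f0 (x, p) - ?d ?e (x, p))\<^sup>2" by simp
          then show "(mom_deriv t i (x, p))\<^sup>2 \<le> 2 * (?d ?f0 (x, p))\<^sup>2 + 2 * (?d ?e (x, p))\<^sup>2"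
            unfolding mom_deriv power2_sum power2_diff by simp
        qed
        also have "\<dots> = 2 * (LBINT p. (?d ?f0 (x, p))\<^sup>2) + 2 * (LBINT p. (?d ?e (x, p))\<^sup>2)"
          using i0 ie by simp
        finally show ?thesis using 1 2 by linarith
      qed
      then have "(\<Sum>i\<in>UNIV. LBINT p. (mom_deriv t i (x, p))\<^sup>2) \<le> (\<Sum>i\<in>(UNIV::3 set). 2 * ((t * (\<sigma> + 1))\<^sup>2 * ?P) + 2 * (1 / (3 * t)))"
        by (intro sum_mono)
      also have "\<dots> = S" by (simp add: S_def field_simps)
      finally show "(\<Sum>i\<in>UNIV. LBINT p. (mom_deriv t i (x, p))\<^sup>2) \<le> S" .
    qed
    also have "16 * S * (3 * B * t)\<^sup>2 * ?P * t + 1 / t = growth_rate B R0 \<sigma> / t"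
      unfolding S_def P growth_rate_def Let_def w_def[symmetric] using elim
      by (simp add: field_simps power2_eq_square power3_eq_cube)
    finally show ?case .
  qed
qed

text \<open>\<open>y t * t powr m\<close> is nondecreasing for large \<open>t\<close>. The decay hypothesis bounds it by
\<open>D (ln t)\<^bsup>2 + 2 K\<^esup> t\<^bsup>K - 2 - 2 K\<^esup>\<close>, which tends to \<open>0\<close>.\<close>
lemma (in vp_pair) y_eq_0_if_fast_decay:
  assumes rate: "\<forall>\<^sub>F t in at_top. \<bar>force t\<bar> \<le> m / t * y t"
    and decay: "\<forall>\<^sub>F t in at_top. y t \<le> D * (ln t ^ (1 + K) / t ^ (1 + K))\<^sup>2"
    and m: "m \<le> real K"
    and s: "s \<ge> T0"
  shows "y s = 0"
proof -
  obtain T where T: "T \<ge> 1" "T \<ge> s" "\<And>t. t \<ge> T \<Longrightarrow> \<bar>force t\<bar> \<le> m / t * y t"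
    "\<And>t. t \<ge> T \<Longrightarrow> y t \<le> D * (ln t ^ (1 + K) / t ^ (1 + K))\<^sup>2"
  proof -
    have "\<forall>\<^sub>F t in at_top. 1 \<le> t \<and> s \<le> t \<and> \<bar>force t\<bar> \<le> m / t * y t \<and> y t \<le> D * (ln t ^ (1 + K) / t ^ (1 + K))\<^sup>2"
      using rate decay eventually_ge_at_top[of 1] eventually_ge_at_top[of s] by eventually_elim auto
    then obtain T where "\<And>t. t \<ge> T \<Longrightarrow> 1 \<le> t \<and> s \<le> t \<and> \<bar>force t\<bar> \<le> m / t * y t \<and> y t \<le> D * (ln t ^ (1 + K) / t ^ (1 + K))\<^sup>2"
      unfolding eventually_at_top_linorder by blast
    then show ?thesis using that[of T] by auto
  qed
  have TT0: "T \<ge> T0" using T s by simp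
  have mono: "y T * T powr m \<le> y t * t powr m" if t: "t \<ge> T" for t
  proof (rule gronwall_backward[where y' = "\<lambda>t. - force t" and E' = "\<lambda>t. m * t powr (m - 1)"])
    show "T \<le> t" by (rule t)
    show "(y has_real_derivative - force r) (at r within {T..t})" if "r \<in> {T..t}" for r
      by (rule has_field_derivative_subset[OF y_derivative]) (use that TT0 in auto)
    show "((\<lambda>t. t powr m) has_real_derivative m * r powr (m - 1)) (at r)" if "r \<in> {T..t}" for r
      using that T(1) by (intro has_real_derivative_powr) auto
    show "0 \<le> - force r * r powr m + y r * (m * r powr (m - 1))" if "r \<in> {T..t}" for r
    proof -
      have r: "r > 0" "r \<ge> T" using that T(1) by auto
      have "0 \<le> (m / r * y r - force r) * r powr m"
        using T(3)[OF r(2)] by (intro mult_nonneg_nonneg) auto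
      also have "\<dots> = - force r * r powr m + y r * (m * r powr (m - 1))"
        using r by (simp add: powr_diff field_simps)
      finally show ?thesis .
    qed
  qed
  have "\<forall>\<^sub>F t in at_top. y T * T powr m \<le> D * (ln t ^ (2 * (1 + K)) / t)"
    using eventually_ge_at_top[of T]
  proof eventually_elim
    case (elim t)
    have t: "t \<ge> 1" "t > 0" using elim T(1) by auto
    have D0: "0 \<le> D * (ln t ^ (1 + K) / t ^ (1 + K))\<^sup>2" using T(4)[OF elim] y_nonneg[of t] by linarith
    have "y T * T powr m \<le> y t * t powr m" by (rule mono[OF elim])
    also have "\<dots> \<le> D * (ln t ^ (1 + K) / t ^ (1 + K))\<^sup>2 * t ^ K"
    proof (rule mult_mono[OF T(4)[OF elim]])
      show "t powr m \<le> t ^ K" using powr_mono[OF m t(1)] t by (simp add: powr_realpow)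
    qed (use D0 in auto)
    also have "\<dots> = D * (ln t ^ (1 + K))\<^sup>2 * (t ^ K / (t ^ (1 + K))\<^sup>2)"
      by (simp add: power_divide)
    also have "t ^ K / (t ^ (1 + K))\<^sup>2 = 1 / t / t ^ (1 + K)"
      using t by (simp add: power2_eq_square field_simps)
    also have "D * (ln t ^ (1 + K))\<^sup>2 * (1 / t / t ^ (1 + K)) \<le> D * (ln t ^ (1 + K))\<^sup>2 * (1 / t / 1)"
    proof (cases "ln t = 0")
      case False
      then have "D \<ge> 0" using D0 t by (auto simp: zero_le_mult_iff power_0_left)
      moreover have "1 \<le> t ^ (1 + K)" using t by (intro one_le_power)
      ultimately show ?thesis using t by (intro mult_left_mono divide_left_mono) auto
    qed simp
    also have "D * (ln t ^ (1 + K))\<^sup>2 * (1 / t / 1) = D * (ln t ^ (2 * (1 + K)) / t)"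
    proof -
      have "(ln t ^ (1 + K))\<^sup>2 = ln t ^ (2 * (1 + K))" by (metis power_mult mult.commute)
      then show ?thesis by simp
    qed
    finally show ?case .
  qed
  then have "y T * T powr m \<le> D * 0"
    by (intro tendsto_lowerbound[where F = at_top and f = "\<lambda>t. D * (ln t ^ (2 * (1 + K)) / t)"]
        tendsto_intros ln_power_div_tendsto_0) auto
  then have "y T * T powr m \<le> 0" by simp
  then have "y T = 0" using y_nonneg[of T] T(1) by (simp add: mult_le_0_iff)
  then show ?thesis using y_eq_0_backward[OF TT0] s T(2) by simp
qed


section \<open>Uniqueness\<close>

theorem theorem1p6:
  fixes B :: real and N :: nat and C :: "nat \<Rightarrow> real"
    and \<nu>s \<nu>f \<nu>r \<nu>p :: "nat \<Rightarrow> nat"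
  assumes "B > 0" and "N \<ge> 6"
    and "exponent_seq \<nu>s" and "exponent_seq \<nu>f" and "exponent_seq \<nu>r" and "exponent_seq \<nu>p"
  shows "\<exists>\<nu> (Kfun :: real \<Rightarrow> nat). exponent_seq \<nu> \<and>
    (\<forall>f_inf phi_inf fc rhoc phic T0 f \<rho> \<phi>.
       scattering_data B f_inf \<longrightarrow>
       poisson_solution (rho_inf f_inf) phi_inf \<longrightarrow>
       approx_coeffs B f_inf fc rhoc phic \<longrightarrow>
       T0 > 0 \<longrightarrow>
       modified_scattering_solution \<nu>s \<nu>f \<nu>r \<nu>p C B N f_inf phi_inf fc rhoc phic T0 f \<rho> \<phi> \<longrightarrow>
       (let K = Kfun (F_inf \<nu> f_inf (N + 1)) in
        \<forall>f' \<rho>' \<phi>'.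
          VP_solution T0 f' \<rho>' \<phi>' \<longrightarrow>
          (\<exists>C'. \<forall>\<^sub>F t in at_top.
             in_L2 (\<lambda>(x, p). f' t x p - f_approx phi_inf fc K t x p) \<and>
             L2norm (\<lambda>(x, p). f' t x p - f_approx phi_inf fc K t x p)
               \<le> C' * (ln t) ^ (1 + K) / t ^ (1 + K)) \<longrightarrow>
          support_property \<nu>s B f_inf phi_inf T0 f' \<longrightarrow>
          (\<forall>t\<ge>T0. f' t = f t \<and> \<rho>' t = \<rho> t \<and> \<phi>' t = \<phi> t)))"
proof -
  \<comment> \<open>\<open>X\<close> is the norm of \<open>f_inf\<close> of order \<open>N + 1\<close>; \<open>R X\<close> bounds the support radius and \<open>\<sigma> X\<close> the \<open>x\<close>-derivatives of \<open>f_inf\<close>.\<close>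
  define R where "R X = 2 * (real (card {(I, J). mabs I + mabs J \<le> 3}) * (X + X ^ \<nu>s 3)) + B" for X
  define \<sigma> where "\<sigma> X = (measure lborel (cball (0::vec3 \<times> vec3) B) + X\<^sup>2) / 2" for X :: real
  define Kfun where "Kfun X = nat \<lceil>growth_rate B (R X) (\<sigma> X)\<rceil>" for X
  show ?thesis
    unfolding Let_def
  proof (intro exI[of _ \<nu>s] exI[of _ Kfun] conjI allI impI)
    show "exponent_seq \<nu>s" by fact
    fix f_inf phi_inf fc rhoc phic T0 f \<rho> \<phi> f' \<rho>' \<phi>' t
    assume sd: "scattering_data B f_inf" and ps: "poisson_solution (rho_inf f_inf) phi_inf"
      and ac: "approx_coeffs B f_inf fc rhoc phic" and T0: "T0 > 0"
      and ms: "modified_scattering_solution \<nu>s \<nu>f \<nu>r \<nu>p C B N f_inf phi_inf fc rhoc phic T0 f \<rho> \<phi>"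
      and vp': "VP_solution T0 f' \<rho>' \<phi>'" and sp': "support_property \<nu>s B f_inf phi_inf T0 f'"
      and t: "T0 \<le> t"
    define X where "X = F_inf \<nu>s f_inf (N + 1)"
    define K where "K = Kfun X"
    assume "\<exists>C'. \<forall>\<^sub>F t in at_top.
             in_L2 (\<lambda>(x, p). f' t x p - f_approx phi_inf fc (Kfun (F_inf \<nu>s f_inf (N + 1))) t x p) \<and>
             L2norm (\<lambda>(x, p). f' t x p - f_approx phi_inf fc (Kfun (F_inf \<nu>s f_inf (N + 1))) t x p)
               \<le> C' * (ln t) ^ (1 + Kfun (F_inf \<nu>s f_inf (N + 1))) / t ^ (1 + Kfun (F_inf \<nu>s f_inf (N + 1)))"
    then obtain C' where C': "\<forall>\<^sub>F t in at_top.
        in_L2 (\<lambda>(x, p). f' t x p - f_approx phi_inf fc K t x p) \<and>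
        L2norm (\<lambda>(x, p). f' t x p - f_approx phi_inf fc K t x p) \<le> C' * (ln t) ^ (1 + K) / t ^ (1 + K)"
      unfolding K_def X_def by blast
    note ms' = ms[unfolded modified_scattering_solution_def]
    have vpf: "VP_solution T0 f \<rho> \<phi>" and spf: "support_property \<nu>s B f_inf phi_inf T0 f"
      and fe: "f_estimate \<nu>f C N f_inf phi_inf fc T0 f" using ms' by blast+
    have \<Phi>: "smooth phi_inf" using ps by (simp add: poisson_solution_def)
    have X0: "X \<ge> 0" unfolding X_def by (rule F_inf_nonneg)
    have RX: "2 * F_inf \<nu>s f_inf 3 + B \<le> R X"
      unfolding R_def X_def using F_inf_le[of 3 "N + 1" \<nu>s f_inf \<nu>s] assms(2) by simp
    have BR: "B \<le> R X" using RX F_inf_nonneg[of \<nu>s f_inf 3] by linarith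
    have supp: "norm (x - t *\<^sub>R p + ln t *\<^sub>R grad phi_inf p) \<le> R X \<and> norm p \<le> 2 * B"
      if "support_property \<nu>s B f_inf phi_inf T0 h" "t \<ge> T0" "h t x p \<noteq> 0" for h t x p
    proof -
      have "(x, p) \<in> supp (\<lambda>(x, p). h t x p)"
        unfolding supp_def using that(3) by (intro subsetD[OF closure_subset]) auto
      then show ?thesis using that(1,2) RX unfolding support_property_def by fastforce
    qed
    interpret vp_pair T0 B "R X" phi_inf f f' \<rho> \<rho>' \<phi> \<phi>'
    proof
      show "R X > 0" using BR assms(1) by linarith
      show "norm (x - t *\<^sub>R p + ln t *\<^sub>R grad phi_inf p) \<le> R X \<and> norm p \<le> 2 * B"
        if "T0 \<le> t" "f t x p \<noteq> 0 \<or> f' t x p \<noteq> 0" for t x p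
        using supp[OF spf that(1)] supp[OF sp' that(1)] that(2) by blast
    qed (fact T0 assms(1) \<Phi> vpf vp')+
    have \<sigma>X: "\<bar>dird (axis i 1, 0) (case_prod f_inf) z\<bar> \<le> \<sigma> X" for i z
      unfolding \<sigma>_def X_def using assms(2) by (intro abs_dx_f_inf_le sd) simp
    have est: "in_L2 (case_prod (mpow (Lfield phi_inf t) I (mpow (scaled_dp t) J (\<lambda>x p. f t x p - f_approx phi_inf fc k t x p))))
        \<and> L2norm (case_prod (mpow (Lfield phi_inf t) I (mpow (scaled_dp t) J (\<lambda>x p. f t x p - f_approx phi_inf fc k t x p))))
         \<le> C k * (F_inf \<nu>f f_inf (N + 2 * k + 4))\<^sup>2 * (ln t) ^ (1 + k) / t ^ (1 + k)"
      if "t \<ge> T0" "mabs I + mabs J \<le> N" for t I J k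
    proof -
      let ?D = "\<lambda>I J. case_prod (mpow (Lfield phi_inf t) I (mpow (scaled_dp t) J (\<lambda>x p. f t x p - f_approx phi_inf fc k t x p)))"
      have a: "in_L2 (?D I J)" and b: "(\<Sum>(I, J)\<in>{(I, J). mabs I + mabs J \<le> N}. L2norm (?D I J))
          \<le> C k * (F_inf \<nu>f f_inf (N + 2 * k + 4))\<^sup>2 * (ln t) ^ (1 + k) / t ^ (1 + k)"
        using fe that unfolding f_estimate_def Let_def by blast+
      have "L2norm (?D I J) \<le> (\<Sum>(I, J)\<in>{(I, J). mabs I + mabs J \<le> N}. L2norm (?D I J))"
        using member_le_sum[of "(I, J)" "{(I, J). mabs I + mabs J \<le> N}" "\<lambda>(I, J). L2norm (?D I J)"]
          that(2) finite_mabs_pair_le L2norm_nonneg by (auto simp: case_prod_beta)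
      then show ?thesis using a b by linarith
    qed
    define c where "c = C 0 * (F_inf \<nu>f f_inf (N + 4))\<^sup>2"
    have est0: "L2norm (mpow (Lop phi_inf t) I (\<lambda>z. dird (0, axis i 1) (\<lambda>z. case_prod (f t) z - case_prod f_inf (shear phi_inf t z)) z / t))
        \<le> c * ln t / t" if "t \<ge> T0" "mabs I \<le> 3" for t I i
    proof -
      let ?e = "\<lambda>x p. f t x p - f_approx phi_inf fc 0 t x p"
      \<comment> \<open>The estimates with one momentum derivative and at most three of the \<open>L\<^sub>i\<close>; their total order is at most \<open>4 \<le> N\<close>.\<close>
      define J :: "nat ^ 3" where "J = (\<chi> j. if j = i then 1 else 0)"
      have J: "mabs J = 1" "mpow (scaled_dp t) J g = scaled_dp t i g" for g
      proof -
        show "mabs J = 1" by (simp add: mabs_def J_def)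
        consider "i = 1" | "i = 2" | "i = 3" using exhaust_3 by blast
        then show "mpow (scaled_dp t) J g = scaled_dp t i g" by cases (simp_all add: mpow_def J_def)
      qed
      have e: "case_prod ?e = (\<lambda>z. case_prod (f t) z - case_prod f_inf (shear phi_inf t z))"
        using f_approx_0[OF ac, of phi_inf t] by (auto simp: fun_eq_iff)
      have "case_prod (scaled_dp t i ?e) = (\<lambda>z. dird (0, axis i 1) (case_prod ?e) z / t)"
        unfolding dp_eq_dird[symmetric] by (auto simp: scaled_dp_def fun_eq_iff)
      then have "case_prod (mpow (Lfield phi_inf t) I (mpow (scaled_dp t) J ?e))
          = mpow (Lop phi_inf t) I (\<lambda>z. dird (0, axis i 1) (\<lambda>z. case_prod (f t) z - case_prod f_inf (shear phi_inf t z)) z / t)"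
        by (simp only: J mpow_case_prod[of "Lfield phi_inf t" "Lop phi_inf t", OF Lfield_eq_Lop] e)
      then show ?thesis using est[of t I J 0] that J(1) assms(2) by (simp add: c_def)
    qed
    have rate: "\<forall>\<^sub>F t in at_top. \<bar>force t\<bar> \<le> growth_rate B (R X) (\<sigma> X) / t * y t"
      by (rule force_growth_rate[OF sd BR \<sigma>X est0])
    define D where "D = C K * (F_inf \<nu>f f_inf (N + 2 * K + 4))\<^sup>2"
    have decay: "\<forall>\<^sub>F t in at_top. y t \<le> (2 * C'\<^sup>2 + 2 * D\<^sup>2) * (ln t ^ (1 + K) / t ^ (1 + K))\<^sup>2"
      using C' eventually_ge_at_top[of T0]
    proof eventually_elim
      case (elim t)
      let ?a = "\<lambda>(x, p). f' t x p - f_approx phi_inf fc K t x p" and ?b = "\<lambda>(x, p). f t x p - f_approx phi_inf fc K t x p"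
      let ?l = "ln t ^ (1 + K) / t ^ (1 + K)"
      have "mpow A 0 h = h" for A :: "3 \<Rightarrow> phase \<Rightarrow> phase" and h by (simp add: mpow_def)
      then have b: "in_L2 ?b" "L2norm ?b \<le> D * ?l"
        using est[of t 0 0 K] elim(2) by (simp_all add: D_def mabs_def)
      have a: "in_L2 ?a" "L2norm ?a \<le> C' * ?l" using elim(1) by simp_all
      have i: "integrable lborel (\<lambda>z. (?a z)\<^sup>2)" "integrable lborel (\<lambda>z. (?b z)\<^sup>2)"
        using a(1) b(1) by (simp_all add: in_L2_def)
      have "y t \<le> (LBINT z. 2 * (?a z)\<^sup>2 + 2 * (?b z)\<^sup>2)"
        unfolding y_def
      proof (rule integral_mono)
        show "integrable lborel (\<lambda>z. (g t z)\<^sup>2)"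
          using elim(2) by (intro integrable_square smooth_g bsupp_fields)
        show "integrable lborel (\<lambda>z. 2 * (?a z)\<^sup>2 + 2 * (?b z)\<^sup>2)" using i by simp
        fix z
        have "g t z = ?a z - ?b z" by (cases z) (simp add: g_def)
        moreover have "0 \<le> (?a z + ?b z)\<^sup>2" by simp
        ultimately show "(g t z)\<^sup>2 \<le> 2 * (?a z)\<^sup>2 + 2 * (?b z)\<^sup>2" by (simp only: power2_sum power2_diff)
      qed
      also have "\<dots> = 2 * (L2norm ?a)\<^sup>2 + 2 * (L2norm ?b)\<^sup>2" unfolding L2norm_power2 using i by simp
      also have "\<dots> \<le> 2 * (C' * ?l)\<^sup>2 + 2 * (D * ?l)\<^sup>2"
        using power_mono[OF a(2) L2norm_nonneg, of 2] power_mono[OF b(2) L2norm_nonneg, of 2] by linarith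
      also have "\<dots> = (2 * C'\<^sup>2 + 2 * D\<^sup>2) * ?l\<^sup>2" by (simp only: power_mult_distrib distrib_right mult.assoc)
      finally show ?case .
    qed
    have "growth_rate B (R X) (\<sigma> X) \<le> real K" unfolding K_def Kfun_def by linarith
    then have "y t = 0" by (rule y_eq_0_if_fast_decay[OF rate decay _ t])
    then show "f' t = f t" "\<rho>' t = \<rho> t" "\<phi>' t = \<phi> t" using solutions_agree[OF t] by blast+
  qed
qed

end
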